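(* Let $n\ge 1$. In the polynomial ring $\mathbb{Z}[a,b,c]$ we have $$\sum_{E_*} a^{p(E_* )}b^{q(E_* )}c^{r(E_* )}=c\prod_{j=1}^{n-1}\bigl(ja+(n-j)b+c\bigr)=c\,(a+(n-1)b+c)(2a+(n-2)b+c)\cdots((n-1)a+b+c),$$ where the sum is over all complete exceptional sequences $E_*$ (up to isomorphism) for the linear quiver of type $A_n$ with straight orientation, and - $p(E_* )$ is the number of objects of $E_*$ which are relatively projective but not relatively injective, - $q(E_* )$ is the number of objects of $E_*$ which are relatively injective but not relatively projective, - $r(E_* )$ is the number of objects of $E_*$ which are both relatively projective and relatively injective.
   Context: Let $K$ be a field, $Q: 1\to 2\to\cdots\to n$, $\Lambda=KQ$; modules are finite-dimensional representations of $Q$ over $K$, and $\mathrm{Ext}$ means $\mathrm{Ext}^1_\Lambda$. A complete exceptional sequence is a sequence $(E_1,\dots,E_n)$ of rigid indecomposable modules such that $\mathrm{Hom}(E_j,E_i)=0=\mathrm{Ext}(E_j,E_i)$ for all $i<j$; sequences are counted up to isomorphism of their terms. For a module $Z$, $Z^\perp$ is the full subcategory of modules $Y$ with $\mathrm{Hom}(Z,Y)=0=\mathrm{Ext}(Z,Y)$, and ${}^\perp Z$ is the full subcategory of modules $X$ with $\mathrm{Hom}(X,Z)=0=\mathrm{Ext}(X,Z)$. $E_i$ is relatively projective in the sequence if it is a projective object of $(E_{i+1}\oplus\cdots\oplus E_n)^\perp$, and relatively injective if it is an injective object of ${}^\perp(E_1\oplus\cdots\oplus E_{i-1})$. *)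

theory Defs
  imports
    "Jordan_Normal_Form.Matrix_Kernel"
    "HOL-Library.Poly_Mapping"
begin

section \<open>Finite-dimensional representations of the quiver 1 \<open>\<rightarrow>\<close> 2 \<open>\<rightarrow>\<close> ... \<open>\<rightarrow>\<close> n\<close>

text \<open>
  A finite-dimensional representation over the field \<open>'k\<close> is given in coordinates: the space at
  vertex \<open>i \<in> {1..n}\<close> is \<open>carrier_vec (dimv V i)\<close>, and \<open>arr V i\<close> is the matrix of the linear map
  belonging to the arrow \<open>i \<rightarrow> i + 1\<close>. Choosing bases shows that every finite-dimensional
  representation is isomorphic to one of this form. The values of \<open>dimv V\<close> outside \<open>{1..n}\<close> and of
  \<open>arr V\<close> outside \<open>{1..<n}\<close> carry no information; they are ignored by all notions below.
\<close>

datatype 'k qrep = QRep (dimv: "nat \<Rightarrow> nat") (arr: "nat \<Rightarrow> 'k mat")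

definition is_rep :: "nat \<Rightarrow> 'k::field qrep \<Rightarrow> bool" where
  "is_rep n V \<longleftrightarrow> (\<forall>i\<in>{1..<n}. arr V i \<in> carrier_mat (dimv V (Suc i)) (dimv V i))"

text \<open>
  Morphisms are extensional families indexed by the vertices, so that equality of
  morphisms is equality in HOL.
\<close>

definition Hom :: "nat \<Rightarrow> 'k::field qrep \<Rightarrow> 'k qrep \<Rightarrow> (nat \<Rightarrow> 'k mat) set" where
  "Hom n X Y = {f \<in> (\<Pi>\<^sub>E i\<in>{1..n}. carrier_mat (dimv Y i) (dimv X i)).
     \<forall>i\<in>{1..<n}. f (Suc i) * arr X i = arr Y i * f i}"

definition id_hom :: "nat \<Rightarrow> 'k::field qrep \<Rightarrow> nat \<Rightarrow> 'k mat" where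
  "id_hom n X = (\<lambda>i\<in>{1..n}. 1\<^sub>m (dimv X i))"

definition zero_hom :: "nat \<Rightarrow> 'k::field qrep \<Rightarrow> 'k qrep \<Rightarrow> nat \<Rightarrow> 'k mat" where
  "zero_hom n X Y = (\<lambda>i\<in>{1..n}. 0\<^sub>m (dimv Y i) (dimv X i))"

definition comp_hom ::
  "nat \<Rightarrow> (nat \<Rightarrow> 'k::field mat) \<Rightarrow> (nat \<Rightarrow> 'k mat) \<Rightarrow> nat \<Rightarrow> 'k mat" where
  "comp_hom n g f = (\<lambda>i\<in>{1..n}. g i * f i)"

definition is_iso :: "nat \<Rightarrow> 'k::field qrep \<Rightarrow> 'k qrep \<Rightarrow> (nat \<Rightarrow> 'k mat) \<Rightarrow> bool" where
  "is_iso n X Y f \<longleftrightarrow> f \<in> Hom n X Y \<and>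
     (\<exists>g\<in>Hom n Y X. comp_hom n g f = id_hom n X \<and> comp_hom n f g = id_hom n Y)"

definition isomorphic :: "nat \<Rightarrow> 'k::field qrep \<Rightarrow> 'k qrep \<Rightarrow> bool" where
  "isomorphic n X Y \<longleftrightarrow> is_rep n X \<and> is_rep n Y \<and> (\<exists>f. is_iso n X Y f)"

definition is_zero :: "nat \<Rightarrow> 'k::field qrep \<Rightarrow> bool" where
  "is_zero n X \<longleftrightarrow> (\<forall>i\<in>{1..n}. dimv X i = 0)"

definition direct_sum :: "'k::field qrep list \<Rightarrow> 'k qrep" where
  "direct_sum Xs = QRep (\<lambda>i. \<Sum>X\<leftarrow>Xs. dimv X i) (\<lambda>i. diag_block_mat (map (\<lambda>X. arr X i) Xs))"

definition indecomposable :: "nat \<Rightarrow> 'k::field qrep \<Rightarrow> bool" where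
  "indecomposable n M \<longleftrightarrow> is_rep n M \<and> \<not> is_zero n M \<and>
     (\<forall>X Y. is_rep n X \<longrightarrow> is_rep n Y \<longrightarrow> isomorphic n M (direct_sum [X, Y]) \<longrightarrow>
        is_zero n X \<or> is_zero n Y)"


section \<open>Extensions\<close>

definition short_exact ::
  "nat \<Rightarrow> 'k::field qrep \<Rightarrow> 'k qrep \<Rightarrow> 'k qrep \<Rightarrow> (nat \<Rightarrow> 'k mat) \<Rightarrow> (nat \<Rightarrow> 'k mat) \<Rightarrow> bool" where
  "short_exact n Y E X f g \<longleftrightarrow> f \<in> Hom n Y E \<and> g \<in> Hom n E X \<and>
     (\<forall>i\<in>{1..n}.
        inj_on (\<lambda>v. f i *\<^sub>v v) (carrier_vec (dimv Y i)) \<and>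
        (\<lambda>v. f i *\<^sub>v v) ` carrier_vec (dimv Y i) = mat_kernel (g i) \<and>
        (\<lambda>v. g i *\<^sub>v v) ` carrier_vec (dimv E i) = carrier_vec (dimv X i))"

text \<open>\<open>Ext1 n X Y\<close> is Yoneda's group of extensions \<open>0 \<rightarrow> Y \<rightarrow> E \<rightarrow> X \<rightarrow> 0\<close> up to equivalence.\<close>

type_synonym 'k extension = "'k qrep \<times> (nat \<Rightarrow> 'k mat) \<times> (nat \<Rightarrow> 'k mat)"

definition extensions :: "nat \<Rightarrow> 'k::field qrep \<Rightarrow> 'k qrep \<Rightarrow> 'k extension set" where
  "extensions n X Y = {(E, f, g). is_rep n E \<and> short_exact n Y E X f g}"

definition ext_equiv :: "nat \<Rightarrow> 'k::field qrep \<Rightarrow> 'k qrep \<Rightarrow> ('k extension \<times> 'k extension) set" where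
  "ext_equiv n X Y = {((E, f, g), (E', f', g')).
     (E, f, g) \<in> extensions n X Y \<and> (E', f', g') \<in> extensions n X Y \<and>
     (\<exists>h. is_iso n E E' h \<and> comp_hom n h f = f' \<and> comp_hom n g' h = g)}"

definition Ext1 :: "nat \<Rightarrow> 'k::field qrep \<Rightarrow> 'k qrep \<Rightarrow> 'k extension set set" where
  "Ext1 n X Y = extensions n X Y // ext_equiv n X Y"

definition Hom_vanishes :: "nat \<Rightarrow> 'k::field qrep \<Rightarrow> 'k qrep \<Rightarrow> bool" where
  "Hom_vanishes n X Y \<longleftrightarrow> Hom n X Y = {zero_hom n X Y}"

text \<open>
  The zero element of \<open>Ext1 n X Y\<close> is the class of the split extension, so the group
  is zero precisely when it has a single element.
\<close>

definition Ext_vanishes :: "nat \<Rightarrow> 'k::field qrep \<Rightarrow> 'k qrep \<Rightarrow> bool" where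
  "Ext_vanishes n X Y \<longleftrightarrow> is_singleton (Ext1 n X Y)"

definition rigid :: "nat \<Rightarrow> 'k::field qrep \<Rightarrow> bool" where
  "rigid n M \<longleftrightarrow> Ext_vanishes n M M"


section \<open>Perpendicular categories\<close>

text \<open>A full subcategory is represented by the set of its objects.\<close>

definition right_perp :: "nat \<Rightarrow> 'k::field qrep \<Rightarrow> 'k qrep set" where
  "right_perp n Z = {Y. is_rep n Y \<and> Hom_vanishes n Z Y \<and> Ext_vanishes n Z Y}"

definition left_perp :: "nat \<Rightarrow> 'k::field qrep \<Rightarrow> 'k qrep set" where
  "left_perp n Z = {X. is_rep n X \<and> Hom_vanishes n X Z \<and> Ext_vanishes n X Z}"

text \<open>
  Epimorphisms, monomorphisms, projective and injective objects are meant in the categorical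
  sense inside the full subcategory \<open>C\<close>, not in the ambient category of all representations.
\<close>

definition is_epi_in ::
  "nat \<Rightarrow> 'k::field qrep set \<Rightarrow> 'k qrep \<Rightarrow> 'k qrep \<Rightarrow> (nat \<Rightarrow> 'k mat) \<Rightarrow> bool" where
  "is_epi_in n C X Y g \<longleftrightarrow> g \<in> Hom n X Y \<and>
     (\<forall>W\<in>C. \<forall>u\<in>Hom n Y W. \<forall>v\<in>Hom n Y W. comp_hom n u g = comp_hom n v g \<longrightarrow> u = v)"

definition is_mono_in ::
  "nat \<Rightarrow> 'k::field qrep set \<Rightarrow> 'k qrep \<Rightarrow> 'k qrep \<Rightarrow> (nat \<Rightarrow> 'k mat) \<Rightarrow> bool" where
  "is_mono_in n C X Y f \<longleftrightarrow> f \<in> Hom n X Y \<and>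
     (\<forall>W\<in>C. \<forall>u\<in>Hom n W X. \<forall>v\<in>Hom n W X. comp_hom n f u = comp_hom n f v \<longrightarrow> u = v)"

definition projective_in :: "nat \<Rightarrow> 'k::field qrep set \<Rightarrow> 'k qrep \<Rightarrow> bool" where
  "projective_in n C P \<longleftrightarrow> P \<in> C \<and>
     (\<forall>X\<in>C. \<forall>Y\<in>C. \<forall>g. is_epi_in n C X Y g \<longrightarrow>
        (\<forall>h\<in>Hom n P Y. \<exists>k\<in>Hom n P X. comp_hom n g k = h))"

definition injective_in :: "nat \<Rightarrow> 'k::field qrep set \<Rightarrow> 'k qrep \<Rightarrow> bool" where
  "injective_in n C I \<longleftrightarrow> I \<in> C \<and>
     (\<forall>X\<in>C. \<forall>Y\<in>C. \<forall>f. is_mono_in n C X Y f \<longrightarrow>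
        (\<forall>h\<in>Hom n X I. \<exists>k\<in>Hom n Y I. comp_hom n k f = h))"


section \<open>Complete exceptional sequences\<close>

text \<open>List positions start at 0: the entry \<open>Es ! i\<close> is the object with index \<open>i + 1\<close>.\<close>

definition complete_exceptional :: "nat \<Rightarrow> 'k::field qrep list \<Rightarrow> bool" where
  "complete_exceptional n Es \<longleftrightarrow> length Es = n \<and>
     (\<forall>E\<in>set Es. is_rep n E \<and> rigid n E \<and> indecomposable n E) \<and>
     (\<forall>j<n. \<forall>i<j. Hom_vanishes n (Es ! j) (Es ! i) \<and> Ext_vanishes n (Es ! j) (Es ! i))"

definition rel_projective :: "nat \<Rightarrow> 'k::field qrep list \<Rightarrow> nat \<Rightarrow> bool" where
  "rel_projective n Es i \<longleftrightarrow>
     projective_in n (right_perp n (direct_sum (drop (Suc i) Es))) (Es ! i)"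

definition rel_injective :: "nat \<Rightarrow> 'k::field qrep list \<Rightarrow> nat \<Rightarrow> bool" where
  "rel_injective n Es i \<longleftrightarrow>
     injective_in n (left_perp n (direct_sum (take i Es))) (Es ! i)"

definition num_p :: "nat \<Rightarrow> 'k::field qrep list \<Rightarrow> nat" where
  "num_p n Es = card {i. i < length Es \<and> rel_projective n Es i \<and> \<not> rel_injective n Es i}"

definition num_q :: "nat \<Rightarrow> 'k::field qrep list \<Rightarrow> nat" where
  "num_q n Es = card {i. i < length Es \<and> rel_injective n Es i \<and> \<not> rel_projective n Es i}"

definition num_r :: "nat \<Rightarrow> 'k::field qrep list \<Rightarrow> nat" where
  "num_r n Es = card {i. i < length Es \<and> rel_projective n Es i \<and> rel_injective n Es i}"

definition seq_iso :: "nat \<Rightarrow> ('k::field qrep list \<times> 'k qrep list) set" where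
  "seq_iso n = {(Es, Fs). complete_exceptional n Es \<and> complete_exceptional n Fs \<and>
     list_all2 (isomorphic n) Es Fs}"

definition exceptional_classes :: "nat \<Rightarrow> 'k::field qrep list set set" where
  "exceptional_classes n = {Es. complete_exceptional n Es} // seq_iso n"

text \<open>
  \<open>num_p\<close>, \<open>num_q\<close> and \<open>num_r\<close> are invariant under \<open>seq_iso\<close>; sums over \<open>exceptional_classes\<close>
  evaluate them at the following representative.
\<close>

definition class_rep :: "'k::field qrep list set \<Rightarrow> 'k qrep list" where
  "class_rep C = (SOME Es. Es \<in> C)"


section \<open>The polynomial ring in three variables over the integers\<close>

datatype indet = Ind_a | Ind_b | Ind_c

text \<open>Finitely supported functions from monomials (exponent vectors) to integer coefficients.\<close>

type_synonym zabc = "(indet \<Rightarrow>\<^sub>0 nat) \<Rightarrow>\<^sub>0 int"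

definition var :: "indet \<Rightarrow> zabc" where
  "var x = Poly_Mapping.single (Poly_Mapping.single x 1) 1"


section \<open>The quotients are taken by equivalence relations\<close>

lemma Hom_carrier: "f \<in> Hom n X Y \<Longrightarrow> i \<in> {1..n} \<Longrightarrow> f i \<in> carrier_mat (dimv Y i) (dimv X i)"
  by (auto simp: Hom_def PiE_def Pi_def)

lemma Hom_ext: "f \<in> Hom n X Y \<Longrightarrow> (\<lambda>i\<in>{1..n}. f i) = f"
  by (auto simp: Hom_def PiE_def extensional_restrict)

lemma id_hom_in_Hom: "is_rep n X \<Longrightarrow> id_hom n X \<in> Hom n X X"
  by (auto simp: Hom_def id_hom_def is_rep_def)

lemma comp_hom_in_Hom:
  assumes X: "is_rep n X" and Y: "is_rep n Y" and Z: "is_rep n Z"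
    and f: "f \<in> Hom n X Y" and g: "g \<in> Hom n Y Z"
  shows "comp_hom n g f \<in> Hom n X Z"
proof -
  have "(g (Suc i) * f (Suc i)) * arr X i = arr Z i * (g i * f i)" if i: "i \<in> {1..<n}" for i
  proof -
    have i': "i \<in> {1..n}" "Suc i \<in> {1..n}" using i by auto
    note c = Hom_carrier[OF f i'(1)] Hom_carrier[OF f i'(2)]
      Hom_carrier[OF g i'(1)] Hom_carrier[OF g i'(2)]
    have a: "arr X i \<in> carrier_mat (dimv X (Suc i)) (dimv X i)"
      "arr Y i \<in> carrier_mat (dimv Y (Suc i)) (dimv Y i)"
      "arr Z i \<in> carrier_mat (dimv Z (Suc i)) (dimv Z i)"
      using X Y Z i by (auto simp: is_rep_def)
    have fc: "f (Suc i) * arr X i = arr Y i * f i" and gc: "g (Suc i) * arr Y i = arr Z i * g i"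
      using f g i by (auto simp: Hom_def)
    have "(g (Suc i) * f (Suc i)) * arr X i = g (Suc i) * (arr Y i * f i)"
      using assoc_mult_mat[OF c(4) c(2) a(1)] fc by simp
    also have "\<dots> = (arr Z i * g i) * f i"
      using assoc_mult_mat[OF c(4) a(2) c(1)] gc by simp
    also have "\<dots> = arr Z i * (g i * f i)"
      by (rule assoc_mult_mat[OF a(3) c(3) c(1)])
    finally show ?thesis .
  qed
  moreover have "g i * f i \<in> carrier_mat (dimv Z i) (dimv X i)" if "i \<in> {1..n}" for i
    using Hom_carrier[OF f that] Hom_carrier[OF g that] by (rule mult_carrier_mat[rotated])
  ultimately show ?thesis
    by (auto simp: Hom_def comp_hom_def)
qed

lemma comp_hom_assoc:
  assumes "f \<in> Hom n W X" "g \<in> Hom n X Y" "h \<in> Hom n Y Z"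
  shows "comp_hom n (comp_hom n h g) f = comp_hom n h (comp_hom n g f)"
  using assoc_mult_mat[OF Hom_carrier[OF assms(3)] Hom_carrier[OF assms(2)] Hom_carrier[OF assms(1)]]
  by (auto simp: comp_hom_def fun_eq_iff restrict_def)

lemma comp_id_hom:
  assumes "f \<in> Hom n X Y"
  shows "comp_hom n f (id_hom n X) = f" "comp_hom n (id_hom n Y) f = f"
proof -
  have "f i * 1\<^sub>m (dimv X i) = f i \<and> 1\<^sub>m (dimv Y i) * f i = f i" if "i \<in> {1..n}" for i
    using Hom_carrier[OF assms that] by simp
  then have "comp_hom n f (id_hom n X) = (\<lambda>i\<in>{1..n}. f i)"
    "comp_hom n (id_hom n Y) f = (\<lambda>i\<in>{1..n}. f i)"
    by (auto simp: comp_hom_def id_hom_def fun_eq_iff restrict_def)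
  then show "comp_hom n f (id_hom n X) = f" "comp_hom n (id_hom n Y) f = f"
    unfolding Hom_ext[OF assms] .
qed

lemma is_iso_id: "is_rep n X \<Longrightarrow> is_iso n X X (id_hom n X)"
  using comp_id_hom[OF id_hom_in_Hom] id_hom_in_Hom unfolding is_iso_def by blast

lemma is_iso_comp:
  assumes r: "is_rep n X" "is_rep n Y" "is_rep n Z" and "is_iso n X Y f" "is_iso n Y Z g"
  shows "is_iso n X Z (comp_hom n g f)"
proof -
  obtain f' g' where f: "f \<in> Hom n X Y" and f': "f' \<in> Hom n Y X"
    and ff: "comp_hom n f' f = id_hom n X" "comp_hom n f f' = id_hom n Y"
    and g: "g \<in> Hom n Y Z" and g': "g' \<in> Hom n Z Y"
    and gg: "comp_hom n g' g = id_hom n Y" "comp_hom n g g' = id_hom n Z"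
    using assms by (auto simp: is_iso_def)
  have gf: "comp_hom n g f \<in> Hom n X Z" and fg: "comp_hom n f' g' \<in> Hom n Z X"
    using comp_hom_in_Hom r f g f' g' by blast+
  have "comp_hom n (comp_hom n f' g') (comp_hom n g f) = id_hom n X"
    using comp_hom_assoc[OF gf g' f'] comp_hom_assoc[OF f g g'] gg ff comp_id_hom[OF f] by simp
  moreover have "comp_hom n (comp_hom n g f) (comp_hom n f' g') = id_hom n Z"
    using comp_hom_assoc[OF fg f g] comp_hom_assoc[OF g' f' f] gg ff comp_id_hom[OF g'] by simp
  ultimately show ?thesis using gf fg by (auto simp: is_iso_def)
qed

lemma isomorphic_refl: "is_rep n X \<Longrightarrow> isomorphic n X X"
  using is_iso_id by (auto simp: isomorphic_def)

lemma isomorphic_sym: "isomorphic n X Y \<Longrightarrow> isomorphic n Y X"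
  by (auto simp: isomorphic_def is_iso_def)

lemma isomorphic_trans: "isomorphic n X Y \<Longrightarrow> isomorphic n Y Z \<Longrightarrow> isomorphic n X Z"
  unfolding isomorphic_def using is_iso_comp by blast

lemma equiv_seq_iso: "equiv {Es. complete_exceptional n Es} (seq_iso n)"
proof (rule equivI)
  show "refl_on {Es. complete_exceptional n Es} (seq_iso n)"
    by (auto simp: refl_on_def seq_iso_def complete_exceptional_def
        intro!: list.rel_refl_strong isomorphic_refl)
  show "sym (seq_iso n)"
    by (auto simp: sym_def seq_iso_def list_all2_conv_all_nth isomorphic_sym)
  show "trans (seq_iso n)"
    by (auto simp: trans_def seq_iso_def intro: list_all2_trans[OF isomorphic_trans])
qed (auto simp: seq_iso_def)

lemma equiv_ext_equiv: "equiv (extensions n X Y) (ext_equiv n X Y)"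
proof (rule equivI)
  show "refl_on (extensions n X Y) (ext_equiv n X Y)"
  proof (rule refl_onI)
    fix e assume e: "e \<in> extensions n X Y"
    obtain E f g where E: "e = (E, f, g)" by (metis prod_cases3)
    have r: "is_rep n E" and H: "f \<in> Hom n Y E" "g \<in> Hom n E X"
      using e by (auto simp: E extensions_def short_exact_def)
    show "(e, e) \<in> ext_equiv n X Y"
      using e is_iso_id[OF r] comp_id_hom(2)[OF H(1)] comp_id_hom(1)[OF H(2)]
      by (auto simp: E ext_equiv_def)
  qed
next
  show "sym (ext_equiv n X Y)"
  proof (rule symI)
    fix e e' assume ee: "(e, e') \<in> ext_equiv n X Y"
    obtain E f g E' f' g' where e: "e = (E, f, g)" "e' = (E', f', g')"
      by (metis prod_cases3)
    obtain h where h: "is_iso n E E' h" "comp_hom n h f = f'" "comp_hom n g' h = g"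
      using ee by (auto simp: ext_equiv_def e)
    then obtain k where k: "h \<in> Hom n E E'" "k \<in> Hom n E' E"
      "comp_hom n k h = id_hom n E" "comp_hom n h k = id_hom n E'"
      by (auto simp: is_iso_def)
    have H: "f \<in> Hom n Y E" "g' \<in> Hom n E' X"
      using ee by (auto simp: ext_equiv_def e extensions_def short_exact_def)
    have "is_iso n E' E k" using k by (auto simp: is_iso_def)
    moreover have "comp_hom n k f' = f"
      using comp_hom_assoc[OF H(1) k(1) k(2)] h k comp_id_hom[OF H(1)] by simp
    moreover have "comp_hom n g k = g'"
      using comp_hom_assoc[OF k(2) k(1) H(2)] h k comp_id_hom[OF H(2)] by simp
    ultimately show "(e', e) \<in> ext_equiv n X Y"
      using ee by (auto simp: ext_equiv_def e)
  qed
next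
  show "trans (ext_equiv n X Y)"
  proof (rule transI)
    fix e1 e2 e3 assume ee: "(e1, e2) \<in> ext_equiv n X Y" "(e2, e3) \<in> ext_equiv n X Y"
    obtain E1 f1 g1 E2 f2 g2 E3 f3 g3
      where e: "e1 = (E1, f1, g1)" "e2 = (E2, f2, g2)" "e3 = (E3, f3, g3)"
      by (metis prod_cases3)
    obtain h k where h: "is_iso n E1 E2 h" "comp_hom n h f1 = f2" "comp_hom n g2 h = g1"
      and k: "is_iso n E2 E3 k" "comp_hom n k f2 = f3" "comp_hom n g3 k = g2"
      using ee by (auto simp: ext_equiv_def e)
    have r: "is_rep n E1" "is_rep n E2" "is_rep n E3"
      and H: "f1 \<in> Hom n Y E1" "g3 \<in> Hom n E3 X"
      using ee by (auto simp: ext_equiv_def e extensions_def short_exact_def)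
    have hk: "h \<in> Hom n E1 E2" "k \<in> Hom n E2 E3" using h k by (auto simp: is_iso_def)
    have "is_iso n E1 E3 (comp_hom n k h)" by (rule is_iso_comp[OF r h(1) k(1)])
    moreover have "comp_hom n (comp_hom n k h) f1 = f3"
      using comp_hom_assoc[OF H(1) hk] h k by simp
    moreover have "comp_hom n g3 (comp_hom n k h) = g1"
      using comp_hom_assoc[OF hk H(2)] h k by simp
    ultimately show "(e1, e3) \<in> ext_equiv n X Y"
      using ee by (auto simp: ext_equiv_def e)
  qed
qed (auto simp: ext_equiv_def)

end

theory Submission
  imports Defs
begin

text \<open>
  Write the interval module with support \<open>{p..<q}\<close> as the chord \<open>(p, q)\<close> on the vertices
  \<open>1, ..., n + 1\<close>. With the convention \<open>Y (n + 1) = 0\<close>, the groups \<open>Hom\<close> and \<open>Ext\<close> from this module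
  to \<open>Y\<close> both vanish iff the map \<open>Y p \<rightarrow> Y q\<close> is bijective. Hence a sequence of chords \<open>(p i, q i)\<close> is a
  complete exceptional sequence iff, for \<open>i < j\<close>, the interval \<open>{p i..<q i}\<close> contains both or none of
  \<open>p j\<close> and \<open>q j\<close>. A chord fails to be relatively projective iff some longer module with the same top
  lies in the perpendicular category of the later chords; if there is none, following the later chords
  upwards from \<open>q\<close> shows that \<open>Y q = 0\<close> for all \<open>Y\<close> in this category, or yields a natural section of
  \<open>Y p \<rightarrow> Y q\<close>, and either one lets morphisms out of the chord be lifted. Relative injectivity is dual.

  The first chord \<open>(p, q)\<close> splits the vertices into \<open>{p..<q}\<close> and the rest, and the sequence into a
  shuffle of complete sequences on these two sets; in the first part every object that is both
  relatively projective and injective becomes relatively injective only. So the generating functions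
  \<open>A n c\<close> satisfy \<open>A (n + 1) c = (\<Sum>k\<le>n. (n choose k) * A k b * (c + (n - k) * a) * A (n - k) c)\<close>,
  which is an Abel-type identity for the product on the right-hand side of the theorem.
\<close>

section \<open>An Abel-type product identity\<close>

text \<open>Completeness enters through a count: \<open>n\<close> chords on \<open>n + 1\<close>
  vertices form a tree, so a set of vertices that contains both or neither end of every chord is
  everything or empty. Applied to the chords outside the first chord, this shows that the first
  chord is always relatively projective. It is relatively injective iff it starts at the least
  vertex. Of the chords with \<open>k + 1\<close> vertices in \<open>{p..<q}\<close> one does and
  \<open>n - k\<close> do not, hence the factor \<open>c + (n - k) * a\<close>; the binomial
  coefficient counts the shuffles. For the chords inside, \<open>q\<close> is a new candidate for a
  witness against relative projectivity, which is how \<open>c\<close> gets replaced by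
  \<open>b\<close>. On the side of modules the obstacle is that epimorphisms are those of the
  perpendicular category. They turn out to be surjective at every vertex because the category
  contains their cokernels. The linear algebra is mostly done by equations between matrices with
  explicit one-sided inverses rather than by subspaces and bases.\<close>

definition falling_prod :: "'a::comm_ring_1 \<Rightarrow> 'a \<Rightarrow> nat \<Rightarrow> 'a \<Rightarrow> 'a" where
  "falling_prod a b N x = (\<Prod>j=1..N. x + of_nat j * a + of_nat (N - j) * b)"

text \<open>For \<open>a = b\<close> and \<open>N \<ge> 1\<close> this is the Abel polynomial
  \<open>x * (x + N * a) ^ (N - 1)\<close>, and \<open>falling_prod\<close> is
  \<open>(x + N * a) ^ N\<close>; for \<open>b = 0\<close> it is the rising factorial with step
  \<open>a\<close>. As polynomials in \<open>x\<close> these products are of binomial type, which is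
  why they solve a recursion that counts shuffles.\<close>

definition abel_prod :: "'a::comm_ring_1 \<Rightarrow> 'a \<Rightarrow> nat \<Rightarrow> 'a \<Rightarrow> 'a" where
  "abel_prod a b N x = (if N = 0 then 1 else x * falling_prod a b (N - 1) (x + b))"

lemma abel_prod_0 [simp]: "abel_prod a b 0 x = 1"
  and abel_prod_Suc: "abel_prod a b (Suc N) x = x * falling_prod a b N (x + b)"
  by (simp_all add: abel_prod_def)

lemma falling_prod_0 [simp]: "falling_prod a b 0 x = 1"
  by (simp add: falling_prod_def)

text \<open>Once the factor for \<open>j = Suc N\<close> is split off, every remaining multiple of
  \<open>b\<close> is one too large for length \<open>N\<close>; the excess goes into the argument
  \<open>x + b\<close>.\<close>

lemma falling_prod_Suc:
  "falling_prod a b (Suc N) x = (x + of_nat (Suc N) * a) * falling_prod a b N (x + b)"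
proof -
  have "x + of_nat j * a + of_nat (Suc N - j) * b = x + b + of_nat j * a + of_nat (N - j) * b"
    if "j \<in> {1..N}" for j
    using that by (simp add: Suc_diff_le algebra_simps)
  then have "(\<Prod>j=1..N. x + of_nat j * a + of_nat (Suc N - j) * b) = falling_prod a b N (x + b)"
    unfolding falling_prod_def by (intro prod.cong) auto
  then show ?thesis
    by (simp add: falling_prod_def algebra_simps)
qed

text \<open>Used in the recursion to turn the total weight of the first chord, times a product of
  Abel type, into a single \<open>falling_prod\<close>.\<close>

lemma falling_prod_abel: "(x + of_nat N * a) * abel_prod a b N x = x * falling_prod a b N x"
  by (cases N) (simp_all add: abel_prod_Suc falling_prod_Suc algebra_simps)

text \<open>The two convolution identities are proved by a simultaneous induction.\<close>

lemma falling_prod_add_imp_abel_prod_add: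
  fixes a b :: "'a::comm_ring_1"
  assumes IH: "\<And>x y. falling_prod a b N (x + y) =
    (\<Sum>k\<le>N. of_nat (N choose k) * abel_prod a b k y * falling_prod a b (N - k) x)"
  shows "abel_prod a b (Suc N) (x + y) =
    (\<Sum>k\<le>Suc N. of_nat (Suc N choose k) * abel_prod a b k y * abel_prod a b (Suc N - k) x)"
proof -
  let ?A = "abel_prod a b" and ?P = "falling_prod a b"
  \<comment> \<open>Pascal's rule will split the sum into the sums of \<open>1\<close> and
    \<open>2\<close>. Each is the assumed identity with one argument shifted by \<open>b\<close>;
    for \<open>2\<close> the summation is reversed, which exchanges \<open>x\<close> and
    \<open>y\<close>.\<close>
  have 1: "(\<Sum>k\<le>N. of_nat (N choose k) * ?A k y * ?A (Suc N - k) x) = x * ?P N (x + y + b)"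
  proof -
    have "(\<Sum>k\<le>N. of_nat (N choose k) * ?A k y * ?A (Suc N - k) x) =
        (\<Sum>k\<le>N. x * (of_nat (N choose k) * ?A k y * ?P (N - k) (x + b)))"
      by (intro sum.cong refl) (simp add: Suc_diff_le abel_prod_Suc algebra_simps)
    also have "\<dots> = x * ?P N (x + b + y)"
      by (simp add: IH sum_distrib_left)
    finally show ?thesis by (simp add: algebra_simps)
  qed
  have 2: "(\<Sum>k\<le>N. of_nat (N choose k) * ?A (Suc k) y * ?A (N - k) x) = y * ?P N (x + y + b)"
  proof -
    have "(\<Sum>k\<le>N. of_nat (N choose k) * ?A (Suc k) y * ?A (N - k) x) =
        (\<Sum>k\<le>N. of_nat (N choose (N - k)) * ?A (Suc (N - k)) y * ?A (N - (N - k)) x)"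
      by (rule sum.reindex_bij_witness[of _ "\<lambda>k. N - k" "\<lambda>k. N - k"]) auto
    also have "\<dots> = (\<Sum>k\<le>N. y * (of_nat (N choose k) * ?A k x * ?P (N - k) (y + b)))"
      by (intro sum.cong refl) (simp add: abel_prod_Suc binomial_symmetric[symmetric] algebra_simps)
    also have "\<dots> = y * ?P N (y + b + x)"
      by (simp add: IH sum_distrib_left)
    finally show ?thesis by (simp add: algebra_simps)
  qed
  have "(\<Sum>k\<le>Suc N. of_nat (Suc N choose k) * ?A k y * ?A (Suc N - k) x) =
      ?A (Suc N) x + (\<Sum>k\<le>N. of_nat (Suc N choose Suc k) * ?A (Suc k) y * ?A (N - k) x)"
    by (subst sum.atMost_Suc_shift) simp
  also have "\<dots> = ?A (Suc N) x + (\<Sum>k\<le>N. of_nat (N choose k) * ?A (Suc k) y * ?A (N - k) x)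
      + (\<Sum>k\<le>N. of_nat (N choose Suc k) * ?A (Suc k) y * ?A (N - k) x)"
    by (simp add: algebra_simps sum.distrib)
  also have "?A (Suc N) x + (\<Sum>k\<le>N. of_nat (N choose Suc k) * ?A (Suc k) y * ?A (N - k) x)
      = (\<Sum>k\<le>Suc N. of_nat (N choose k) * ?A k y * ?A (Suc N - k) x)"
    by (subst sum.atMost_Suc_shift) simp
  then have "?A (Suc N) x + (\<Sum>k\<le>N. of_nat (N choose k) * ?A (Suc k) y * ?A (N - k) x)
      + (\<Sum>k\<le>N. of_nat (N choose Suc k) * ?A (Suc k) y * ?A (N - k) x)
    = (\<Sum>k\<le>N. of_nat (N choose k) * ?A k y * ?A (Suc N - k) x)
      + (\<Sum>k\<le>N. of_nat (N choose k) * ?A (Suc k) y * ?A (N - k) x)"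
    by (simp add: algebra_simps binomial_eq_0)
  finally show ?thesis
    unfolding 1 2 by (simp add: abel_prod_Suc algebra_simps)
qed

text \<open>The leading factor \<open>x + (Suc N - k) * a\<close> of \<open>falling_prod\<close> is
  split. The summand \<open>x\<close> rebuilds \<open>abel_prod\<close>, to which the addition
  formula of the same length applies. In the other summand the absorption rule
  \<open>(Suc N choose k) * (Suc N - k) = Suc N * (N choose k)\<close> leaves the induction
  hypothesis at \<open>x + b\<close>.\<close>

lemma falling_prod_add:
  fixes a b :: "'a::comm_ring_1"
  shows "falling_prod a b N (x + y) =
    (\<Sum>k\<le>N. of_nat (N choose k) * abel_prod a b k y * falling_prod a b (N - k) x)"
proof (induction N arbitrary: x y)
  case 0
  show ?case by simp
next
  case (Suc N)
  let ?A = "abel_prod a b" and ?P = "falling_prod a b"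
  note B = falling_prod_add_imp_abel_prod_add[OF Suc.IH, of x y]
  have absorb: "of_nat (Suc N choose k) * of_nat (Suc N - k) =
      (of_nat (Suc N) * of_nat (N choose k) :: 'a)" if "k \<le> N" for k
  proof -
    have "(Suc N choose k) * (Suc N - k) = Suc N * (N choose k)"
      using binomial_absorb_comp[of "Suc N" k] by (simp only: mult.commute) simp
    then show ?thesis by (metis of_nat_mult)
  qed
  have P: "?P (Suc N - k) x = (x + of_nat (Suc N - k) * a) * ?P (N - k) (x + b)" if "k \<le> N" for k
    using that falling_prod_Suc[of a b "N - k" x] by (simp add: Suc_diff_le)
  have "(\<Sum>k\<le>Suc N. of_nat (Suc N choose k) * ?A k y * ?P (Suc N - k) x) =
      ?A (Suc N) y +
      (\<Sum>k\<le>N. of_nat (Suc N choose k) * ?A k y * ((x + of_nat (Suc N - k) * a) * ?P (N - k) (x + b)))"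
    using P by (simp add: add.commute)
  also have "(\<Sum>k\<le>N. of_nat (Suc N choose k) * ?A k y * ((x + of_nat (Suc N - k) * a) * ?P (N - k) (x + b)))
      = (\<Sum>k\<le>N. of_nat (Suc N choose k) * ?A k y * ?A (Suc N - k) x
        + of_nat (Suc N) * a * (of_nat (N choose k) * ?A k y * ?P (N - k) (x + b)))"
  proof (intro sum.cong refl)
    fix k assume "k \<in> {..N}"
    then have k: "k \<le> N" by simp
    have "of_nat (Suc N choose k) * ?A k y * ((x + of_nat (Suc N - k) * a) * ?P (N - k) (x + b)) =
      of_nat (Suc N choose k) * ?A k y * (x * ?P (N - k) (x + b)) +
      (of_nat (Suc N choose k) * of_nat (Suc N - k)) * ?A k y * a * ?P (N - k) (x + b)"
      by (simp only: algebra_simps)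
    then show "of_nat (Suc N choose k) * ?A k y * ((x + of_nat (Suc N - k) * a) * ?P (N - k) (x + b)) =
      of_nat (Suc N choose k) * ?A k y * ?A (Suc N - k) x
        + of_nat (Suc N) * a * (of_nat (N choose k) * ?A k y * ?P (N - k) (x + b))"
      unfolding absorb[OF k] unfolding Suc_diff_le[OF k] abel_prod_Suc by (simp only: algebra_simps)
  qed
  also have "\<dots> = (\<Sum>k\<le>N. of_nat (Suc N choose k) * ?A k y * ?A (Suc N - k) x)
      + of_nat (Suc N) * a * ?P N (x + b + y)"
    by (simp only: sum.distrib Suc.IH sum_distrib_left)
  also have "?A (Suc N) y + \<dots> = ?A (Suc N) (x + y) + of_nat (Suc N) * a * ?P N (x + b + y)"
    unfolding B by simp
  also have "\<dots> = ?P (Suc N) (x + y)"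
    unfolding falling_prod_Suc abel_prod_Suc by (simp only: algebra_simps)
  finally show ?case by simp
qed

text \<open>The addition formula of \<open>falling_prod\<close> with second argument
  \<open>b\<close>: the shift by \<open>b\<close> in \<open>abel_prod_Suc\<close> becomes the
  argument of the factor that will belong to the chords enclosed by the first one.\<close>

lemma abel_prod_recursion:
  fixes a b :: "'a::comm_ring_1"
  shows "abel_prod a b (Suc N) x = (\<Sum>k\<le>N. of_nat (N choose k) * abel_prod a b k b *
    ((x + of_nat (N - k) * a) * abel_prod a b (N - k) x))"
  unfolding falling_prod_abel abel_prod_Suc falling_prod_add sum_distrib_left
  by (intro sum.cong refl) (simp only: ac_simps)

lemma abel_prod_eq:
  assumes "N \<ge> 1"
  shows "abel_prod a b N x = x * (\<Prod>j=1..N-1. of_nat j * a + of_nat (N - j) * b + x)"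
proof -
  have "(\<Prod>j=1..N-1. of_nat j * a + of_nat (N - j) * b + x) = falling_prod a b (N - 1) (x + b)"
    unfolding falling_prod_def
  proof (rule prod.cong[OF refl])
    fix j assume "j \<in> {1..N-1}"
    then have "N - j = Suc (N - 1 - j)" by auto
    then show "of_nat j * a + of_nat (N - j) * b + x = x + b + of_nat j * a + of_nat (N - 1 - j) * b"
      by (simp add: algebra_simps)
  qed
  then show ?thesis using assms by (simp add: abel_prod_def)
qed

section \<open>Exceptional sequences of chords\<close>

definition chords :: "nat set \<Rightarrow> (nat \<times> nat) set" where
  "chords V = {(a, b). a \<in> V \<and> b \<in> V \<and> a < b}"

abbreviation chord_ivl :: "nat \<times> nat \<Rightarrow> nat set" where
  "chord_ivl p \<equiv> {fst p..<snd p}"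

definition exceptional_on :: "nat set \<Rightarrow> (nat \<Rightarrow> nat \<times> nat) \<Rightarrow> bool" where
  "exceptional_on L e \<longleftrightarrow>
     (\<forall>i\<in>L. \<forall>j\<in>L. i < j \<longrightarrow> (fst (e j) \<in> chord_ivl (e i) \<longleftrightarrow> snd (e j) \<in> chord_ivl (e i)))"

text \<open>Positions and vertices are arbitrary finite sets, since after splitting at the first
  chord neither of them need be an initial segment.\<close>

definition chord_seqs :: "nat set \<Rightarrow> nat set \<Rightarrow> (nat \<Rightarrow> nat \<times> nat) set" where
  "chord_seqs L V = {e \<in> L \<rightarrow>\<^sub>E chords V. exceptional_on L e}"

text \<open>
  Relative projectivity and injectivity of the \<open>i\<close>-th chord. A witness \<open>l\<close> against the former stands
  for an epimorphism from the interval module \<open>{fst (e i)..<l}\<close> that does not split.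
\<close>

definition chord_proj :: "nat set \<Rightarrow> nat set \<Rightarrow> (nat \<Rightarrow> nat \<times> nat) \<Rightarrow> nat \<Rightarrow> bool" where
  "chord_proj L V e i \<longleftrightarrow> \<not> (\<exists>l\<in>V. snd (e i) < l \<and> (\<forall>j\<in>L. i < j \<longrightarrow>
     (fst (e j) \<in> {snd (e i)..<l} \<longleftrightarrow> snd (e j) \<in> {snd (e i)..<l})))"

definition chord_inj :: "nat set \<Rightarrow> nat set \<Rightarrow> (nat \<Rightarrow> nat \<times> nat) \<Rightarrow> nat \<Rightarrow> bool" where
  "chord_inj L V e i \<longleftrightarrow> \<not> (\<exists>k\<in>V. k < fst (e i) \<and> (\<forall>j\<in>L. j < i \<longrightarrow>
     (fst (e j) \<in> {k<..fst (e i)} \<longleftrightarrow> snd (e j) \<in> {k<..fst (e i)})))"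

text \<open>
  For relatively projective chords this is equivalent to \<open>chord_inj\<close>; it is the condition under which
  relative projectivity gets lost when a chord enclosing the whole sequence is put in front.
\<close>

definition chord_top :: "nat set \<Rightarrow> (nat \<Rightarrow> nat \<times> nat) \<Rightarrow> nat \<Rightarrow> bool" where
  "chord_top L e i \<longleftrightarrow> (\<forall>j\<in>L. i < j \<longrightarrow> \<not> (fst (e j) < snd (e i) \<and> snd (e i) \<le> snd (e j)))"

lemma chordsD: "p \<in> chords V \<Longrightarrow> fst p \<in> V \<and> snd p \<in> V \<and> fst p < snd p"
  by (auto simp: chords_def)

lemma exceptional_on_subset: "exceptional_on L e \<Longrightarrow> S \<subseteq> L \<Longrightarrow> exceptional_on S e"
  by (auto simp: exceptional_on_def)

section \<open>Exceptional sequences of chords as forests and trees\<close>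

lemma chords_split:
  assumes fin: "finite L" "finite V" and e: "e \<in> L \<rightarrow> chords V"
    and U: "\<And>j. j \<in> L \<Longrightarrow> fst (e j) \<in> U \<longleftrightarrow> snd (e j) \<in> U"
  defines "S \<equiv> {j \<in> L. fst (e j) \<in> U}" and "T \<equiv> {j \<in> L. fst (e j) \<notin> U}"
  shows "e \<in> S \<rightarrow> chords (V \<inter> U)" "e \<in> T \<rightarrow> chords (V - U)" "card L = card S + card T"
    "card V = card (V \<inter> U) + card (V - U)"
proof -
  have c: "fst (e j) \<in> V" "snd (e j) \<in> V" "fst (e j) < snd (e j)" if "j \<in> L" for j
    using e that by (auto simp: Pi_def dest!: chordsD)
  show "e \<in> S \<rightarrow> chords (V \<inter> U)" "e \<in> T \<rightarrow> chords (V - U)"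
    using U c by (force simp: S_def T_def chords_def)+
  have "L = S \<union> T" "S \<inter> T = {}" by (auto simp: S_def T_def)
  then show "card L = card S + card T" using fin(1) by (auto intro: card_Un_disjoint)
  show "card V = card (V \<inter> U) + card (V - U)"
    using fin(2) by (metis Int_Diff_Un Int_Diff_disjoint card_Un_disjoint finite_Diff finite_Int)
qed

text \<open>The chords form a forest. The interval of the first chord contains its lower but not its
  upper end, and every other chord has both or neither end in it, so the rest falls apart into
  sequences on two nonempty smaller vertex sets. Both satisfy the strict bound; the two units gained
  pay for the removed chord with one to spare.\<close>

lemma exceptional_on_card:
  assumes "finite L" "finite V" "V \<noteq> {}" "e \<in> L \<rightarrow> chords V" "exceptional_on L e"
  shows "card L < card V"
  using assms
proof (induction "card L" arbitrary: L V rule: less_induct)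
  case less
  show ?case
  proof (cases "L = {}")
    case True
    then show ?thesis using less.prems by (simp add: card_gt_0_iff)
  next
    case False
    define i0 where "i0 = Min L"
    have i0: "i0 \<in> L" "\<And>j. j \<in> L \<Longrightarrow> j \<noteq> i0 \<Longrightarrow> i0 < j"
      using False less.prems(1) by (auto simp: i0_def order.order_iff_strict Min_le)
         (metis Min_le le_neq_implies_less)
    let ?I = "chord_ivl (e i0)" and ?L = "L - {i0}"
    have i0c: "fst (e i0) \<in> V" "snd (e i0) \<in> V" "fst (e i0) < snd (e i0)"
      using less.prems(4) i0(1) by (auto simp: Pi_def dest!: chordsD)
    have both: "fst (e j) \<in> ?I \<longleftrightarrow> snd (e j) \<in> ?I" if "j \<in> ?L" for j
      using less.prems(5) i0 that unfolding exceptional_on_def by auto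
    have L: "finite ?L" "e \<in> ?L \<rightarrow> chords V" "card L = Suc (card ?L)"
      using less.prems(1,4) card_Suc_Diff1[OF less.prems(1) i0(1)] by auto
    note sp = chords_split[OF L(1) less.prems(2) L(2) both]
    have le: "card {j \<in> ?L. Q j} < card L" "exceptional_on {j \<in> ?L. Q j} e" for Q
    proof -
      have "card {j \<in> ?L. Q j} \<le> card ?L" by (rule card_mono[OF L(1)]) auto
      then show "card {j \<in> ?L. Q j} < card L" using L(3) by simp
      show "exceptional_on {j \<in> ?L. Q j} e" by (rule exceptional_on_subset[OF less.prems(5)]) auto
    qed
    have "card {j \<in> ?L. fst (e j) \<in> ?I} < card (V \<inter> ?I)"
      by (rule less.hyps[OF le(1) _ _ _ sp(1) le(2)]) (use L(1) less.prems(2) i0c in auto)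
    moreover have "card {j \<in> ?L. fst (e j) \<notin> ?I} < card (V - ?I)"
      by (rule less.hyps[OF le(1) _ _ _ sp(2) le(2)]) (use L(1) less.prems(2) i0c in auto)
    ultimately show ?thesis using sp(3,4) L(3) by simp
  qed
qed

text \<open>The extremal case of \<open>exceptional_on_card\<close>, where the forest is a tree: if
  there were vertices on both sides of \<open>U\<close>, the bound on each side would cost two
  vertices in total, but only one is available.\<close>

lemma exceptional_on_connected:
  assumes "finite L" "finite V" "e \<in> L \<rightarrow> chords V" "exceptional_on L e" "card V = Suc (card L)"
    and U: "\<And>j. j \<in> L \<Longrightarrow> fst (e j) \<in> U \<longleftrightarrow> snd (e j) \<in> U"
  shows "V \<subseteq> U \<or> V \<inter> U = {}"
proof (rule ccontr)
  assume "\<not> ?thesis"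
  then have ne: "V \<inter> U \<noteq> {}" "V - U \<noteq> {}" by auto
  note sp = chords_split[OF assms(1-3) U]
  have "card {j \<in> L. fst (e j) \<in> U} < card (V \<inter> U)"
    by (rule exceptional_on_card[OF _ _ ne(1) sp(1) exceptional_on_subset[OF assms(4)]]) (use assms(1,2)
        in auto)
  moreover have "card {j \<in> L. fst (e j) \<notin> U} < card (V - U)"
    by (rule exceptional_on_card[OF _ _ ne(2) sp(2) exceptional_on_subset[OF assms(4)]]) (use assms(1,2)
        in auto)
  ultimately show False using assms(5) sp(3,4) by simp
qed

section \<open>Splitting off the first chord\<close>

locale chord_split =
  fixes L V :: "nat set" and e :: "nat \<Rightarrow> nat \<times> nat" and i0 a b :: nat and S T V1 V2 :: "nat set"
  assumes fin: "finite L" "finite V"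
    and i0: "i0 \<in> L" "\<And>j. j \<in> L \<Longrightarrow> j \<noteq> i0 \<Longrightarrow> i0 < j"
    and e0: "e i0 = (a, b)"
    and V1: "V1 = V \<inter> {a..<b}" and V2: "V2 = V - {a..<b}"
    and S: "S = {j \<in> L - {i0}. fst (e j) \<in> {a..<b}}"
    and T: "T = {j \<in> L - {i0}. fst (e j) \<notin> {a..<b}}"
    and chords: "e \<in> L \<rightarrow> chords V" and exc: "exceptional_on L e"
    and full: "card V = Suc (card L)"
begin

lemma finV: "finite V1" "finite V2" "finite S" "finite T"
  using fin by (auto simp: V1 V2 S T)

lemma L_eq: "L = insert i0 (S \<union> T)" "i0 \<notin> S" "i0 \<notin> T" "S \<inter> T = {}"
  using i0 by (auto simp: S T)

lemma ab: "a \<in> V" "b \<in> V" "a < b" "a \<in> V1" "b \<in> V2"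
  using chords i0(1) e0 by (auto simp: Pi_def V1 V2 dest!: chordsD bspec)

lemma split_ends: "j \<in> L \<Longrightarrow> j \<noteq> i0 \<Longrightarrow> fst (e j) \<in> {a..<b} \<longleftrightarrow> snd (e j) \<in> {a..<b}"
  using exc i0 e0 unfolding exceptional_on_def by (metis fst_conv snd_conv)

lemma chord_L: "j \<in> L \<Longrightarrow> fst (e j) \<in> V \<and> snd (e j) \<in> V \<and> fst (e j) < snd (e j)"
  using chords by (auto simp: Pi_def dest!: chordsD)

lemma chord_S: "j \<in> S \<Longrightarrow> j \<in> L \<and> j \<noteq> i0 \<and> i0 < j \<and> fst (e j) \<in> V1 \<and> snd (e j) \<in> V1 \<and>
    a \<le> fst (e j) \<and> fst (e j) < snd (e j) \<and> snd (e j) < b"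
  using split_ends[of j] chord_L[of j] i0(2)[of j] by (auto simp: S V1)

lemma chord_T: "j \<in> T \<Longrightarrow> j \<in> L \<and> j \<noteq> i0 \<and> i0 < j \<and> fst (e j) \<in> V2 \<and> snd (e j) \<in> V2 \<and>
    (fst (e j) < a \<or> b \<le> fst (e j)) \<and> (snd (e j) < a \<or> b \<le> snd (e j)) \<and> fst (e j) < snd (e j)"
  using split_ends[of j] chord_L[of j] i0(2)[of j] by (auto simp: T V2)

lemma eST: "e \<in> S \<rightarrow> chords V1" "e \<in> T \<rightarrow> chords V2"
  using chord_S chord_T by (auto simp: chords_def split: prod.splits) (metis fst_conv snd_conv)+

lemma excST: "exceptional_on S e" "exceptional_on T e"
  using exceptional_on_subset[OF exc] L_eq by auto

text \<open>Both parts satisfy the strict bound of \<open>exceptional_on_card\<close>, and the total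
  leaves no room for a larger gap in either of them.\<close>

lemma fullST: "card V1 = Suc (card S)" "card V2 = Suc (card T)"
proof -
  have "card S < card V1" "card T < card V2"
    using exceptional_on_card[OF finV(3,1) _ eST(1) excST(1)]
      exceptional_on_card[OF finV(4,2) _ eST(2) excST(2)] ab by auto
  moreover have "card V = card V1 + card V2"
    unfolding V1 V2 using fin(2)
    by (metis Int_Diff_Un Int_Diff_disjoint card_Un_disjoint finite_Diff finite_Int)
  moreover have "card L = Suc (card S + card T)"
    using L_eq finV by (simp add: card_Un_disjoint)
  ultimately show "card V1 = Suc (card S)" "card V2 = Suc (card T)"
    using full by auto
qed

lemma connected_T: "(\<And>j. j \<in> T \<Longrightarrow> fst (e j) \<in> U \<longleftrightarrow> snd (e j) \<in> U) \<Longrightarrow> b \<in> U \<Longrightarrow> V2 \<subseteq> U"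
  using exceptional_on_connected[OF finV(4,2) eST(2) excST(2) fullST(2), of U] ab by auto

lemma V1_iff: "x \<in> V1 \<longleftrightarrow> x \<in> V \<and> a \<le> x \<and> x < b" and V2_iff: "x \<in> V2 \<longleftrightarrow> x \<in> V \<and> (x < a \<or> b \<le> x)"
  by (auto simp: V1 V2)

lemma ball_L: "(\<forall>j\<in>L. Q j) \<longleftrightarrow> Q i0 \<and> (\<forall>j\<in>S. Q j) \<and> (\<forall>j\<in>T. Q j)"
  unfolding L_eq(1) by auto

text \<open>A witness \<open>l\<close> would make \<open>{b..<l}\<close> a set not cut by any chord
  of \<open>T\<close>. It contains \<open>b\<close>, hence by connectedness all of
  \<open>V2\<close>, including \<open>l\<close> itself.\<close>

lemma proj_first: "chord_proj L V e i0"
proof (rule ccontr)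
  assume "\<not> ?thesis"
  then obtain l where l: "l \<in> V" "b < l"
    "\<forall>j\<in>L. i0 < j \<longrightarrow> (fst (e j) \<in> {b..<l} \<longleftrightarrow> snd (e j) \<in> {b..<l})"
    by (auto simp: chord_proj_def e0)
  have "V2 \<subseteq> {b..<l}"
    by (rule connected_T) (use l chord_T in auto)
  moreover have "l \<in> V2" using l by (auto simp: V2_iff)
  ultimately show False by auto
qed

lemma inj_first: "chord_inj L V e i0 \<longleftrightarrow> (\<forall>x\<in>V. a \<le> x)"
proof -
  have "\<not> j < i0" if "j \<in> L" for j using i0(2)[OF that] by (cases "j = i0") auto
  then have none: "(\<forall>j\<in>L. j < i0 \<longrightarrow> Q j) = True" for Q by blast
  show ?thesis unfolding chord_inj_def e0 none by (auto simp: not_less)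
qed

text \<open>If no later chord passes over \<open>b\<close> from below, connectedness of
  \<open>V2\<close> puts all its vertices at or above \<open>b\<close>, so nothing is left below
  \<open>a\<close>.\<close>

lemma top_first: "chord_top L e i0 \<longleftrightarrow> (\<forall>x\<in>V. a \<le> x)"
proof
  assume t: "chord_top L e i0"
  have "V2 \<subseteq> {b..}"
  proof (rule connected_T)
    fix j assume "j \<in> T"
    then show "fst (e j) \<in> {b..} \<longleftrightarrow> snd (e j) \<in> {b..}"
      using t chord_T[of j] by (auto simp: chord_top_def e0)
  qed simp
  then show "\<forall>x\<in>V. a \<le> x" using ab by (force simp: V2_iff subset_iff)
next
  assume a: "\<forall>x\<in>V. a \<le> x"
  have "\<not> (fst (e j) < b \<and> b \<le> snd (e j))" if "j \<in> S \<or> j \<in> T" for j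
    using that chord_S[of j] chord_T[of j] a chord_L[of j] by force
  then show "chord_top L e i0" unfolding chord_top_def ball_L by (auto simp: e0)
qed

text \<open>The enclosing chord is earlier than \<open>i\<close>. For \<open>k < a\<close> it has
  \<open>a\<close>, but not \<open>b\<close>, in \<open>{k<..fst (e i)}\<close>, so it confines the
  witnesses to \<open>V1\<close>.\<close>

lemma inj_S: "i \<in> S \<Longrightarrow> chord_inj L V e i \<longleftrightarrow> chord_inj S V1 e i"
proof -
  assume i: "i \<in> S"
  have "(\<forall>j\<in>L. j < i \<longrightarrow> (fst (e j) \<in> {k<..fst (e i)} \<longleftrightarrow> snd (e j) \<in> {k<..fst (e i)})) \<longleftrightarrow>
    a \<le> k \<and> (\<forall>j\<in>S. j < i \<longrightarrow> (fst (e j) \<in> {k<..fst (e i)} \<longleftrightarrow> snd (e j) \<in> {k<..fst (e i)}))"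
    if "k < fst (e i)" for k
    unfolding ball_L e0 using chord_S[OF i] chord_T that by auto (force | fastforce)+
  then show ?thesis
    unfolding chord_inj_def V1_iff Bex_def using chord_S[OF i] by (smt (verit) less_trans)
qed

text \<open>The enclosing chord is not later than \<open>i\<close> and puts no condition on
  witnesses, but \<open>b\<close> becomes a candidate that is absent from \<open>V1\<close>. It is a
  witness iff no later chord of \<open>S\<close> passes over \<open>snd (e i)\<close>, that is, iff
  \<open>chord_top S e i\<close>; with respect to \<open>S\<close>, vertices above \<open>b\<close>
  act like \<open>b\<close>.\<close>

lemma proj_S: "i \<in> S \<Longrightarrow> chord_proj L V e i \<longleftrightarrow> chord_proj S V1 e i \<and> \<not> chord_top S e i"
proof -
  assume i: "i \<in> S"
  let ?Q = "\<lambda>M l. \<forall>j\<in>M. i < j \<longrightarrow> (fst (e j) \<in> {snd (e i)..<l} \<longleftrightarrow> snd (e j) \<in> {snd (e i)..<l})"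
  have i': "\<not> i < i0" using chord_S[OF i] by auto
  have inside: "?Q L l \<longleftrightarrow> ?Q S l" if "l \<le> b" for l
  proof -
    have "?Q T l" using chord_T chord_S[OF i] that by fastforce
    then show ?thesis unfolding ball_L using i' by blast
  qed
  have top: "?Q S l \<longleftrightarrow> chord_top S e i" if "b \<le> l" for l
  proof -
    have "(fst (e j) \<in> {snd (e i)..<l} \<longleftrightarrow> snd (e j) \<in> {snd (e i)..<l}) \<longleftrightarrow>
      \<not> (fst (e j) < snd (e i) \<and> snd (e i) \<le> snd (e j))" if "j \<in> S" for j
      using chord_S[OF that] \<open>b \<le> l\<close> by auto
    then show ?thesis by (simp add: chord_top_def)
  qed
  have "(\<exists>l\<in>V. snd (e i) < l \<and> ?Q L l) \<longleftrightarrow>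
    (\<exists>l\<in>V1. snd (e i) < l \<and> ?Q S l) \<or> chord_top S e i" (is "?A \<longleftrightarrow> ?B \<or> ?C")
  proof
    assume ?A
    then obtain l where l: "l \<in> V" "snd (e i) < l" "?Q L l" by blast
    show "?B \<or> ?C"
    proof (cases "l < b")
      case True
      then have "l \<in> V1" using l chord_S[OF i] by (auto simp: V1_iff)
      then show ?thesis using l inside[of l] True by auto
    next
      case False
      have "?Q S l" using l(3) unfolding ball_L by blast
      then show ?thesis using top[of l] False by auto
    qed
  next
    assume "?B \<or> ?C"
    then show ?A
    proof
      assume ?B
      then show ?A using inside V1_iff by (metis less_imp_le)
    next
      assume ?C
      then have "?Q L b" using inside[of b] top[of b] by simp
      then show ?A using ab chord_S[OF i] by blast
    qed
  qed
  then show ?thesis unfolding chord_proj_def by blast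
qed

lemma top_S: "i \<in> S \<Longrightarrow> chord_top L e i \<Longrightarrow> chord_top S e i"
  using L_eq by (auto simp: chord_top_def)

text \<open>The first chord excludes witnesses in \<open>V1\<close>: for
  \<open>a \<le> k < b \<le> fst (e i)\<close> the set \<open>{k<..fst (e i)}\<close> contains
  \<open>b\<close> but not \<open>a\<close>.\<close>

lemma inj_T: "i \<in> T \<Longrightarrow> chord_inj L V e i \<longleftrightarrow> chord_inj T V2 e i"
proof -
  assume i: "i \<in> T"
  let ?Q = "\<lambda>M k. \<forall>j\<in>M. j < i \<longrightarrow> (fst (e j) \<in> {k<..fst (e i)} \<longleftrightarrow> snd (e j) \<in> {k<..fst (e i)})"
  have i': "i0 < i" using chord_T[OF i] by auto
  have "?Q L k \<longleftrightarrow> k \<in> V2 \<and> ?Q T k" if k: "k \<in> V" "k < fst (e i)" for k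
  proof (cases "k \<in> V2")
    case True
    have "?Q S k" using chord_S chord_T[OF i] True k by (fastforce simp: V2_iff)
    moreover have "fst (e i0) \<in> {k<..fst (e i)} \<longleftrightarrow> snd (e i0) \<in> {k<..fst (e i)}"
      using chord_T[OF i] True k ab(3) by (auto simp: e0 V2_iff)
    ultimately show ?thesis unfolding ball_L using True by blast
  next
    case False
    then have "\<not> (fst (e i0) \<in> {k<..fst (e i)} \<longleftrightarrow> snd (e i0) \<in> {k<..fst (e i)})"
      using chord_T[OF i] k by (auto simp: e0 V2_iff)
    then show ?thesis unfolding ball_L using False i' by blast
  qed
  moreover have "V2 \<subseteq> V" by (auto simp: V2)
  ultimately show ?thesis unfolding chord_inj_def by blast
qed

text \<open>A witness in \<open>V1\<close> can be moved up to \<open>b\<close>, because the chords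
  of \<open>T\<close> have no ends in \<open>{a..<b}\<close>.\<close>

lemma proj_T: "i \<in> T \<Longrightarrow> chord_proj L V e i \<longleftrightarrow> chord_proj T V2 e i"
proof -
  assume i: "i \<in> T"
  let ?Q = "\<lambda>M l. \<forall>j\<in>M. i < j \<longrightarrow> (fst (e j) \<in> {snd (e i)..<l} \<longleftrightarrow> snd (e j) \<in> {snd (e i)..<l})"
  have i': "\<not> i < i0" using chord_T[OF i] by auto
  have outside: "?Q L l \<longleftrightarrow> ?Q T l" if "l \<in> V2" for l
  proof -
    have "?Q S l" using chord_S chord_T[OF i] that by (fastforce simp: V2_iff)
    then show ?thesis unfolding ball_L using i' by blast
  qed
  have b: "snd (e i) < b \<and> ?Q T b" if "l \<in> V1" "snd (e i) < l" "?Q T l" for l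
  proof -
    have "fst (e j) < l \<longleftrightarrow> fst (e j) < b" "snd (e j) < l \<longleftrightarrow> snd (e j) < b" if "j \<in> T" for j
      using chord_T[OF that] \<open>l \<in> V1\<close> by (auto simp: V1_iff)
    then show ?thesis using that chord_T[OF i] by (auto simp: V1_iff)
  qed
  have LT: "?Q L l \<Longrightarrow> ?Q T l" for l unfolding ball_L by blast
  have "l \<in> V \<Longrightarrow> l \<in> V1 \<or> l \<in> V2" "l \<in> V2 \<Longrightarrow> l \<in> V" for l by (auto simp: V1 V2)
  note V12 = this
  have "(\<exists>l\<in>V. snd (e i) < l \<and> ?Q L l) \<longleftrightarrow> (\<exists>l\<in>V2. snd (e i) < l \<and> ?Q T l)"
  proof
    assume "\<exists>l\<in>V. snd (e i) < l \<and> ?Q L l"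
    then obtain l where l: "l \<in> V" "snd (e i) < l" "?Q T l" using LT by blast
    show "\<exists>l\<in>V2. snd (e i) < l \<and> ?Q T l"
    proof (cases "l \<in> V1")
      case True
      show ?thesis using b[OF True l(2,3)] ab(5) by (rule bexI)
    qed (use l V12 in blast)
  next
    assume "\<exists>l\<in>V2. snd (e i) < l \<and> ?Q T l"
    then obtain l where l: "l \<in> V2" "snd (e i) < l" "?Q T l" by blast
    have "?Q L l" using outside[OF l(1)] l(3) by (rule iffD2)
    then show "\<exists>l\<in>V. snd (e i) < l \<and> ?Q L l" using l(2) V12(2)[OF l(1)] by blast
  qed
  then show ?thesis unfolding chord_proj_def by (rule arg_cong)
qed

lemma top_T: "i \<in> T \<Longrightarrow> chord_top L e i \<longleftrightarrow> chord_top T e i"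
proof -
  assume i: "i \<in> T"
  have "\<not> (fst (e j) < snd (e i) \<and> snd (e i) \<le> snd (e j))" if "j \<in> S" for j
    using chord_S[OF that] chord_T[OF i] by auto
  then show ?thesis using chord_T[OF i] unfolding chord_top_def ball_L by auto
qed

end

lemma chord_split_exists:
  assumes "finite L" "finite V" "e \<in> L \<rightarrow> chords V" "exceptional_on L e" "card V = Suc (card L)" "L \<noteq> {}"
  shows "chord_split L V e (Min L) (fst (e (Min L))) (snd (e (Min L)))
    {j \<in> L - {Min L}. fst (e j) \<in> chord_ivl (e (Min L))} {j \<in> L - {Min L}. fst (e j) \<notin> chord_ivl (e (Min L))}
    (V \<inter> chord_ivl (e (Min L))) (V - chord_ivl (e (Min L)))"
  using assms by unfold_locales (auto simp: order.not_eq_order_implies_strict)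

text \<open>The two claims need each other in the induction: an enclosed chord loses relative
  projectivity exactly when \<open>chord_top\<close> holds, and only the second claim, for the
  enclosed part, turns this into relative injectivity.\<close>

lemma chord_status:
  assumes "finite L" "finite V" "e \<in> L \<rightarrow> chords V" "exceptional_on L e" "card V = Suc (card L)" "i \<in> L"
  shows "chord_proj L V e i \<or> chord_inj L V e i"
    and "chord_proj L V e i \<Longrightarrow> chord_top L e i \<longleftrightarrow> chord_inj L V e i"
proof -
  have "(chord_proj L V e i \<or> chord_inj L V e i) \<and>
    (chord_proj L V e i \<longrightarrow> (chord_top L e i \<longleftrightarrow> chord_inj L V e i))"
    using assms
  proof (induction "card L" arbitrary: L V rule: less_induct)
    case less
    define p where "p = e (Min L)"
    define S where "S = {j \<in> L - {Min L}. fst (e j) \<in> chord_ivl p}"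
    define T where "T = {j \<in> L - {Min L}. fst (e j) \<notin> chord_ivl p}"
    interpret chord_split L V e "Min L" "fst p" "snd p" S T "V \<inter> chord_ivl p" "V - chord_ivl p"
      unfolding S_def T_def p_def by (rule chord_split_exists) (use less.prems in auto)
    have lt: "card S < card L" "card T < card L"
      using L_eq fin finV i0(1) by (auto intro!: psubset_card_mono)
    consider "i = Min L" | "i \<in> S" | "i \<in> T" using less.prems L_eq by auto
    then show ?case
    proof cases
      case 1
      then show ?thesis using proj_first inj_first top_first by simp
    next
      case 2
      note IH = less.hyps[OF lt(1) finV(3) finV(1) eST(1) excST(1) fullST(1) 2]
      show ?thesis using IH inj_S[OF 2] proj_S[OF 2] top_S[OF 2] by blast
    next
      case 3
      note IH = less.hyps[OF lt(2) finV(4) finV(2) eST(2) excST(2) fullST(2) 3]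
      show ?thesis using IH inj_T[OF 3] proj_T[OF 3] top_T[OF 3] by blast
    qed
  qed
  then show "chord_proj L V e i \<or> chord_inj L V e i"
    and "chord_proj L V e i \<Longrightarrow> chord_top L e i \<longleftrightarrow> chord_inj L V e i" by auto
qed

text \<open>With the value \<open>1\<close> for a chord that is neither, the product of the weights
  is the monomial of the theorem by mere case distinction.\<close>

definition chord_weight ::
  "'a::comm_ring_1 \<Rightarrow> 'a \<Rightarrow> 'a \<Rightarrow> nat set \<Rightarrow> nat set \<Rightarrow> (nat \<Rightarrow> nat \<times> nat) \<Rightarrow> nat \<Rightarrow> 'a" where
  "chord_weight x y z L V e i =
     (if chord_proj L V e i then if chord_inj L V e i then z else x
      else if chord_inj L V e i then y else 1)"

lemma chord_weight_cong:
  assumes "\<And>j. j \<in> L \<Longrightarrow> e j = e' j" "i \<in> L"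
  shows "chord_weight x y z L V e i = chord_weight x y z L V e' i"
proof -
  have "chord_proj L V e i = chord_proj L V e' i" "chord_inj L V e i = chord_inj L V e' i"
    using assms unfolding chord_proj_def chord_inj_def by (simp_all cong: ball_cong)
  then show ?thesis by (simp add: chord_weight_def)
qed

context chord_split
begin

lemma weight_first: "chord_weight x y z L V e i0 = (if \<forall>v\<in>V. a \<le> v then z else x)"
  by (simp add: chord_weight_def proj_first inj_first)

text \<open>A chord that is both relatively projective and relatively injective in \<open>S\<close>
  satisfies \<open>chord_top\<close> there and stays only relatively injective in \<open>L\<close>;
  so \<open>y\<close> takes the place of \<open>z\<close>.\<close>

lemma weight_S: "i \<in> S \<Longrightarrow> chord_weight x y z L V e i = chord_weight x y y S V1 e i"
  using chord_status[OF finV(3) finV(1) eST(1) excST(1) fullST(1), of i] proj_S[of i] inj_S[of i]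
  by (auto simp: chord_weight_def)

lemma weight_T: "i \<in> T \<Longrightarrow> chord_weight x y z L V e i = chord_weight x y z T V2 e i"
  using proj_T[of i] inj_T[of i] by (simp add: chord_weight_def)

lemma weight_prod: "(\<Prod>i\<in>L. chord_weight x y z L V e i) =
    (if \<forall>v\<in>V. a \<le> v then z else x) * ((\<Prod>i\<in>S. chord_weight x y y S V1 e i) *
    (\<Prod>i\<in>T. chord_weight x y z T V2 e i))"
proof -
  have "(\<Prod>i\<in>L. chord_weight x y z L V e i) =
      chord_weight x y z L V e i0 * ((\<Prod>i\<in>S. chord_weight x y z L V e i) * (\<Prod>i\<in>T. chord_weight x y z L V e i))"
    using L_eq finV by (subst L_eq(1), subst prod.insert) (auto simp: prod.union_disjoint)
  then show ?thesis by (simp add: weight_first weight_S weight_T)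
qed

end

section \<open>The generating function of chord sequences\<close>

lemma finite_chords: "finite V \<Longrightarrow> finite (chords V)"
  by (rule finite_subset[of _ "V \<times> V"]) (auto simp: chords_def)

lemma finite_chord_seqs: "finite L \<Longrightarrow> finite V \<Longrightarrow> finite (chord_seqs L V)"
  unfolding chord_seqs_def by (rule finite_subset[OF Collect_subset]) (simp add: finite_PiE finite_chords)

text \<open>In the increasing enumeration \<open>s\<close> of \<open>V\<close> a chord is
  \<open>(s u, s (u + m))\<close>, where \<open>m\<close> counts the vertices in its half-open
  interval. Here \<open>u\<close> ranges from \<open>0\<close> to \<open>N - m\<close>, and only
  \<open>u = 0\<close> gives the least vertex.\<close>

lemma sum_chords:
  fixes h :: "nat \<Rightarrow> 'a::comm_ring_1"
  assumes V: "finite V" "card V = Suc N"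
  shows "(\<Sum>p\<in>chords V. (if \<forall>v\<in>V. fst p \<le> v then z else x) * h (card (V \<inter> chord_ivl p))) =
    (\<Sum>m=1..N. (z + of_nat (N - m) * x) * h m)"
proof -
  obtain s where s: "bij_betw s {..<card V} V" "strict_mono_on {..<card V} s"
    using ex_bij_betw_strict_mono_card[OF V(1)] .
  have less: "s u < s v \<longleftrightarrow> u < v" and le: "s u \<le> s v \<longleftrightarrow> u \<le> v" if "u \<le> N" "v \<le> N" for u v
    using strict_mono_on_less[OF s(2), of u v] strict_mono_on_less_eq[OF s(2), of u v] that V(2) by auto
  have img: "V = s ` {..N}" using s(1) V(2) by (auto simp: bij_betw_def lessThan_Suc_atMost)
  have inj: "inj_on s {..N}" using s(1) V(2) by (auto simp: bij_betw_def lessThan_Suc_atMost)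
  have min: "(\<forall>v\<in>V. s u \<le> v) \<longleftrightarrow> u = 0" if "u \<le> N" for u
    using that le unfolding img by auto
  have card: "card (V \<inter> {s u..<s v}) = v - u" if "u \<le> N" "v \<le> N" for u v
  proof -
    have "V \<inter> {s u..<s v} = s ` {u..<v}"
      unfolding img using that less le by auto
    then show ?thesis
      using card_image[OF inj_on_subset[OF inj, of "{u..<v}"]] that by (simp add: subset_iff)
  qed
  have bij: "bij_betw (\<lambda>(m, u). (s u, s (u + m))) (SIGMA m:{1..N}. {0..N-m}) (chords V)"
      unfolding bij_betw_def
    proof
      show "inj_on (\<lambda>(m, u). (s u, s (u + m))) (SIGMA m:{1..N}. {0..N-m})"
      proof (rule inj_onI, clarify)
        fix m u m' u' assume *: "m \<in> {1..N}" "u \<in> {0..N-m}" "m' \<in> {1..N}" "u' \<in> {0..N-m'}"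
          "s u = s u'" "s (u + m) = s (u' + m')"
        then have "u + m \<le> N" "u' + m' \<le> N" by auto
        then show "m = m' \<and> u = u'"
          using inj_onD[OF inj *(5)] inj_onD[OF inj *(6)] by auto
      qed
      show "(\<lambda>(m, u). (s u, s (u + m))) ` (SIGMA m:{1..N}. {0..N-m}) = chords V"
      proof safe
        fix m u assume "m \<in> {1..N}" "u \<in> {0..N-m}"
        then show "(s u, s (u + m)) \<in> chords V" using less[of u "u + m"] by (auto simp: chords_def img)
      next
        fix p q assume "(p, q) \<in> chords V"
        then obtain u v where uv: "u \<le> N" "v \<le> N" "p = s u" "q = s v" "u < v"
          using less by (auto simp: chords_def img)
        then show "(p, q) \<in> (\<lambda>(m, u). (s u, s (u + m))) ` (SIGMA m:{1..N}. {0..N-m})"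
          by (intro image_eqI[of _ _ "(v - u, u)"]) auto
      qed
    qed
  have min0: "s 0 \<le> v" if "v \<in> V" for v using min[of 0] that by blast
  let ?F = "\<lambda>p. (if \<forall>v\<in>V. fst p \<le> v then z else x) * h (card (V \<inter> chord_ivl p))"
  have "sum ?F (chords V) = (\<Sum>t\<in>(SIGMA m:{1..N}. {0..N-m}). ?F (case t of (m, u) \<Rightarrow> (s u, s (u + m))))"
    by (rule sum.reindex_bij_betw[OF bij, symmetric])
  also have "\<dots> = (\<Sum>(m,u)\<in>(SIGMA m:{1..N}. {0..N-m}). (if u = 0 then z else x) * h m)"
    by (rule sum.cong) (auto simp: min card dest: min0)
  also have "\<dots> = (\<Sum>m=1..N. \<Sum>u=0..N-m. (if u = 0 then z else x) * h m)"
    by (subst sum.Sigma) auto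
  also have "\<dots> = (\<Sum>m=1..N. (z + of_nat (N - m) * x) * h m)"
    by (intro sum.cong refl, subst sum.atLeast_Suc_atMost) (auto simp: algebra_simps)
  finally show ?thesis .
qed

text \<open>A sequence starting with \<open>p\<close> is a shuffle: \<open>S\<close> is the set of
  positions of the chords inside \<open>p\<close>. Its size is forced by \<open>fullST\<close>, and
  every \<open>S\<close> of this size occurs, with independent choices for the two parts.\<close>

lemma chord_seqs_fibre:
  fixes x y z :: "'a::comm_ring_1"
  assumes fin: "finite L" "finite V" and full: "card V = Suc (card L)" and ne: "L \<noteq> {}"
    and p: "p \<in> chords V"
  defines "i0 \<equiv> Min L" and "V1 \<equiv> V \<inter> chord_ivl p" and "V2 \<equiv> V - chord_ivl p"
  shows "(\<Sum>e\<in>{e \<in> chord_seqs L V. e i0 = p}. \<Prod>i\<in>L. chord_weight x y z L V e i) =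
    (if \<forall>v\<in>V. fst p \<le> v then z else x) *
    (\<Sum>S | S \<subseteq> L - {i0} \<and> card S = card V1 - 1.
      (\<Sum>e\<in>chord_seqs S V1. \<Prod>i\<in>S. chord_weight x y y S V1 e i) *
      (\<Sum>e\<in>chord_seqs (L - {i0} - S) V2. \<Prod>i\<in>L - {i0} - S. chord_weight x y z (L - {i0} - S) V2 e i))"
proof -
  obtain a b where pab: "p = (a, b)" by (cases p)
  have ab: "a \<in> V" "b \<in> V" "a < b" using p by (auto simp: chords_def pab)
  have i0: "i0 \<in> L" "\<And>j. j \<in> L \<Longrightarrow> j \<noteq> i0 \<Longrightarrow> i0 < j"
    using fin ne by (auto simp: i0_def order.not_eq_order_implies_strict)
  let ?Ss = "{S. S \<subseteq> L - {i0} \<and> card S = card V1 - 1}"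
  let ?E = "{e \<in> chord_seqs L V. e i0 = p}"
  let ?S = "\<lambda>e::nat \<Rightarrow> nat \<times> nat. {j \<in> L - {i0}. fst (e j) \<in> chord_ivl p}"
  let ?X = "SIGMA S:?Ss. chord_seqs S V1 \<times> chord_seqs (L - {i0} - S) V2"
  let ?w = "\<lambda>(S, e1, e2). (if \<forall>v\<in>V. a \<le> v then z else x) *
     ((\<Prod>i\<in>S. chord_weight x y y S V1 e1 i) * (\<Prod>i\<in>L-{i0}-S. chord_weight x y z (L-{i0}-S) V2 e2 i))"
  let ?join = "\<lambda>(S, e1, e2). \<lambda>i. if i = i0 then p else if i \<in> S then e1 i else if i \<in> L then e2 i else
      undefined"
  let ?split = "\<lambda>e. (?S e, restrict e (?S e), restrict e (L - {i0} - ?S e))"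
  have finS: "finite ?Ss" using fin by auto
  have Vfin: "finite V1" "finite V2" using fin by (auto simp: V1_def V2_def)
  have disj: "V1 \<inter> V2 = {}" by (auto simp: V1_def V2_def)
  have cV: "card V = card V1 + card V2" unfolding V1_def V2_def
    using fin by (metis Int_Diff_Un Int_Diff_disjoint card_Un_disjoint finite_Diff finite_Int)
  have V1pos: "card V1 > 0" using ab Vfin by (auto simp: card_gt_0_iff V1_def pab)
  have split: "chord_split L V e i0 a b (?S e) (L - {i0} - ?S e) V1 V2" if "e \<in> ?E" for e
    using that i0 fin full by unfold_locales (auto simp: chord_seqs_def V1_def V2_def pab)
  have "(\<Sum>e\<in>?E. \<Prod>i\<in>L. chord_weight x y z L V e i) = (\<Sum>t\<in>?X. ?w t)"
  proof (rule sum.reindex_bij_witness[of _ ?join ?split])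
    fix e assume e: "e \<in> ?E"
    interpret chord_split L V e i0 a b "?S e" "L - {i0} - ?S e" V1 V2 by (rule split[OF e])
    have ext: "e \<in> extensional L" using e by (auto simp: chord_seqs_def PiE_def)
    show "?join (?split e) = e"
      using e i0 ext by (auto simp: fun_eq_iff extensional_def)
    have "?S e \<in> ?Ss" using fullST by auto
    moreover have "restrict e (?S e) \<in> chord_seqs (?S e) V1"
      "restrict e (L - {i0} - ?S e) \<in> chord_seqs (L - {i0} - ?S e) V2"
      using eST excST by (auto simp: chord_seqs_def exceptional_on_def Pi_def PiE_def)
    ultimately show "?split e \<in> ?X" by blast
    have r1: "chord_weight x y y (?S e) V1 (restrict e (?S e)) i = chord_weight x y y (?S e) V1 e i"
      if "i \<in> ?S e" for i by (rule chord_weight_cong) (use that in auto)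
    have r2: "chord_weight x y z (L - {i0} - ?S e) V2 (restrict e (L - {i0} - ?S e)) i =
       chord_weight x y z (L - {i0} - ?S e) V2 e i"
      if "i \<in> L - {i0} - ?S e" for i by (rule chord_weight_cong) (use that in auto)
    show "?w (?split e) = (\<Prod>i\<in>L. chord_weight x y z L V e i)"
      unfolding weight_prod prod.case
      by (intro arg_cong2[where f = "(*)"] prod.cong refl r1 r2)
  next
    fix t assume "t \<in> ?X"
    then obtain S e1 e2 where t: "t = (S, e1, e2)" "S \<subseteq> L - {i0}" "card S = card V1 - 1"
      "e1 \<in> chord_seqs S V1" "e2 \<in> chord_seqs (L - {i0} - S) V2" by auto
    have c1: "fst (e1 j) \<in> V1 \<and> snd (e1 j) \<in> V1 \<and> fst (e1 j) < snd (e1 j)" if "j \<in> S" for j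
      using t that by (auto simp: chord_seqs_def PiE_def Pi_def dest!: chordsD)
    have c2: "fst (e2 j) \<in> V2 \<and> snd (e2 j) \<in> V2 \<and> fst (e2 j) < snd (e2 j)" if "j \<in> L - {i0} - S" for j
      using t that by (auto simp: chord_seqs_def PiE_def Pi_def dest!: chordsD)
    have x1: "fst (e1 j) \<in> chord_ivl (e1 i) \<longleftrightarrow> snd (e1 j) \<in> chord_ivl (e1 i)" if "i \<in> S" "j \<in> S" "i < j" for i j
      using t that by (auto simp: chord_seqs_def exceptional_on_def)
    have x2: "fst (e2 j) \<in> chord_ivl (e2 i) \<longleftrightarrow> snd (e2 j) \<in> chord_ivl (e2 i)"
      if "i \<in> L - {i0} - S" "j \<in> L - {i0} - S" "i < j" for i j
      using t(5) that unfolding chord_seqs_def exceptional_on_def by blast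
    define e where "e = ?join t"
    have e_i0: "e i0 = p" and e_S: "\<And>j. j \<in> S \<Longrightarrow> e j = e1 j"
      and e_T: "\<And>j. j \<in> L - {i0} - S \<Longrightarrow> e j = e2 j" and e_ext: "\<And>j. j \<notin> L \<Longrightarrow> e j = undefined"
      using t i0 by (auto simp: e_def)
    have "fst (e j) \<in> V \<and> snd (e j) \<in> V \<and> fst (e j) < snd (e j)" if "j \<in> L" for j
      using that e_i0 e_S e_T c1 c2 ab by (cases "j = i0"; cases "j \<in> S") (auto simp: V1_def V2_def pab)
    then have "e \<in> L \<rightarrow>\<^sub>E chords V"
      using e_ext by (auto simp: PiE_def extensional_def chords_def split: prod.splits)
          (metis fst_conv snd_conv)+
    moreover have "exceptional_on L e"
      unfolding exceptional_on_def
    proof (intro ballI impI)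
      fix i j assume ij: "i \<in> L" "j \<in> L" "i < j"
      then have j: "j \<noteq> i0" using i0(2)[of i] by (cases "i = i0") auto
      \<comment> \<open>The mixed cases hold automatically: the interval of a chord in
        \<open>V1\<close> contains no vertex of \<open>V2\<close>, and that of a chord in
        \<open>V2\<close> contains all vertices of \<open>V1\<close> or none.\<close>
      consider "i = i0" "j \<in> S" | "i = i0" "j \<in> L - {i0} - S" | "i \<in> S" "j \<in> S"
        | "i \<in> S" "j \<in> L - {i0} - S" | "i \<in> L - {i0} - S" "j \<in> S"
        | "i \<in> L - {i0} - S" "j \<in> L - {i0} - S"
        using ij j by blast
      then show "fst (e j) \<in> chord_ivl (e i) \<longleftrightarrow> snd (e j) \<in> chord_ivl (e i)"
      proof cases
        case 1 then show ?thesis using c1[of j] by (auto simp: e_i0 e_S V1_def)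
      next
        case 2 then show ?thesis using c2[of j] by (auto simp: e_i0 e_T V2_def)
      next
        case 3 then show ?thesis using x1[of i j] ij by (simp add: e_S)
      next
        case 4 then show ?thesis using c1[of i] c2[of j] by (auto simp: e_S e_T V1_def V2_def)
      next
        case 5 then show ?thesis using c1[of j] c2[of i] by (auto simp: e_S e_T V1_def V2_def)
      next
        case 6 then show ?thesis using x2[of i j] ij by (simp add: e_T)
      qed
    qed
    ultimately have "e \<in> ?E" by (simp add: chord_seqs_def e_i0)
    then show "?join t \<in> ?E" by (simp add: e_def)
    have "?S e = S"
    proof (rule Set.set_eqI)
      fix j show "j \<in> ?S e \<longleftrightarrow> j \<in> S"
        using c1[of j] c2[of j] t(2) e_S[of j] e_T[of j]
        by (cases "j \<in> S"; cases "j \<in> L - {i0}") (auto simp: V1_def V2_def)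
    qed
    moreover have "restrict e S = e1" "restrict e (L - {i0} - S) = e2"
      using t e_S e_T by (auto simp: chord_seqs_def fun_eq_iff PiE_def extensional_def restrict_def)
    ultimately show "?split (?join t) = t" unfolding e_def[symmetric] by (simp add: t(1))
  qed
  also have "\<dots> = (\<Sum>S\<in>?Ss. \<Sum>(e1, e2)\<in>chord_seqs S V1 \<times> chord_seqs (L - {i0} - S) V2. ?w (S, e1, e2))"
    using finS fin Vfin
    by (subst sum.Sigma) (auto intro!: finite_chord_seqs intro: finite_subset simp: split_beta)
  also have "\<dots> = (\<Sum>S\<in>?Ss. (if \<forall>v\<in>V. a \<le> v then z else x) *
    ((\<Sum>e\<in>chord_seqs S V1. \<Prod>i\<in>S. chord_weight x y y S V1 e i) *
     (\<Sum>e\<in>chord_seqs (L - {i0} - S) V2. \<Prod>i\<in>L - {i0} - S. chord_weight x y z (L - {i0} - S) V2 e i)))"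
    unfolding sum_product unfolding sum_distrib_left sum.cartesian_product
    by (intro sum.cong refl) (simp add: split_beta)
  finally show ?thesis by (simp add: sum_distrib_left pab)
qed

text \<open>The weight \<open>z\<close> varies in the induction, because the enclosed part calls for
  the hypothesis at \<open>y\<close> in its place.\<close>

lemma chord_seqs_generating_function:
  fixes x y z :: "'a::comm_ring_1"
  assumes "finite L" "finite V" "card V = Suc (card L)"
  shows "(\<Sum>e\<in>chord_seqs L V. \<Prod>i\<in>L. chord_weight x y z L V e i) = abel_prod x y (card L) z"
  using assms
proof (induction "card L" arbitrary: L V z rule: less_induct)
  case less
  show ?case
  proof (cases "L = {}")
    case True
    then show ?thesis by (simp add: chord_seqs_def exceptional_on_def)
  next
    case False
    define i0 where "i0 = Min L"
    have i0: "i0 \<in> L" using False less.prems by (simp add: i0_def)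
    obtain N where N: "card L = Suc N"
      using False less.prems by (metis card_gt_0_iff gr0_implies_Suc)
    \<comment> \<open>\<open>m\<close> stands for the number of vertices in the interval of the
      first chord; the chords on them occupy \<open>m - 1\<close> of the \<open>N\<close> remaining
      positions.\<close>
    let ?h = "\<lambda>m. of_nat (N choose (m - 1)) * (abel_prod x y (m - 1) y * abel_prod x y (Suc N - m) z)"
    have fibre: "(\<Sum>e\<in>{e \<in> chord_seqs L V. e i0 = p}. \<Prod>i\<in>L. chord_weight x y z L V e i) =
      (if \<forall>v\<in>V. fst p \<le> v then z else x) * ?h (card (V \<inter> chord_ivl p))" if p: "p \<in> chords V" for p
    proof -
      have p': "fst p \<in> V" "snd p \<in> V" "fst p < snd p" using p by (auto dest: chordsD)
      let ?V1 = "V \<inter> chord_ivl p" and ?V2 = "V - chord_ivl p"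
      have V1: "finite ?V1" "card ?V1 > 0" and V2: "finite ?V2" "card ?V2 > 0"
        using p' less.prems by (auto simp: card_gt_0_iff)
      have cV: "card V = card ?V1 + card ?V2"
        using less.prems by (metis Int_Diff_Un Int_Diff_disjoint card_Un_disjoint finite_Diff finite_Int)
      have "(\<Sum>e\<in>chord_seqs S ?V1. \<Prod>i\<in>S. chord_weight x y y S ?V1 e i) = abel_prod x y (card ?V1 - 1) y \<and>
        (\<Sum>e\<in>chord_seqs (L - {i0} - S) ?V2. \<Prod>i\<in>L - {i0} - S. chord_weight x y z (L - {i0} - S) ?V2 e i)
          = abel_prod x y (Suc N - card ?V1) z"
        if S: "S \<subseteq> L - {i0}" "card S = card ?V1 - 1" for S
      proof -
        have fS: "finite S" using S less.prems by (meson finite_Diff finite_subset)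
        have cT: "card (L - {i0} - S) = N - card S"
          using S fS i0 N less.prems by (simp add: card_Diff_subset)
        have le: "card S \<le> N" using card_mono[OF _ S(1)] less.prems i0 N by simp
        have a: "card S < card L" "card ?V1 = Suc (card S)" using le N S(2) V1 by auto
        have b: "card (L - {i0} - S) < card L" "card ?V2 = Suc (card (L - {i0} - S))"
          "card (L - {i0} - S) = Suc N - card ?V1"
          using cT le N a(2) cV less.prems(3) by auto
        have fT: "finite (L - {i0} - S)" using less.prems(1) by simp
        show ?thesis
          using less.hyps[OF a(1) fS V1(1) a(2), of y] less.hyps[OF b(1) fT V2(1) b(2), of z]
          unfolding b(3) S(2) by (rule conjI)
      qed
      moreover have "card {S. S \<subseteq> L - {i0} \<and> card S = card ?V1 - 1} = N choose (card ?V1 - 1)"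
        using n_subsets[of "L - {i0}"] less.prems i0 N by simp
      ultimately show ?thesis
        unfolding chord_seqs_fibre[OF less.prems False p, folded i0_def]
        by simp
    qed
    have "(\<Sum>e\<in>chord_seqs L V. \<Prod>i\<in>L. chord_weight x y z L V e i) =
      (\<Sum>p\<in>chords V. \<Sum>e\<in>{e \<in> chord_seqs L V. e i0 = p}. \<Prod>i\<in>L. chord_weight x y z L V e i)"
      using less.prems i0
      by (intro sum.group[symmetric]) (auto simp: finite_chords finite_chord_seqs, auto simp: chord_seqs_def)
    also have "\<dots> = (\<Sum>m=1..Suc N. (z + of_nat (Suc N - m) * x) * ?h m)"
      unfolding sum_chords[OF less.prems(2) less.prems(3)[unfolded N], symmetric]
      using fibre by (rule sum.cong[OF refl])
    also have "\<dots> = (\<Sum>k\<le>N. (z + of_nat (N - k) * x) * ?h (Suc k))"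
      by (rule sum.reindex_bij_witness[of _ Suc "\<lambda>m. m - 1"]) auto
    also have "\<dots> = abel_prod x y (Suc N) z"
      unfolding abel_prod_recursion by (intro sum.cong refl) (simp add: ac_simps)
    finally show ?thesis by (simp add: N)
  qed
qed

section \<open>Matrices\<close>

text \<open>The side conditions of this and the following rules are equations between dimensions,
  which the simplifier can discharge; products and sums of matrices can thus be normalised by
  \<open>mat_ring\<close> almost as in a ring.\<close>

lemma mat_assoc: "dim_col A = dim_row B \<Longrightarrow> dim_col B = dim_row C \<Longrightarrow> (A * B) * C = A * (B * C)"
  for A B C :: "'k::field mat"
  by (rule assoc_mult_mat[of _ "dim_row A" "dim_col A" _ "dim_col B" _ "dim_col C"]) auto

lemma mat_add_distL: "dim_col A = dim_row B \<Longrightarrow> dim_row B = dim_row C \<Longrightarrow> dim_col B = dim_col C \<Longrightarrow>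
    A * (B + C) = A * B + A * C" for A B C :: "'k::field mat"
  by (rule mult_add_distrib_mat[of _ "dim_row A" "dim_col A" _ "dim_col B"]) auto

lemma mat_add_distR: "dim_col A = dim_row C \<Longrightarrow> dim_row B = dim_row A \<Longrightarrow> dim_col B = dim_col A \<Longrightarrow>
    (A + B) * C = A * C + B * C" for A B C :: "'k::field mat"
  by (rule add_mult_distrib_mat[of _ "dim_row A" "dim_col A" _ _ "dim_col C"]) auto

lemma mat_minus_distL: "dim_col A = dim_row B \<Longrightarrow> dim_row B = dim_row C \<Longrightarrow> dim_col B = dim_col C \<Longrightarrow>
    A * (B - C) = A * B - A * C" for A B C :: "'k::field mat"
  by (rule mult_minus_distrib_mat[of _ "dim_row A" "dim_col A" _ "dim_col B"]) auto

lemma mat_minus_distR: "dim_col A = dim_row C \<Longrightarrow> dim_row B = dim_row A \<Longrightarrow> dim_col B = dim_col A \<Longrightarrow>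
    (A - B) * C = A * C - B * C" for A B C :: "'k::field mat"
  by (rule minus_mult_distrib_mat[of _ "dim_row A" "dim_col A" _ _ "dim_col C"]) auto

lemma mat_oneL: "dim_row A = m \<Longrightarrow> 1\<^sub>m m * A = A"
  and mat_oneR: "dim_col A = m \<Longrightarrow> A * 1\<^sub>m m = A" for A :: "'k::field mat"
  by (auto intro!: left_mult_one_mat right_mult_one_mat)

lemma mat_zeroL: "dim_row A = k \<Longrightarrow> 0\<^sub>m m k * A = 0\<^sub>m m (dim_col A)"
  and mat_zeroR: "dim_col A = k \<Longrightarrow> A * 0\<^sub>m k m = 0\<^sub>m (dim_row A) m" for A :: "'k::field mat"
  by (auto intro!: left_mult_zero_mat right_mult_zero_mat)

lemma mat_add_zeroL: "dim_row A = m \<Longrightarrow> dim_col A = k \<Longrightarrow> 0\<^sub>m m k + A = A"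
  and mat_add_zeroR: "dim_row A = m \<Longrightarrow> dim_col A = k \<Longrightarrow> A + 0\<^sub>m m k = A"
  and mat_minus_zeroR: "dim_row A = m \<Longrightarrow> dim_col A = k \<Longrightarrow> A - 0\<^sub>m m k = A" for A :: "'k::field mat"
  by auto

lemma mat_minus_self: "A - A = 0\<^sub>m (dim_row A) (dim_col A)" for A :: "'k::field mat"
  by auto

lemmas mat_ring = mat_minus_self mat_assoc mat_add_distL mat_add_distR mat_minus_distL mat_minus_distR
  mat_oneL mat_oneR mat_zeroL mat_zeroR mat_add_zeroL mat_add_zeroR mat_minus_zeroR

lemma mat_no_cols: "dim_row A = dim_row B \<Longrightarrow> dim_col A = 0 \<Longrightarrow> dim_col B = 0 \<Longrightarrow> A = B"
  and mat_no_rows: "dim_col A = dim_col B \<Longrightarrow> dim_row A = 0 \<Longrightarrow> dim_row B = 0 \<Longrightarrow> A = B"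
  by (auto intro: eq_matI)

lemma mat_solve_cols:
  fixes A B :: "'k::field mat"
  assumes A: "A \<in> carrier_mat m k" and B: "B \<in> carrier_mat m l"
    and ex: "\<And>j. j < l \<Longrightarrow> \<exists>v\<in>carrier_vec k. A *\<^sub>v v = col B j"
  shows "\<exists>C\<in>carrier_mat k l. A * C = B"
proof -
  obtain v where v: "\<And>j. j < l \<Longrightarrow> v j \<in> carrier_vec k \<and> A *\<^sub>v v j = col B j"
    using ex by metis
  let ?C = "mat_of_cols k (map v [0..<l])"
  have "A * ?C = B"
  proof (rule mat_col_eqI)
    fix j assume "j < dim_col B"
    then have j: "j < l" using B by auto
    then have "col (A * ?C) j = A *\<^sub>v col ?C j" by (subst col_mult2[OF A _]) auto
    also have "col ?C j = v j" using j v by (subst col_mat_of_cols) auto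
    finally show "col (A * ?C) j = col B j" using v j by simp
  qed (use A B in auto)
  then show ?thesis by (intro bexI[of _ ?C]) auto
qed

text \<open>\<open>W\<close> and \<open>U\<close> are inclusion and projection of a complement of the line spanned by \<open>v\<close>.\<close>

lemma split_column:
  fixes v :: "'k::field mat"
  assumes v: "v \<in> carrier_mat (Suc d) 1" and p: "p < Suc d" "v $$ (p, 0) \<noteq> 0"
  obtains \<phi> W U where "\<phi> \<in> carrier_mat 1 (Suc d)" "W \<in> carrier_mat (Suc d) d" "U \<in> carrier_mat d (Suc d)"
    "\<phi> * v = 1\<^sub>m 1" "U * W = 1\<^sub>m d" "U * v = 0\<^sub>m d 1" "W * U + v * \<phi> = 1\<^sub>m (Suc d)"
proof -
  \<comment> \<open>\<open>\<phi>\<close> reads the pivot coordinate \<open>p\<close>, scaled to be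
    \<open>1\<close> on \<open>v\<close>. \<open>W\<close> inserts a zero at position
    \<open>p\<close>, \<open>V\<close> deletes this coordinate, and \<open>E\<close> projects to it.
    The factor \<open>1 - v * \<phi>\<close> makes \<open>U\<close> vanish on
    \<open>v\<close>.\<close>
  define \<phi> where "\<phi> = mat 1 (Suc d) (\<lambda>(i, j). if j = p then inverse (v $$ (p, 0)) else 0)"
  define W where "W = mat (Suc d) d (\<lambda>(i, j). if i = insert_index p j then 1 else 0 :: 'k)"
  define V where "V = mat d (Suc d) (\<lambda>(i, j). if j = insert_index p i then 1 else 0 :: 'k)"
  define E where "E = mat (Suc d) (Suc d) (\<lambda>(i, j). if i = p \<and> j = p then 1 else 0 :: 'k)"
  define U where "U = V * (1\<^sub>m (Suc d) - v * \<phi>)"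
  have c [simp]: "dim_row \<phi> = 1" "dim_col \<phi> = Suc d" "dim_row W = Suc d" "dim_col W = d"
    "dim_row V = d" "dim_col V = Suc d" "dim_row E = Suc d" "dim_col E = Suc d"
    "dim_row v = Suc d" "dim_col v = 1" "dim_row U = d" "dim_col U = Suc d"
    using v by (auto simp: \<phi>_def W_def V_def E_def U_def)
  have ins: "insert_index p j \<noteq> p" "insert_index p j < Suc d" if "j < d" for j
    using that p by (auto simp: insert_index_def)
  have ins_inj: "insert_index p i = insert_index p j \<longleftrightarrow> i = j" for i j
    by (auto simp: insert_index_def)
  have ins_surj: "\<exists>k<d. i = insert_index p k" if "i < Suc d" "i \<noteq> p" for i
    using that p by (intro exI[of _ "if i < p then i else i - 1"]) (auto simp: insert_index_def)
  have \<phi>v: "\<phi> * v = 1\<^sub>m 1"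
    using p by (intro eq_matI)
      (auto simp: \<phi>_def scalar_prod_def if_distrib[of "\<lambda>x. x * _"] sum.delta simp del: sum.op_ivl_Suc cong:
          if_cong)
  have \<phi>W: "\<phi> * W = 0\<^sub>m 1 d"
    using p ins by (intro eq_matI)
      (auto simp: \<phi>_def W_def scalar_prod_def simp del: sum.op_ivl_Suc intro!: sum.neutral)
  have VW: "V * W = 1\<^sub>m d"
    using p ins by (intro eq_matI)
      (auto simp: V_def W_def scalar_prod_def if_distrib[of "\<lambda>x. x * _"] sum.delta ins_inj
        simp del: sum.op_ivl_Suc cong: if_cong)
  have WV: "W * V = 1\<^sub>m (Suc d) - E"
  proof (rule eq_matI)
    fix i j assume "i < dim_row (1\<^sub>m (Suc d) - E)" "j < dim_col (1\<^sub>m (Suc d) - E)"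
    then have ij: "i < Suc d" "j < Suc d" by auto
    have "(W * V) $$ (i, j) = (\<Sum>k<d. if i = insert_index p k \<and> j = insert_index p k then 1 else 0)"
      using ij by (auto simp: W_def V_def scalar_prod_def atLeast0LessThan intro!: sum.cong)
    also have "\<dots> = (1\<^sub>m (Suc d) - E) $$ (i, j)"
    proof (cases "i = p")
      case True
      then show ?thesis using ij ins(1)[THEN not_sym] by (auto simp: E_def intro!: sum.neutral)
    next
      case False
      then obtain k where k: "k < d" "i = insert_index p k" using ins_surj ij by blast
      show ?thesis using ij k False by (auto simp: E_def ins_inj intro!: sum.neutral)
    qed
    finally show "(W * V) $$ (i, j) = (1\<^sub>m (Suc d) - E) $$ (i, j)" .
  qed (use c in auto)
  \<comment> \<open>Row \<open>p\<close> of \<open>v * \<phi>\<close> is the unit row with its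
    \<open>1\<close> at \<open>p\<close>; hence both terms with \<open>E\<close> cancel in
    \<open>W * U\<close>.\<close>
  have Ev: "E * (v * \<phi>) = E"
    using p by (intro eq_matI)
      (auto simp: E_def \<phi>_def scalar_prod_def if_distrib[of "\<lambda>x. x * _"] sum.delta
        simp del: sum.op_ivl_Suc cong: if_cong)
  have Uv: "U * v = 0\<^sub>m d 1"
    by (simp add: U_def mat_ring \<phi>v)
  have UW: "U * W = 1\<^sub>m d"
    by (simp add: U_def mat_ring \<phi>W VW)
  have "W * U = (1\<^sub>m (Suc d) - E) * (1\<^sub>m (Suc d) - v * \<phi>)"
    unfolding U_def by (subst WV[symmetric], subst mat_assoc) auto
  also have "\<dots> = 1\<^sub>m (Suc d) - v * \<phi>"
    by (simp add: mat_minus_distR mat_minus_distL mat_oneL mat_oneR Ev) (intro eq_matI, auto)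
  finally have "W * U + v * \<phi> = 1\<^sub>m (Suc d)"
    by (intro eq_matI) auto
  then show ?thesis
    by (intro that[of \<phi> W U] \<phi>v UW Uv carrier_matI c)
qed

text \<open>Gaussian elimination, one pivot column at a time. The matrix \<open>u\<close> is the
  cokernel of \<open>g\<close>, \<open>t\<close> a section of it, and \<open>g * r\<close> the
  complementary projection onto the image of \<open>g\<close>. Later proofs use only these
  equations; if \<open>u\<close> vanishes, \<open>r\<close> is a right inverse of
  \<open>g\<close>.\<close>

lemma cokernel_exists:
  fixes g :: "'k::field mat"
  assumes "g \<in> carrier_mat y x"
  obtains w u t r where "u \<in> carrier_mat w y" "t \<in> carrier_mat y w" "r \<in> carrier_mat x y"
    "u * g = 0\<^sub>m w x" "u * t = 1\<^sub>m w" "t * u + g * r = 1\<^sub>m y"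
proof -
  have "\<exists>w u t r. u \<in> carrier_mat w y \<and> t \<in> carrier_mat y w \<and> r \<in> carrier_mat x y \<and>
    u * g = 0\<^sub>m w x \<and> u * t = 1\<^sub>m w \<and> t * u + g * r = 1\<^sub>m y"
    using assms
  proof (induction y arbitrary: g)
    case 0
    then show ?case
      by (intro exI[of _ 0] exI[of _ "0\<^sub>m 0 0"] exI[of _ "0\<^sub>m x 0"]) auto
  next
    case (Suc d)
    show ?case
    proof (cases "g = 0\<^sub>m (Suc d) x")
      case True
      then show ?thesis
        by (intro exI[of _ "Suc d"] exI[of _ "1\<^sub>m (Suc d)"] exI[of _ "0\<^sub>m x (Suc d)"]) auto
    next
      case False
      then obtain p c where pc: "p < Suc d" "c < x" "g $$ (p, c) \<noteq> 0"
        using Suc.prems by (metis carrier_matD eq_matI index_zero_mat)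
      define e where "e = mat x 1 (\<lambda>(i, j). if i = c then 1 else 0 :: 'k)"
      have e: "dim_row e = x" "dim_col e = 1" and g: "dim_row g = Suc d" "dim_col g = x"
        using Suc.prems by (auto simp: e_def)
      have gp: "(g * e) $$ (p, 0) \<noteq> 0"
        using pc g by (simp add: e_def scalar_prod_def if_distrib sum.delta cong: if_cong)
      have ge: "g * e \<in> carrier_mat (Suc d) 1" using g e by auto
      obtain \<phi> W U where c1: "\<phi> \<in> carrier_mat 1 (Suc d)" "W \<in> carrier_mat (Suc d) d" "U \<in> carrier_mat d (Suc d)"
        and UW: "U * W = 1\<^sub>m d" and Uv: "U * (g * e) = 0\<^sub>m d 1" and dec: "W * U + (g * e) * \<phi> = 1\<^sub>m (Suc d)"
        by (rule split_column[OF ge pc(1) gp])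
      obtain w u t r where c2: "u \<in> carrier_mat w d" "t \<in> carrier_mat d w" "r \<in> carrier_mat x d"
        and ug: "u * (U * g) = 0\<^sub>m w x" and ut: "u * t = 1\<^sub>m w" and tu: "t * u + (U * g) * r = 1\<^sub>m d"
        using Suc.IH[OF mult_carrier_mat[OF c1(3) Suc.prems]] by blast
      note [simp] = e g carrier_matD[OF c1(1)] carrier_matD[OF c1(2)] carrier_matD[OF c1(3)]
        carrier_matD[OF c2(1)] carrier_matD[OF c2(2)] carrier_matD[OF c2(3)]
      \<comment> \<open>On the line spanned by \<open>g * e\<close> a preimage is given by
        \<open>e\<close>. On the complement \<open>r\<close> is right up to a multiple of
        \<open>g * e\<close>, which the last term removes.\<close>
      let ?r = "e * \<phi> + (r * U - e * (\<phi> * (g * (r * U))))"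
      have "(u * U) * g = 0\<^sub>m w x" using ug by (simp add: mat_assoc)
      moreover have "(u * U) * (W * t) = 1\<^sub>m w"
      proof -
        have "(u * U) * (W * t) = u * ((U * W) * t)" by (simp add: mat_assoc)
        then show ?thesis by (simp add: UW mat_oneL ut)
      qed
      moreover have "(W * t) * (u * U) + g * ?r = 1\<^sub>m (Suc d)"
      proof -
        have 1: "W * (t * (u * U)) + W * (U * (g * (r * U))) = W * U"
        proof -
          have "W * ((t * u + (U * g) * r) * U) = W * (t * (u * U)) + W * (U * (g * (r * U)))"
            by (simp add: mat_ring)
          then show ?thesis unfolding tu by (simp add: mat_oneL)
        qed
        have 2: "W * (U * (g * (r * U))) + g * (e * (\<phi> * (g * (r * U)))) = g * (r * U)"
        proof -
          have "(W * U + (g * e) * \<phi>) * (g * (r * U)) = W * (U * (g * (r * U))) + g * (e * (\<phi> * (g * (r * U))))"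
            by (simp add: mat_ring)
          then show ?thesis unfolding dec by (simp add: mat_oneL)
        qed
        have 3: "W * U + g * (e * \<phi>) = 1\<^sub>m (Suc d)" using dec by (simp add: mat_assoc)
        have lin: "A + (B + (C - D)) = I" if "A + F = H" "F + D = C" "H + B = I"
          "A \<in> carrier_mat (Suc d) (Suc d)" "B \<in> carrier_mat (Suc d) (Suc d)" "D \<in> carrier_mat (Suc d) (Suc d)"
          "F \<in> carrier_mat (Suc d) (Suc d)"
          for A B C D F H I :: "'k mat"
          using that(4-7) unfolding that(1,2,3)[symmetric] by (intro eq_matI) auto
        have "(W * t) * (u * U) + g * ?r = W * (t * (u * U)) +
            (g * (e * \<phi>) + (g * (r * U) - g * (e * (\<phi> * (g * (r * U))))))"
          by (simp add: mat_ring)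
        also have "\<dots> = 1\<^sub>m (Suc d)"
          by (rule lin[OF 1 2 3]; rule carrier_matI; simp)
        finally show ?thesis .
      qed
      ultimately show ?thesis
        by (intro exI[of _ w] exI[of _ "u * U"] exI[of _ "W * t"] exI[of _ ?r] conjI carrier_matI) simp_all
    qed
  qed
  then show ?thesis using that by blast
qed

section \<open>Morphisms and short exact sequences\<close>

text \<open>A variant of membership in \<open>Hom\<close> that ignores the values outside the
  vertices, so that composites and sums can be written pointwise.\<close>

definition morphism :: "nat \<Rightarrow> 'k::field qrep \<Rightarrow> 'k qrep \<Rightarrow> (nat \<Rightarrow> 'k mat) \<Rightarrow> bool" where
  "morphism n X Y f \<longleftrightarrow> (\<forall>i\<in>{1..n}. f i \<in> carrier_mat (dimv Y i) (dimv X i)) \<and>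
     (\<forall>i\<in>{1..<n}. f (Suc i) * arr X i = arr Y i * f i)"

definition no_hom :: "nat \<Rightarrow> 'k::field qrep \<Rightarrow> 'k qrep \<Rightarrow> bool" where
  "no_hom n X Y \<longleftrightarrow> (\<forall>f. morphism n X Y f \<longrightarrow> (\<forall>i\<in>{1..n}. f i = 0\<^sub>m (dimv Y i) (dimv X i)))"

text \<open>The cokernel of \<open>h \<mapsto> h X - Y h\<close> from families \<open>h i : X i \<rightarrow> Y i\<close> to families
  \<open>c i : X i \<rightarrow> Y (i + 1)\<close> computes \<open>Ext1 n X Y\<close>.\<close>

definition no_ext :: "nat \<Rightarrow> 'k::field qrep \<Rightarrow> 'k qrep \<Rightarrow> bool" where
  "no_ext n X Y \<longleftrightarrow> (\<forall>c. (\<forall>i\<in>{1..<n}. c i \<in> carrier_mat (dimv Y (Suc i)) (dimv X i)) \<longrightarrow>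
     (\<exists>h. (\<forall>i\<in>{1..n}. h i \<in> carrier_mat (dimv Y i) (dimv X i)) \<and>
       (\<forall>i\<in>{1..<n}. c i = h (Suc i) * arr X i - arr Y i * h i)))"

lemma rep_dim: "is_rep n X \<Longrightarrow> i \<in> {1..<n} \<Longrightarrow> dim_row (arr X i) = dimv X (Suc i) \<and> dim_col (arr X i) = dimv X i"
  by (auto simp: is_rep_def)

lemma morphism_dim: "morphism n X Y f \<Longrightarrow> i \<in> {1..n} \<Longrightarrow> dim_row (f i) = dimv Y i \<and> dim_col (f i) = dimv X i"
  by (auto simp: morphism_def)

lemma morphism_dim_Suc: "morphism n X Y f \<Longrightarrow> i \<in> {1..<n} \<Longrightarrow>
    dim_row (f i) = dimv Y i \<and> dim_col (f i) = dimv X i \<and>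
    dim_row (f (Suc i)) = dimv Y (Suc i) \<and> dim_col (f (Suc i)) = dimv X (Suc i)"
  by (auto simp: morphism_def)

lemma morphism_comm: "morphism n X Y f \<Longrightarrow> i \<in> {1..<n} \<Longrightarrow> f (Suc i) * arr X i = arr Y i * f i"
  by (auto simp: morphism_def)

lemma morphismI:
  "(\<And>i. i \<in> {1..n} \<Longrightarrow> dim_row (f i) = dimv Y i) \<Longrightarrow> (\<And>i. i \<in> {1..n} \<Longrightarrow> dim_col (f i) = dimv X i) \<Longrightarrow>
   (\<And>i. i \<in> {1..<n} \<Longrightarrow> f (Suc i) * arr X i = arr Y i * f i) \<Longrightarrow> morphism n X Y f"
  unfolding morphism_def by (blast intro: carrier_matI)

lemma Hom_iff: "f \<in> Hom n X Y \<longleftrightarrow> morphism n X Y f \<and> f \<in> extensional {1..n}"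
  by (auto simp: Hom_def morphism_def PiE_def)

lemma morphism_cong: "(\<And>i. i \<in> {1..n} \<Longrightarrow> f i = g i) \<Longrightarrow> morphism n X Y f \<longleftrightarrow> morphism n X Y g"
  unfolding morphism_def by (intro arg_cong2[where f = "(\<and>)"] ball_cong) auto

lemma restrict_in_Hom: "morphism n X Y f \<Longrightarrow> restrict f {1..n} \<in> Hom n X Y"
  unfolding Hom_iff by (subst morphism_cong[of _ _ f]) auto

lemma Hom_eqI: "f \<in> Hom n X Y \<Longrightarrow> g \<in> Hom n X Y \<Longrightarrow> (\<And>i. i \<in> {1..n} \<Longrightarrow> f i = g i) \<Longrightarrow> f = g"
  unfolding Hom_iff by (auto intro: extensionalityI)

lemma morphism_comp:
  assumes r: "is_rep n X" "is_rep n Y" "is_rep n Z" and f: "morphism n X Y f" and g: "morphism n Y Z g"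
  shows "morphism n X Z (\<lambda>i. g i * f i)"
proof -
  have "(g (Suc i) * f (Suc i)) * arr X i = arr Z i * (g i * f i)" if i: "i \<in> {1..<n}" for i
  proof -
    note [simp] = rep_dim[OF r(1) i] rep_dim[OF r(2) i] rep_dim[OF r(3) i]
      morphism_dim_Suc[OF f i] morphism_dim_Suc[OF g i]
    have "(g (Suc i) * f (Suc i)) * arr X i = g (Suc i) * (f (Suc i) * arr X i)" by (simp add: mat_assoc)
    also have "\<dots> = (g (Suc i) * arr Y i) * f i" by (simp add: morphism_comm[OF f i] mat_assoc)
    also have "\<dots> = arr Z i * (g i * f i)" by (simp add: morphism_comm[OF g i] mat_assoc)
    finally show ?thesis .
  qed
  then show ?thesis using morphism_dim[OF f] morphism_dim[OF g] by (intro morphismI) simp_all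
qed

lemma morphism_add:
  assumes r: "is_rep n X" "is_rep n Y" and f: "morphism n X Y f" and g: "morphism n X Y g"
  shows "morphism n X Y (\<lambda>i. f i + g i)"
proof -
  have "(f (Suc i) + g (Suc i)) * arr X i = arr Y i * (f i + g i)" if i: "i \<in> {1..<n}" for i
  proof -
    note [simp] = rep_dim[OF r(1) i] rep_dim[OF r(2) i] morphism_dim_Suc[OF f i] morphism_dim_Suc[OF g i]
    show ?thesis by (simp add: mat_ring morphism_comm[OF f i] morphism_comm[OF g i])
  qed
  then show ?thesis using morphism_dim[OF f] morphism_dim[OF g] by (intro morphismI) simp_all
qed

lemma morphism_zero: "is_rep n X \<Longrightarrow> is_rep n Y \<Longrightarrow> morphism n X Y (\<lambda>i. 0\<^sub>m (dimv Y i) (dimv X i))"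
  by (auto simp: morphism_def mat_zeroL mat_zeroR rep_dim)

lemma morphism_id: "is_rep n X \<Longrightarrow> morphism n X X (\<lambda>i. 1\<^sub>m (dimv X i))"
  by (auto simp: morphism_def mat_oneL mat_oneR rep_dim)

lemma Hom_vanishes_iff:
  assumes "is_rep n X" "is_rep n Y"
  shows "Hom_vanishes n X Y \<longleftrightarrow> no_hom n X Y"
proof
  assume H: "Hom_vanishes n X Y"
  show "no_hom n X Y" unfolding no_hom_def
  proof (intro allI impI ballI)
    fix f i assume f: "morphism n X Y f" and i: "i \<in> {1..n}"
    have "restrict f {1..n} = zero_hom n X Y"
      using H restrict_in_Hom[OF f] by (auto simp: Hom_vanishes_def)
    then show "f i = 0\<^sub>m (dimv Y i) (dimv X i)"
      using i by (auto simp: zero_hom_def fun_eq_iff restrict_def split: if_splits)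
  qed
next
  assume H: "no_hom n X Y"
  have z: "zero_hom n X Y \<in> Hom n X Y"
    unfolding zero_hom_def by (rule restrict_in_Hom[OF morphism_zero[OF assms]])
  have "f = zero_hom n X Y" if f: "f \<in> Hom n X Y" for f
  proof (rule Hom_eqI[OF f z])
    fix i assume i: "i \<in> {1..n}"
    have "f i = 0\<^sub>m (dimv Y i) (dimv X i)" using H f i unfolding no_hom_def Hom_iff by blast
    then show "f i = zero_hom n X Y i" using i by (simp add: zero_hom_def)
  qed
  then show "Hom_vanishes n X Y" using z unfolding Hom_vanishes_def by blast
qed

section \<open>Biproducts and splittings at the vertices\<close>

definition biproduct :: "nat \<Rightarrow> 'k::field qrep \<Rightarrow> 'k qrep \<Rightarrow> 'k qrep \<Rightarrow> (nat \<Rightarrow> 'k mat) \<Rightarrow>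
    (nat \<Rightarrow> 'k mat) \<Rightarrow> (nat \<Rightarrow> 'k mat) \<Rightarrow> (nat \<Rightarrow> 'k mat) \<Rightarrow> bool" where
  "biproduct n W X Z s p t q \<longleftrightarrow>
     morphism n X W s \<and> morphism n W X p \<and> morphism n Z W t \<and> morphism n W Z q \<and>
     (\<forall>i\<in>{1..n}. p i * s i = 1\<^sub>m (dimv X i) \<and> q i * t i = 1\<^sub>m (dimv Z i) \<and>
        p i * t i = 0\<^sub>m (dimv X i) (dimv Z i) \<and> q i * s i = 0\<^sub>m (dimv Z i) (dimv X i) \<and>
        s i * p i + t i * q i = 1\<^sub>m (dimv W i))"

text \<open>Linear algebra at a single vertex, so \<open>r\<close> and \<open>s\<close> need not
  commute with the arrows. A right inverse \<open>s\<close> of \<open>g i\<close> exists by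
  surjectivity; the columns of \<open>1 - s * g i\<close> lie in the kernel of \<open>g i\<close>,
  that is, in the image of \<open>f i\<close>, which gives \<open>r\<close>. The remaining equations
  follow by cancelling \<open>f i\<close>.\<close>

lemma short_exact_splits_vertexwise:
  assumes se: "short_exact n Y E X f g" and i: "i \<in> {1..n}"
  obtains r s where "r \<in> carrier_mat (dimv Y i) (dimv E i)" "s \<in> carrier_mat (dimv E i) (dimv X i)"
    "r * f i = 1\<^sub>m (dimv Y i)" "g i * s = 1\<^sub>m (dimv X i)" "f i * r + s * g i = 1\<^sub>m (dimv E i)"
    "g i * f i = 0\<^sub>m (dimv X i) (dimv Y i)" "r * s = 0\<^sub>m (dimv Y i) (dimv X i)"
proof -
  let ?y = "dimv Y i" and ?e = "dimv E i" and ?x = "dimv X i"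
  have f: "f i \<in> carrier_mat ?e ?y" and g: "g i \<in> carrier_mat ?x ?e"
    using se i by (auto simp: short_exact_def Hom_carrier)
  have inj: "inj_on (\<lambda>v. f i *\<^sub>v v) (carrier_vec ?y)"
    and ker: "(\<lambda>v. f i *\<^sub>v v) ` carrier_vec ?y = mat_kernel (g i)"
    and sur: "(\<lambda>v. g i *\<^sub>v v) ` carrier_vec ?e = carrier_vec ?x"
    using se i by (auto simp: short_exact_def)
  note [simp] = carrier_matD[OF f] carrier_matD[OF g]
  have "\<exists>s\<in>carrier_mat ?e ?x. g i * s = 1\<^sub>m ?x"
  proof (rule mat_solve_cols[OF g])
    fix j assume "j < ?x"
    then show "\<exists>v\<in>carrier_vec ?e. g i *\<^sub>v v = col (1\<^sub>m ?x) j"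
      using sur by (metis col_one imageE unit_vec_carrier)
  qed simp
  then obtain s where s: "s \<in> carrier_mat ?e ?x" and gs: "g i * s = 1\<^sub>m ?x" by blast
  note [simp] = carrier_matD[OF s]
  have c1: "1\<^sub>m ?e - s * g i \<in> carrier_mat ?e ?e" by (rule carrier_matI) auto
  have g0: "g i * (1\<^sub>m ?e - s * g i) = 0\<^sub>m ?x ?e"
  proof -
    have "g i * (1\<^sub>m ?e - s * g i) = g i - (g i * s) * g i" by (simp add: mat_ring)
    then show ?thesis by (simp add: gs mat_ring)
  qed
  have "\<exists>r\<in>carrier_mat ?y ?e. f i * r = 1\<^sub>m ?e - s * g i"
  proof (rule mat_solve_cols[OF f c1])
    fix j assume j: "j < ?e"
    have "g i *\<^sub>v col (1\<^sub>m ?e - s * g i) j = col (g i * (1\<^sub>m ?e - s * g i)) j"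
      by (rule col_mult2[symmetric, OF g c1 j])
    also have "\<dots> = 0\<^sub>v ?x" unfolding g0 using j by auto
    finally have "col (1\<^sub>m ?e - s * g i) j \<in> mat_kernel (g i)"
      using col_carrier_vec[OF j c1] by (intro mat_kernelI[OF g])
    then show "\<exists>v\<in>carrier_vec ?y. f i *\<^sub>v v = col (1\<^sub>m ?e - s * g i) j"
      unfolding ker[symmetric] by auto
  qed
  then obtain r where r: "r \<in> carrier_mat ?y ?e" and fr: "f i * r = 1\<^sub>m ?e - s * g i" by blast
  note [simp] = carrier_matD[OF r]
  have gf: "g i * f i = 0\<^sub>m ?x ?y"
  proof (rule mat_col_eqI)
    fix j assume "j < dim_col (0\<^sub>m ?x ?y)"
    then have j: "j < ?y" by simp
    have "f i *\<^sub>v col (1\<^sub>m ?y) j \<in> mat_kernel (g i)" unfolding ker[symmetric] using j by auto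
    then have "f i *\<^sub>v unit_vec ?y j \<in> mat_kernel (g i)" using j by simp
    moreover have "f i *\<^sub>v unit_vec ?y j = col (f i) j"
      using col_mult2[OF f one_carrier_mat j] j f by simp
    ultimately have "g i *\<^sub>v col (f i) j = 0\<^sub>v ?x"
      using mat_kernelD[OF g] by auto
    then show "col (g i * f i) j = col (0\<^sub>m ?x ?y) j"
      using col_mult2[OF g f j] j by auto
  qed auto
  have cancel: "A = B" if "A \<in> carrier_mat ?y m" "B \<in> carrier_mat ?y m" "f i * A = f i * B" for A B m
  proof (rule mat_col_eqI)
    fix j assume "j < dim_col B"
    then have j: "j < m" using that by simp
    have "f i *\<^sub>v col A j = f i *\<^sub>v col B j"
      using col_mult2[OF f that(1) j] col_mult2[OF f that(2) j] that(3) by simp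
    then show "col A j = col B j"
      by (rule inj_onD[OF inj]) (use that j in auto)
  qed (use that in auto)
  have rf: "r * f i = 1\<^sub>m ?y"
  proof (rule cancel[of _ ?y])
    have "f i * (r * f i) = (f i * r) * f i" by (simp add: mat_ring)
    also have "\<dots> = f i - s * (g i * f i)" unfolding fr by (simp add: mat_ring)
    also have "\<dots> = f i * 1\<^sub>m ?y" unfolding gf by (simp add: mat_ring)
    finally show "f i * (r * f i) = f i * 1\<^sub>m ?y" .
  qed (auto intro: carrier_matI)
  have rs: "r * s = 0\<^sub>m ?y ?x"
  proof (rule cancel[of _ ?x])
    have "f i * (r * s) = (f i * r) * s" by (simp add: mat_ring)
    also have "\<dots> = s - s * (g i * s)" unfolding fr by (simp add: mat_ring)
    also have "\<dots> = f i * 0\<^sub>m ?y ?x" unfolding gs by (simp add: mat_ring)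
    finally show "f i * (r * s) = f i * 0\<^sub>m ?y ?x" .
  qed (auto intro: carrier_matI)
  have "f i * r + s * g i = 1\<^sub>m ?e" unfolding fr by (intro eq_matI) auto
  then show ?thesis using that r s rf gs gf rs by blast
qed

text \<open>Exactness is a condition at each vertex, so a splitting there certifies it, whether or
  not the splitting is natural. This applies to the nonsplit extensions built by
  \<open>twisted_sum\<close>.\<close>

lemma biproduct_short_exact:
  fixes Y E X :: "'k::field qrep"
  assumes r: "is_rep n Y" "is_rep n E" "is_rep n X"
    and "f \<in> Hom n Y E" "g \<in> Hom n E X"
    and eqs: "\<And>i. i \<in> {1..n} \<Longrightarrow> r i \<in> carrier_mat (dimv Y i) (dimv E i) \<and>
        s i \<in> carrier_mat (dimv E i) (dimv X i) \<and>
      r i * f i = 1\<^sub>m (dimv Y i) \<and> g i * s i = 1\<^sub>m (dimv X i) \<and> f i * r i + s i * g i = 1\<^sub>m (dimv E i) \<and>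
      g i * f i = 0\<^sub>m (dimv X i) (dimv Y i)"
  shows "short_exact n Y E X f g"
  unfolding short_exact_def
proof (intro conjI ballI assms(4,5))
  fix i assume i: "i \<in> {1..n}"
  let ?y = "dimv Y i" and ?e = "dimv E i" and ?x = "dimv X i"
  have f: "f i \<in> carrier_mat ?e ?y" and g: "g i \<in> carrier_mat ?x ?e"
    using assms(4,5) i by (auto simp: Hom_carrier)
  have r: "r i \<in> carrier_mat ?y ?e" and s: "s i \<in> carrier_mat ?e ?x"
    and e: "r i * f i = 1\<^sub>m ?y" "g i * s i = 1\<^sub>m ?x" "f i * r i + s i * g i = 1\<^sub>m ?e" "g i * f i = 0\<^sub>m ?x ?y"
    using eqs[OF i] by auto
  show "inj_on (\<lambda>v. f i *\<^sub>v v) (carrier_vec ?y)"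
  proof (rule inj_on_inverseI)
    fix v :: "'k vec" assume "v \<in> carrier_vec ?y"
    then show "r i *\<^sub>v (f i *\<^sub>v v) = v"
      using assoc_mult_mat_vec[OF r f, of v] e(1) by simp
  qed
  show "(\<lambda>v. g i *\<^sub>v v) ` carrier_vec ?e = carrier_vec ?x"
  proof
    show "carrier_vec ?x \<subseteq> (\<lambda>v. g i *\<^sub>v v) ` carrier_vec ?e"
    proof
      fix v :: "'k vec" assume v: "v \<in> carrier_vec ?x"
      then have "g i *\<^sub>v (s i *\<^sub>v v) = v" using assoc_mult_mat_vec[OF g s v] e(2) by simp
      then show "v \<in> (\<lambda>v. g i *\<^sub>v v) ` carrier_vec ?e" using s v by (metis image_eqI mult_mat_vec_carrier)
    qed
  qed (use g in auto)
  show "(\<lambda>v. f i *\<^sub>v v) ` carrier_vec ?y = mat_kernel (g i)"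
  proof (intro equalityI subsetI)
    fix w assume "w \<in> (\<lambda>v. f i *\<^sub>v v) ` carrier_vec ?y"
    then obtain v where v: "v \<in> carrier_vec ?y" "w = f i *\<^sub>v v" by blast
    have "g i *\<^sub>v w = 0\<^sub>m ?x ?y *\<^sub>v v" using assoc_mult_mat_vec[OF g f v(1)] e(4) v(2) by simp
    also have "\<dots> = 0\<^sub>v ?x" using v(1) by (intro eq_vecI) auto
    finally have "g i *\<^sub>v w = 0\<^sub>v ?x" .
    then show "w \<in> mat_kernel (g i)" using v f by (intro mat_kernelI[OF g]) auto
  next
    fix w assume "w \<in> mat_kernel (g i)"
    then have w: "w \<in> carrier_vec ?e" "g i *\<^sub>v w = 0\<^sub>v ?x" using mat_kernelD[OF g] by auto
    have "w = (f i * r i + s i * g i) *\<^sub>v w" using e(3) w by simp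
    also have "\<dots> = (f i * r i) *\<^sub>v w + (s i * g i) *\<^sub>v w"
      by (rule add_mult_distrib_mat_vec[of _ ?e ?e]) (use f r s g w in auto)
    also have "\<dots> = f i *\<^sub>v (r i *\<^sub>v w) + s i *\<^sub>v (g i *\<^sub>v w)"
      using assoc_mult_mat_vec[OF f r w(1)] assoc_mult_mat_vec[OF s g w(1)] by simp
    also have "s i *\<^sub>v (g i *\<^sub>v w) = 0\<^sub>v ?e" unfolding w(2) using s by (intro eq_vecI) auto
    also have "f i *\<^sub>v (r i *\<^sub>v w) + 0\<^sub>v ?e = f i *\<^sub>v (r i *\<^sub>v w)" using f r w by auto
    finally show "w \<in> (\<lambda>v. f i *\<^sub>v v) ` carrier_vec ?y" using r w by (metis image_eqI mult_mat_vec_carrier)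
  qed
qed

text \<open>The empty blocks make the rule for products of block matrices applicable.\<close>

definition "inL x z = four_block_mat (1\<^sub>m x) (0\<^sub>m x 0) (0\<^sub>m z x) (0\<^sub>m z 0)"
definition "inR x z = four_block_mat (0\<^sub>m x 0) (0\<^sub>m x z) (0\<^sub>m z 0) (1\<^sub>m z)"
definition "prL x z = four_block_mat (1\<^sub>m x) (0\<^sub>m x z) (0\<^sub>m 0 x) (0\<^sub>m 0 z)"
definition "prR x z = four_block_mat (0\<^sub>m 0 x) (0\<^sub>m 0 z) (0\<^sub>m z x) (1\<^sub>m z)"

lemma block_dims [simp]:
  "dim_row (inL x z) = x + z" "dim_col (inL x z) = x" "dim_row (inR x z) = x + z" "dim_col (inR x z) = z"
  "dim_row (prL x z) = x" "dim_col (prL x z) = x + z" "dim_row (prR x z) = z" "dim_col (prR x z) = x + z"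
  by (simp_all add: inL_def inR_def prL_def prR_def)

lemma block_eqs:
  "prL x z * inL x z = (1\<^sub>m x :: 'k::field mat)" "prR x z * inR x z = (1\<^sub>m z :: 'k mat)"
  "prL x z * inR x z = (0\<^sub>m x z :: 'k mat)" "prR x z * inL x z = (0\<^sub>m z x :: 'k mat)"
  "inL x z * prL x z + inR x z * prR x z = (1\<^sub>m (x + z) :: 'k mat)"
proof -
  have d: "1\<^sub>m (x + z) = (four_block_mat (1\<^sub>m x) (0\<^sub>m x z) (0\<^sub>m z x) (1\<^sub>m z) :: 'k mat)"
    by (intro eq_matI) auto
  show "prL x z * inL x z = (1\<^sub>m x :: 'k::field mat)" "prR x z * inR x z = (1\<^sub>m z :: 'k mat)"
    "prL x z * inR x z = (0\<^sub>m x z :: 'k mat)" "prR x z * inL x z = (0\<^sub>m z x :: 'k mat)"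
    unfolding inL_def inR_def prL_def prR_def
    by (subst mult_four_block_mat; (auto; fail)?; (intro eq_matI; auto))+
  show "inL x z * prL x z + inR x z * prR x z = (1\<^sub>m (x + z) :: 'k mat)"
    unfolding d inL_def inR_def prL_def prR_def
    by (subst mult_four_block_mat, (auto)[8], subst mult_four_block_mat, (auto)[8]) (intro eq_matI, auto)
qed

text \<open>Replaces the blocks in \<open>direct_sum\<close> by inclusions and projections, so that
  the arrows of a direct sum can be treated with \<open>block_eqs\<close> alone.\<close>

lemma four_block_diag:
  fixes A B :: "'k::field mat"
  assumes "A \<in> carrier_mat x' x" "B \<in> carrier_mat z' z"
  shows "four_block_mat A (0\<^sub>m x' z) (0\<^sub>m z' x) B = inL x' z' * (A * prL x z) + inR x' z' * (B * prR x z)"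
proof -
  note [simp] = carrier_matD[OF assms(1)] carrier_matD[OF assms(2)]
  have 1: "A * prL x z = four_block_mat A (0\<^sub>m x' z) (0\<^sub>m 0 x) (0\<^sub>m 0 z)"
  proof -
    have "four_block_mat A (0\<^sub>m x' 0) (0\<^sub>m 0 x) (0\<^sub>m 0 0) * prL x z = four_block_mat A (0\<^sub>m x' z) (0\<^sub>m 0 x)
        (0\<^sub>m 0 z)"
      unfolding prL_def by (subst mult_four_block_mat[OF assms(1)]) (auto simp: mat_ring assms)
    moreover have "four_block_mat A (0\<^sub>m x' 0) (0\<^sub>m 0 x) (0\<^sub>m 0 0) = A" by (intro eq_matI) auto
    ultimately show ?thesis by simp
  qed
  have 2: "B * prR x z = four_block_mat (0\<^sub>m 0 x) (0\<^sub>m 0 z) (0\<^sub>m z' x) B"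
  proof -
    have "four_block_mat (0\<^sub>m 0 0) (0\<^sub>m 0 z) (0\<^sub>m z' 0) B * prR x z = four_block_mat (0\<^sub>m 0 x) (0\<^sub>m 0 z)
        (0\<^sub>m z' x) B"
      unfolding prR_def by (subst mult_four_block_mat[OF _ _ _ assms(2)]) (auto simp: mat_ring assms)
    moreover have "four_block_mat (0\<^sub>m 0 0) (0\<^sub>m 0 z) (0\<^sub>m z' 0) B = B" by (intro eq_matI) auto
    ultimately show ?thesis by simp
  qed
  have 3: "inL x' z' * four_block_mat A (0\<^sub>m x' z) (0\<^sub>m 0 x) (0\<^sub>m 0 z) = four_block_mat A (0\<^sub>m x' z)
      (0\<^sub>m z' x) (0\<^sub>m z' z)"
    unfolding inL_def by (subst mult_four_block_mat[OF _ _ _ _ assms(1)]) (auto simp: mat_ring assms)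
  have 4: "inR x' z' * four_block_mat (0\<^sub>m 0 x) (0\<^sub>m 0 z) (0\<^sub>m z' x) B = four_block_mat (0\<^sub>m x' x)
      (0\<^sub>m x' z) (0\<^sub>m z' x) B"
    unfolding inR_def by (subst mult_four_block_mat[OF _ _ _ _ _ _ _ assms(2)]) (auto simp: mat_ring assms)
  show ?thesis unfolding 1 2 3 4 by (intro eq_matI) auto
qed

section \<open>Vanishing of Ext\<close>

lemma biproduct_dim:
  assumes "biproduct n W X Z s p t q" "i \<in> {1..n}"
  shows "dim_row (s i) = dimv W i" "dim_col (s i) = dimv X i" "dim_row (p i) = dimv X i"
      "dim_col (p i) = dimv W i"
    "dim_row (t i) = dimv W i" "dim_col (t i) = dimv Z i" "dim_row (q i) = dimv Z i" "dim_col (q i) = dimv W i"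
  using assms morphism_dim unfolding biproduct_def by metis+

lemma biproduct_eqs:
  assumes "biproduct n W X Z s p t q" "i \<in> {1..n}"
  shows "p i * s i = 1\<^sub>m (dimv X i)" "q i * t i = 1\<^sub>m (dimv Z i)" "p i * t i = 0\<^sub>m (dimv X i) (dimv Z i)"
    "q i * s i = 0\<^sub>m (dimv Z i) (dimv X i)" "s i * p i + t i * q i = 1\<^sub>m (dimv W i)"
  using assms unfolding biproduct_def by auto

lemma biproduct_morphism:
  assumes "biproduct n W X Z s p t q"
  shows "morphism n X W s" "morphism n W X p" "morphism n Z W t" "morphism n W Z q"
  using assms unfolding biproduct_def by auto

lemma extension_splits:
  assumes r: "is_rep n X" "is_rep n Y" and ext: "no_ext n X Y" and E: "(E, f, g) \<in> extensions n X Y"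
  obtains r s where "biproduct n E Y X f r s g"
proof -
  have rE: "is_rep n E" and se: "short_exact n Y E X f g" using E by (auto simp: extensions_def)
  then have f: "morphism n Y E f" and g: "morphism n E X g" by (auto simp: short_exact_def Hom_iff)
  have "\<exists>r s. r \<in> carrier_mat (dimv Y i) (dimv E i) \<and> s \<in> carrier_mat (dimv E i) (dimv X i) \<and>
    r * f i = 1\<^sub>m (dimv Y i) \<and> g i * s = 1\<^sub>m (dimv X i) \<and> f i * r + s * g i = 1\<^sub>m (dimv E i) \<and>
    g i * f i = 0\<^sub>m (dimv X i) (dimv Y i) \<and> r * s = 0\<^sub>m (dimv Y i) (dimv X i)" if "i \<in> {1..n}" for i
    by (rule short_exact_splits_vertexwise[OF se that]) blast
  then obtain r s where rs: "\<And>i. i \<in> {1..n} \<Longrightarrow> r i \<in> carrier_mat (dimv Y i) (dimv E i) \<and>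
    s i \<in> carrier_mat (dimv E i) (dimv X i) \<and>
    r i * f i = 1\<^sub>m (dimv Y i) \<and> g i * s i = 1\<^sub>m (dimv X i) \<and> f i * r i + s i * g i = 1\<^sub>m (dimv E i) \<and>
    g i * f i = 0\<^sub>m (dimv X i) (dimv Y i) \<and> r i * s i = 0\<^sub>m (dimv Y i) (dimv X i)"
    by metis
  \<comment> \<open>\<open>c\<close> measures how far the splitting is from being natural: along the
    arrow \<open>i\<close> one has \<open>E s = s X + f c\<close> and
    \<open>r E = Y r + c g\<close>. A solution of \<open>c = h X - Y h\<close> makes
    \<open>s + f h\<close> and \<open>r - h g\<close> natural.\<close>
  define c where "c i = r (Suc i) * (arr E i * s i)" for i
  have d: "dim_row (r i) = dimv Y i" "dim_col (r i) = dimv E i" "dim_row (s i) = dimv E i"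
      "dim_col (s i) = dimv X i"
    if "i \<in> {1..n}" for i using rs[OF that] by auto
  have "c i \<in> carrier_mat (dimv Y (Suc i)) (dimv X i)" if "i \<in> {1..<n}" for i
    using that d by (intro carrier_matI) (auto simp: c_def)
  then obtain h where h: "\<And>i. i \<in> {1..n} \<Longrightarrow> h i \<in> carrier_mat (dimv Y i) (dimv X i)"
    and ch: "\<And>i. i \<in> {1..<n} \<Longrightarrow> c i = h (Suc i) * arr X i - arr Y i * h i"
    using ext unfolding no_ext_def by metis
  have dh: "dim_row (h i) = dimv Y i" "dim_col (h i) = dimv X i" if "i \<in> {1..n}" for i
    using h[OF that] by auto
  let ?s = "\<lambda>i. s i + f i * h i" and ?r = "\<lambda>i. r i - h i * g i"
  have e: "?r i * f i = 1\<^sub>m (dimv Y i)" "g i * ?s i = 1\<^sub>m (dimv X i)" "?r i * ?s i = 0\<^sub>m (dimv Y i) (dimv X i)"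
    "g i * f i = 0\<^sub>m (dimv X i) (dimv Y i)" "f i * ?r i + ?s i * g i = 1\<^sub>m (dimv E i)" if i: "i \<in> {1..n}" for i
  proof -
    note [simp] = d[OF i] dh[OF i] morphism_dim[OF f i] morphism_dim[OF g i]
    have e: "r i * f i = 1\<^sub>m (dimv Y i)" "g i * s i = 1\<^sub>m (dimv X i)" "f i * r i + s i * g i = 1\<^sub>m (dimv E i)"
      "g i * f i = 0\<^sub>m (dimv X i) (dimv Y i)" "r i * s i = 0\<^sub>m (dimv Y i) (dimv X i)"
      using rs[OF i] by auto
    have e': "r i * (f i * h i) = h i" "g i * (f i * h i) = 0\<^sub>m (dimv X i) (dimv X i)"
      using mat_assoc[of "r i" "f i" "h i"] mat_assoc[of "g i" "f i" "h i"] by (simp_all add: e mat_ring)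
    have z: "0\<^sub>m (dimv Y i) (dimv X i) - h i + h i = 0\<^sub>m (dimv Y i) (dimv X i)" by (intro eq_matI) auto
    show "?r i * f i = 1\<^sub>m (dimv Y i)" "g i * ?s i = 1\<^sub>m (dimv X i)" "?r i * ?s i = 0\<^sub>m (dimv Y i) (dimv X i)"
      "g i * f i = 0\<^sub>m (dimv X i) (dimv Y i)"
      by (simp_all add: mat_ring e e' z)
    have "f i * ?r i + ?s i * g i = (f i * r i - f i * (h i * g i)) + (s i * g i + f i * (h i * g i))"
      by (simp add: mat_ring)
    also have "\<dots> = f i * r i + s i * g i" by (intro eq_matI) auto
    finally show "f i * ?r i + ?s i * g i = 1\<^sub>m (dimv E i)" by (simp add: e)
  qed
  have s: "morphism n X E ?s" and r: "morphism n E Y ?r"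
  proof -
    have sr: "?s (Suc i) * arr X i = arr E i * ?s i \<and> ?r (Suc i) * arr E i = arr Y i * ?r i"
        if i: "i \<in> {1..<n}" for i
    proof -
      have i': "i \<in> {1..n}" "Suc i \<in> {1..n}" using i by auto
      note [simp] = rep_dim[OF r(1) i] rep_dim[OF r(2) i] rep_dim[OF rE i] d[OF i'(1)] d[OF i'(2)]
        dh[OF i'(1)] dh[OF i'(2)] morphism_dim_Suc[OF f i] morphism_dim_Suc[OF g i]
      note dec = rs[OF i'(1), THEN conjunct2, THEN conjunct2, THEN conjunct2, THEN conjunct2, THEN conjunct1]
      note dec' = rs[OF i'(2), THEN conjunct2, THEN conjunct2, THEN conjunct2, THEN conjunct2, THEN conjunct1]
      have gs: "g i * s i = 1\<^sub>m (dimv X i)" and rf: "r (Suc i) * f (Suc i) = 1\<^sub>m (dimv Y (Suc i))"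
        using rs[OF i'(1)] rs[OF i'(2)] by auto
      have dc: "dim_row (c i) = dimv Y (Suc i)" "dim_col (c i) = dimv X i" by (auto simp: c_def)
      note comm = morphism_comm[OF f i] morphism_comm[OF g i]
      have Es: "arr E i * s i = f (Suc i) * c i + s (Suc i) * arr X i"
      proof -
        have "arr E i * s i = (f (Suc i) * r (Suc i) + s (Suc i) * g (Suc i)) * (arr E i * s i)"
          by (simp add: dec' mat_oneL)
        also have "\<dots> = f (Suc i) * c i + s (Suc i) * ((g (Suc i) * arr E i) * s i)"
          by (simp add: mat_ring c_def)
        also have "(g (Suc i) * arr E i) * s i = arr X i" unfolding comm(2) by (simp add: mat_ring gs)
        finally show ?thesis .
      qed
      have rE': "r (Suc i) * arr E i = arr Y i * r i + c i * g i"
      proof -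
        have "r (Suc i) * arr E i = (r (Suc i) * arr E i) * (f i * r i + s i * g i)"
          by (simp add: dec mat_oneR)
        also have "\<dots> = r (Suc i) * ((arr E i * f i) * r i) + c i * g i"
          by (simp add: mat_ring c_def)
        also have "r (Suc i) * ((arr E i * f i) * r i) = (r (Suc i) * f (Suc i)) * (arr Y i * r i)"
          unfolding comm(1)[symmetric] by (simp add: mat_ring)
        finally show ?thesis by (simp add: rf mat_oneL)
      qed
      have "arr E i * ?s i = f (Suc i) * c i + s (Suc i) * arr X i + (arr E i * f i) * h i"
        by (simp add: mat_ring Es)
      also have "\<dots> = f (Suc i) * (h (Suc i) * arr X i) - f (Suc i) * (arr Y i * h i) + s (Suc i) * arr X i
          + f (Suc i) * (arr Y i * h i)"
        unfolding comm(1)[symmetric] ch[OF i] by (simp add: mat_ring)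
      also have "\<dots> = ?s (Suc i) * arr X i"
        by (simp add: mat_ring) (intro eq_matI, auto)
      finally have 1: "?s (Suc i) * arr X i = arr E i * ?s i" by simp
      have "?r (Suc i) * arr E i = arr Y i * r i + c i * g i - h (Suc i) * (g (Suc i) * arr E i)"
        by (simp add: mat_ring rE')
      also have "\<dots> = arr Y i * r i + (h (Suc i) * (arr X i * g i) - arr Y i * (h i * g i)) - h (Suc i)
          * (arr X i * g i)"
        unfolding comm(2) ch[OF i] by (simp add: mat_ring)
      also have "\<dots> = arr Y i * ?r i"
        by (simp add: mat_ring) (intro eq_matI, auto)
      finally show ?thesis using 1 by simp
    qed
    show "morphism n X E ?s" "morphism n E Y ?r"
      by (rule morphismI; use sr d dh morphism_dim[OF f] morphism_dim[OF g] in simp)+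
  qed
  have "biproduct n E Y X f ?r ?s g"
    unfolding biproduct_def using f g s r e by blast
  then show ?thesis by (rule that)
qed

text \<open>Going through the common summands, \<open>f' r + s' g\<close> and
  \<open>f r' + s g'\<close> are mutually inverse. This yields both the equivalence of split
  extensions and the isomorphism of a module with a direct sum of its summands.\<close>

lemma biproduct_compare:
  assumes r: "is_rep n X" "is_rep n Y" "is_rep n E" "is_rep n E'"
    and b: "biproduct n E Y X f r s g" and b': "biproduct n E' Y X f' r' s' g'"
  obtains h k where "morphism n E E' h" "morphism n E' E k"
    "\<And>i. i \<in> {1..n} \<Longrightarrow> k i * h i = 1\<^sub>m (dimv E i)" "\<And>i. i \<in> {1..n} \<Longrightarrow> h i * k i = 1\<^sub>m (dimv E' i)"
    "\<And>i. i \<in> {1..n} \<Longrightarrow> h i * f i = f' i" "\<And>i. i \<in> {1..n} \<Longrightarrow> g' i * h i = g i"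
proof -
  let ?h = "\<lambda>i. f' i * r i + s' i * g i" and ?k = "\<lambda>i. f i * r' i + s i * g' i"
  have hk: "morphism n E E' ?h" "morphism n E' E ?k"
    by (intro morphism_add morphism_comp[of n _ Y] morphism_comp[of n _ X] r
        biproduct_morphism[OF b] biproduct_morphism[OF b'])+
  have e: "?k i * ?h i = 1\<^sub>m (dimv E i)" "?h i * ?k i = 1\<^sub>m (dimv E' i)" "?h i * f i = f' i" "g' i * ?h i = g i"
    if i: "i \<in> {1..n}" for i
  proof -
    note [simp] = biproduct_dim[OF b i] biproduct_dim[OF b' i]
    have a: "r i * (f i * M) = M" "g i * (f i * M) = 0\<^sub>m (dimv X i) (dim_col M)" "r' i * (f' i * M) = M"
      "g' i * (f' i * M) = 0\<^sub>m (dimv X i) (dim_col M)" if "dim_row M = dimv Y i" for M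
      using that mat_assoc[of "r i" "f i" M] mat_assoc[of "g i" "f i" M]
        mat_assoc[of "r' i" "f' i" M] mat_assoc[of "g' i" "f' i" M]
      by (simp_all add: biproduct_eqs[OF b i] biproduct_eqs[OF b' i] mat_ring)
    have a': "r i * (s i * M) = 0\<^sub>m (dimv Y i) (dim_col M)" "g i * (s i * M) = M"
        "r' i * (s' i * M) = 0\<^sub>m (dimv Y i) (dim_col M)"
      "g' i * (s' i * M) = M" if "dim_row M = dimv X i" for M
      using that mat_assoc[of "r i" "s i" M] mat_assoc[of "g i" "s i" M]
        mat_assoc[of "r' i" "s' i" M] mat_assoc[of "g' i" "s' i" M]
      by (simp_all add: biproduct_eqs[OF b i] biproduct_eqs[OF b' i] mat_ring)
    show "?k i * ?h i = 1\<^sub>m (dimv E i)" "?h i * ?k i = 1\<^sub>m (dimv E' i)" "?h i * f i = f' i" "g' i * ?h i = g i"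
      by (simp_all add: mat_ring a a' biproduct_eqs[OF b i] biproduct_eqs[OF b' i])
  qed
  show ?thesis by (rule that[OF hk e])
qed

lemma biproduct_ext_equiv:
  assumes E: "(E, f, g) \<in> extensions n X Y" and E': "(E', f', g') \<in> extensions n X Y"
    and r: "is_rep n X" "is_rep n Y"
    and b: "biproduct n E Y X f r s g" and b': "biproduct n E' Y X f' r' s' g'"
  shows "((E, f, g), (E', f', g')) \<in> ext_equiv n X Y"
proof -
  have rE: "is_rep n E" "is_rep n E'" using E E' by (auto simp: extensions_def)
  have H: "f \<in> Hom n Y E" "g \<in> Hom n E X" "f' \<in> Hom n Y E'" "g' \<in> Hom n E' X"
    using E E' by (auto simp: extensions_def short_exact_def)
  obtain h k where h: "morphism n E E' h" and k: "morphism n E' E k"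
    and e: "\<And>i. i \<in> {1..n} \<Longrightarrow> k i * h i = 1\<^sub>m (dimv E i)" "\<And>i. i \<in> {1..n} \<Longrightarrow> h i * k i = 1\<^sub>m (dimv E' i)"
      "\<And>i. i \<in> {1..n} \<Longrightarrow> h i * f i = f' i" "\<And>i. i \<in> {1..n} \<Longrightarrow> g' i * h i = g i"
    by (rule biproduct_compare[OF r rE b b']) blast
  have "is_iso n E E' (restrict h {1..n})"
    unfolding is_iso_def using e
    by (intro conjI restrict_in_Hom[OF h] bexI[OF _ restrict_in_Hom[OF k]])
      (auto simp: comp_hom_def id_hom_def fun_eq_iff restrict_def)
  moreover have "comp_hom n (restrict h {1..n}) f = f'" "comp_hom n g' (restrict h {1..n}) = g"
    using e H by (auto simp: comp_hom_def Hom_iff fun_eq_iff restrict_def extensional_def)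
  ultimately show ?thesis using E E' by (auto simp: ext_equiv_def)
qed

text \<open>The arrows are the block matrices with rows \<open>(Y, c)\<close> and
  \<open>(0, X)\<close>: this is the extension of \<open>X\<close> by \<open>Y\<close> with cocycle
  \<open>c\<close>, and it splits in the obvious way for \<open>c = 0\<close>.\<close>

definition twisted_sum :: "'k::field qrep \<Rightarrow> 'k qrep \<Rightarrow> (nat \<Rightarrow> 'k mat) \<Rightarrow> 'k qrep" where
  "twisted_sum Y X c = QRep (\<lambda>i. dimv Y i + dimv X i) (\<lambda>i.
     inL (dimv Y (Suc i)) (dimv X (Suc i)) * (arr Y i * prL (dimv Y i) (dimv X i) + c i * prR (dimv Y i)
         (dimv X i)) +
     inR (dimv Y (Suc i)) (dimv X (Suc i)) * (arr X i * prR (dimv Y i) (dimv X i)))"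

lemma block_cancel:
  fixes M :: "'k::field mat"
  shows "dim_row M = x \<Longrightarrow> prL x z * (inL x z * M) = M" "dim_row M = x \<Longrightarrow>
      prR x z * (inL x z * M) = 0\<^sub>m z (dim_col M)"
    "dim_row M = z \<Longrightarrow> prL x z * (inR x z * M) = 0\<^sub>m x (dim_col M)" "dim_row M = z \<Longrightarrow> prR x z * (inR x z * M) = M"
  using mat_assoc[of "prL x z" "inL x z" M] mat_assoc[of "prR x z" "inL x z" M]
    mat_assoc[of "prL x z" "inR x z" M] mat_assoc[of "prR x z" "inR x z" M]
  by (simp_all add: block_eqs mat_ring)

lemma twisted_sum_extension:
  assumes r: "is_rep n X" "is_rep n Y" and c: "\<And>i. i \<in> {1..<n} \<Longrightarrow> c i \<in> carrier_mat (dimv Y (Suc i)) (dimv X i)"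
  shows "(twisted_sum Y X c, \<lambda>i\<in>{1..n}. inL (dimv Y i) (dimv X i), \<lambda>i\<in>{1..n}. prR (dimv Y i) (dimv X i))
      \<in> extensions n X Y"
proof -
  let ?E = "twisted_sum Y X c"
  have rE: "is_rep n ?E"
    unfolding is_rep_def by (intro ballI carrier_matI) (simp_all add: twisted_sum_def)
  have m: "morphism n Y ?E (\<lambda>i. inL (dimv Y i) (dimv X i))" "morphism n ?E X (\<lambda>i. prR (dimv Y i) (dimv X i))"
  proof (rule_tac [!] morphismI)
    fix i assume i: "i \<in> {1..<n}"
    note [simp] = rep_dim[OF r(1) i] rep_dim[OF r(2) i] carrier_matD[OF c[OF i]]
    show "inL (dimv Y (Suc i)) (dimv X (Suc i)) * arr Y i = arr ?E i * inL (dimv Y i) (dimv X i)"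
      "prR (dimv Y (Suc i)) (dimv X (Suc i)) * arr ?E i = arr X i * prR (dimv Y i) (dimv X i)"
      by (simp_all add: twisted_sum_def mat_ring block_eqs block_cancel)
  qed (simp_all add: twisted_sum_def)
  have "short_exact n Y ?E X (\<lambda>i\<in>{1..n}. inL (dimv Y i) (dimv X i)) (\<lambda>i\<in>{1..n}. prR (dimv Y i) (dimv X i))"
    by (rule biproduct_short_exact[OF r(2) rE r(1) restrict_in_Hom[OF m(1)] restrict_in_Hom[OF m(2)],
          where r = "\<lambda>i. prL (dimv Y i) (dimv X i)" and s = "\<lambda>i. inR (dimv Y i) (dimv X i)"])
      (simp add: block_eqs twisted_sum_def carrier_matI)
  then show ?thesis using rE by (simp add: extensions_def)
qed

text \<open>If every cocycle is a boundary, all extensions split and are thus equivalent to the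
  twisted sum with cocycle \<open>0\<close>. Conversely, an equivalence from that sum to the one
  with cocycle \<open>c\<close> is unitriangular, and its off-diagonal block \<open>?k\<close> has
  boundary \<open>c\<close>.\<close>

lemma Ext_vanishes_iff:
  fixes X Y :: "'k::field qrep"
  assumes r: "is_rep n X" "is_rep n Y"
  shows "Ext_vanishes n X Y \<longleftrightarrow> no_ext n X Y"
proof
  assume ext: "no_ext n X Y"
  let ?E0 = "(twisted_sum Y X (\<lambda>i. 0\<^sub>m (dimv Y (Suc i)) (dimv X i)), \<lambda>i\<in>{1..n}. inL (dimv Y i) (dimv X i)
      :: 'k mat,
    \<lambda>i\<in>{1..n}. prR (dimv Y i) (dimv X i))"
  have 0: "?E0 \<in> extensions n X Y" by (rule twisted_sum_extension[OF r]) auto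
  have "(e, e') \<in> ext_equiv n X Y" if ee: "e \<in> extensions n X Y" "e' \<in> extensions n X Y" for e e'
  proof -
    obtain E f g E' f' g' where e: "e = (E, f, g)" "e' = (E', f', g')" by (metis prod_cases3)
    obtain r' s' where 1: "biproduct n E Y X f r' s' g" using extension_splits[OF r ext] ee(1) e(1) by metis
    obtain r'' s'' where 2: "biproduct n E' Y X f' r'' s'' g'"
        using extension_splits[OF r ext] ee(2) e(2) by metis
    show ?thesis using biproduct_ext_equiv[OF _ _ r 1 2] ee e by simp
  qed
  then have "Ext1 n X Y = {ext_equiv n X Y `` {?E0}}"
    using 0 equiv_class_eq[OF equiv_ext_equiv[of n X Y]] unfolding Ext1_def quotient_def by blast
  then show "Ext_vanishes n X Y" by (simp add: Ext_vanishes_def)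
next
  assume E: "Ext_vanishes n X Y"
  show "no_ext n X Y" unfolding no_ext_def
  proof (intro allI impI)
    fix c :: "nat \<Rightarrow> 'k mat" assume c: "\<forall>i\<in>{1..<n}. c i \<in> carrier_mat (dimv Y (Suc i)) (dimv X i)"
    let ?f = "\<lambda>i\<in>{1..n}. inL (dimv Y i) (dimv X i) :: 'k mat"
        and ?g = "\<lambda>i\<in>{1..n}. prR (dimv Y i) (dimv X i) :: 'k mat"
    let ?z = "\<lambda>i. 0\<^sub>m (dimv Y (Suc i)) (dimv X i) :: 'k mat"
    have e0: "(twisted_sum Y X ?z, ?f, ?g) \<in> extensions n X Y" by (rule twisted_sum_extension[OF r]) auto
    have e1: "(twisted_sum Y X c, ?f, ?g) \<in> extensions n X Y"
        by (rule twisted_sum_extension[OF r]) (use c in auto)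
    have "((twisted_sum Y X ?z, ?f, ?g), (twisted_sum Y X c, ?f, ?g)) \<in> ext_equiv n X Y"
    proof -
      obtain K where K: "extensions n X Y // ext_equiv n X Y = {K}"
        using E by (auto simp: Ext_vanishes_def Ext1_def is_singleton_def)
      have "ext_equiv n X Y `` {(twisted_sum Y X ?z, ?f, ?g)} =
          ext_equiv n X Y `` {(twisted_sum Y X c, ?f, ?g)}"
        using quotientI[OF e0, of "ext_equiv n X Y"] quotientI[OF e1, of "ext_equiv n X Y"] unfolding K by auto
      then show ?thesis by (rule eq_equiv_class[OF _ equiv_ext_equiv e1])
    qed
    then obtain h where "h \<in> Hom n (twisted_sum Y X ?z) (twisted_sum Y X c)" and gh: "comp_hom n ?g h = ?g"
      by (auto simp: ext_equiv_def is_iso_def)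
    then have h: "morphism n (twisted_sum Y X ?z) (twisted_sum Y X c) h" by (simp add: Hom_iff)
    let ?k = "\<lambda>i. prL (dimv Y i) (dimv X i) * (h i * inR (dimv Y i) (dimv X i))"
    have dh: "dim_row (h i) = dimv Y i + dimv X i" "dim_col (h i) = dimv Y i + dimv X i" if "i \<in> {1..n}" for i
      using morphism_dim[OF h that] by (auto simp: twisted_sum_def)
    have "c i = ?k (Suc i) * arr X i - arr Y i * ?k i" if i: "i \<in> {1..<n}" for i
    proof -
      have i': "i \<in> {1..n}" "Suc i \<in> {1..n}" using i by auto
      note [simp] = rep_dim[OF r(1) i] rep_dim[OF r(2) i] carrier_matD[OF c[rule_format, OF i]]
        dh[OF i'(1)] dh[OF i'(2)]
      have "prR (dimv Y i) (dimv X i) * h i = prR (dimv Y i) (dimv X i)"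
        using fun_cong[OF gh, of i] i' by (simp add: comp_hom_def)
      then have ghs: "prR (dimv Y i) (dimv X i) * (h i * inR (dimv Y i) (dimv X i)) = 1\<^sub>m (dimv X i)"
        using mat_assoc[of "prR (dimv Y i) (dimv X i)" "h i" "inR (dimv Y i) (dimv X i)"]
        by (simp add: block_eqs)
      have A: "arr (twisted_sum Y X ?z) i * inR (dimv Y i) (dimv X i) = inR (dimv Y (Suc i))
          (dimv X (Suc i)) * arr X i"
        by (simp add: twisted_sum_def mat_ring block_eqs)
      have dE: "dim_row (arr (twisted_sum Y X ?z) i) = dimv Y (Suc i) + dimv X (Suc i)"
        "dim_col (arr (twisted_sum Y X ?z) i) = dimv Y i + dimv X i"
        by (simp_all add: twisted_sum_def)
      have "?k (Suc i) * arr X i = prL (dimv Y (Suc i)) (dimv X (Suc i)) *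
          ((h (Suc i) * arr (twisted_sum Y X ?z) i) * inR (dimv Y i) (dimv X i))"
        using dE A mat_assoc[of "h (Suc i)" "arr (twisted_sum Y X ?z) i" "inR (dimv Y i) (dimv X i)"]
        by (simp add: mat_assoc)
      also have "\<dots> = prL (dimv Y (Suc i)) (dimv X (Suc i)) * (arr (twisted_sum Y X c)
          i * (h i * inR (dimv Y i) (dimv X i)))"
        unfolding morphism_comm[OF h i] by (subst mat_assoc) (simp_all add: twisted_sum_def)
      also have "\<dots> = arr Y i * ?k i + c i"
        by (simp add: twisted_sum_def mat_ring block_cancel ghs)
      finally show ?thesis by (intro eq_matI) auto
    qed
    moreover have "?k i \<in> carrier_mat (dimv Y i) (dimv X i)" if "i \<in> {1..n}" for i
      by (rule carrier_matI) auto
    ultimately show "\<exists>h. (\<forall>i\<in>{1..n}. h i \<in> carrier_mat (dimv Y i) (dimv X i)) \<and>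
       (\<forall>i\<in>{1..<n}. c i = h (Suc i) * arr X i - arr Y i * h i)"
      by (intro exI[of _ ?k]) blast
  qed
qed

section \<open>Retracts and direct sums\<close>

definition retract :: "nat \<Rightarrow> 'k::field qrep \<Rightarrow> 'k qrep \<Rightarrow> bool" where
  "retract n X W \<longleftrightarrow> (\<exists>s p. morphism n X W s \<and> morphism n W X p \<and> (\<forall>i\<in>{1..n}. p i * s i = 1\<^sub>m (dimv X i)))"

lemma no_homD: "no_hom n X Y \<Longrightarrow> morphism n X Y f \<Longrightarrow> i \<in> {1..n} \<Longrightarrow> f i = 0\<^sub>m (dimv Y i) (dimv X i)"
  by (auto simp: no_hom_def)

lemma no_extE:
  assumes "no_ext n X Y" "\<And>i. i \<in> {1..<n} \<Longrightarrow> dim_row (c i) = dimv Y (Suc i)" "\<And>i. i \<in> {1..<n} \<Longrightarrow>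
      dim_col (c i) = dimv X i"
  obtains h where "\<And>i. i \<in> {1..n} \<Longrightarrow> dim_row (h i) = dimv Y i" "\<And>i. i \<in> {1..n} \<Longrightarrow> dim_col (h i) = dimv X i"
    "\<And>i. i \<in> {1..<n} \<Longrightarrow> c i = h (Suc i) * arr X i - arr Y i * h i"
proof -
  have "\<forall>i\<in>{1..<n}. c i \<in> carrier_mat (dimv Y (Suc i)) (dimv X i)"
    using assms(2,3) by (auto intro: carrier_matI)
  then obtain h where h: "\<forall>i\<in>{1..n}. h i \<in> carrier_mat (dimv Y i) (dimv X i)"
    "\<forall>i\<in>{1..<n}. c i = h (Suc i) * arr X i - arr Y i * h i"
    using assms(1) unfolding no_ext_def by blast
  show ?thesis by (rule that[of h]) (use h in auto)
qed

lemma no_extI: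
  assumes "\<And>c. (\<And>i. i \<in> {1..<n} \<Longrightarrow> dim_row (c i) = dimv Y (Suc i)) \<Longrightarrow> (\<And>i. i \<in> {1..<n} \<Longrightarrow>
      dim_col (c i) = dimv X i) \<Longrightarrow>
    \<exists>h. (\<forall>i\<in>{1..n}. dim_row (h i) = dimv Y i \<and> dim_col (h i) = dimv X i) \<and>
      (\<forall>i\<in>{1..<n}. c i = h (Suc i) * arr X i - arr Y i * h i)"
  shows "no_ext n X Y"
  unfolding no_ext_def
proof (intro allI impI)
  fix c :: "nat \<Rightarrow> 'a mat" assume c: "\<forall>i\<in>{1..<n}. c i \<in> carrier_mat (dimv Y (Suc i)) (dimv X i)"
  obtain h where h: "\<forall>i\<in>{1..n}. dim_row (h i) = dimv Y i \<and> dim_col (h i) = dimv X i"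
      "\<forall>i\<in>{1..<n}. c i = h (Suc i) * arr X i - arr Y i * h i"
    using assms[of c] c by fastforce
  then show "\<exists>h. (\<forall>i\<in>{1..n}. h i \<in> carrier_mat (dimv Y i) (dimv X i)) \<and>
      (\<forall>i\<in>{1..<n}. c i = h (Suc i) * arr X i - arr Y i * h i)"
    by (intro exI[of _ h]) (auto intro: carrier_matI)
qed

lemma retract_no_hom:
  assumes r: "is_rep n X" "is_rep n W" "is_rep n Y" and "retract n X W" "no_hom n W Y"
  shows "no_hom n X Y"
proof -
  obtain s p where s: "morphism n X W s" and p: "morphism n W X p"
    and ps: "\<And>i. i \<in> {1..n} \<Longrightarrow> p i * s i = 1\<^sub>m (dimv X i)"
    using assms(4) by (auto simp: retract_def)
  show ?thesis unfolding no_hom_def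
  proof (intro allI impI ballI)
    fix f i assume f: "morphism n X Y f" and i: "i \<in> {1..n}"
    note [simp] = morphism_dim[OF s i] morphism_dim[OF p i] morphism_dim[OF f i]
    have "(f i * p i) * s i = 0\<^sub>m (dimv Y i) (dimv X i)"
      using no_homD[OF assms(5) morphism_comp[OF r(2,1,3) p f] i] by (simp add: mat_ring)
    then show "f i = 0\<^sub>m (dimv Y i) (dimv X i)" by (simp add: mat_ring ps[OF i])
  qed
qed

text \<open>A family on \<open>X\<close> is pulled back to \<open>W\<close> along \<open>p\<close>,
  and a solution found there is restricted to \<open>X\<close> along \<open>s\<close>.\<close>

lemma retract_no_ext:
  assumes r: "is_rep n X" "is_rep n W" "is_rep n Y" and "retract n X W" "no_ext n W Y"
  shows "no_ext n X Y"
proof -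
  obtain s p where s: "morphism n X W s" and p: "morphism n W X p"
    and ps: "\<And>i. i \<in> {1..n} \<Longrightarrow> p i * s i = 1\<^sub>m (dimv X i)"
    using assms(4) by (auto simp: retract_def)
  show ?thesis
  proof (rule no_extI)
    fix c :: "nat \<Rightarrow> 'a mat"
    assume c: "\<And>i. i \<in> {1..<n} \<Longrightarrow> dim_row (c i) = dimv Y (Suc i)" "\<And>i. i \<in> {1..<n} \<Longrightarrow> dim_col (c i) = dimv X i"
    obtain h where h: "\<And>i. i \<in> {1..n} \<Longrightarrow> dim_row (h i) = dimv Y i" "\<And>i. i \<in> {1..n} \<Longrightarrow> dim_col (h i) = dimv W i"
      "\<And>i. i \<in> {1..<n} \<Longrightarrow> c i * p i = h (Suc i) * arr W i - arr Y i * h i"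
      by (rule no_extE[OF assms(5), of "\<lambda>i. c i * p i"]) (use c morphism_dim[OF p] in auto)
    have "c i = h (Suc i) * s (Suc i) * arr X i - arr Y i * (h i * s i)" if i: "i \<in> {1..<n}" for i
    proof -
      have i': "i \<in> {1..n}" "Suc i \<in> {1..n}" using i by auto
      note [simp] = h(1)[OF i'(1)] h(1)[OF i'(2)] h(2)[OF i'(1)] h(2)[OF i'(2)] c(1)[OF i] c(2)[OF i]
        rep_dim[OF r(1) i] rep_dim[OF r(2) i] rep_dim[OF r(3)
            i] morphism_dim_Suc[OF s i] morphism_dim_Suc[OF p i]
      have "c i = (c i * p i) * s i" by (simp add: mat_ring ps[OF i'(1)])
      also have "\<dots> = h (Suc i) * (arr W i * s i) - arr Y i * (h i * s i)"
        unfolding h(3)[OF i] by (simp add: mat_ring)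
      finally show ?thesis unfolding morphism_comm[OF s i, symmetric] by (simp add: mat_ring)
    qed
    then show "\<exists>h. (\<forall>i\<in>{1..n}. dim_row (h i) = dimv Y i \<and> dim_col (h i) = dimv X i) \<and>
      (\<forall>i\<in>{1..<n}. c i = h (Suc i) * arr X i - arr Y i * h i)"
      using h morphism_dim[OF s] by (intro exI[of _ "\<lambda>i. h i * s i"]) auto
  qed
qed

lemma biproduct_retract: "biproduct n W X Z s p t q \<Longrightarrow> retract n X W \<and> retract n Z W"
  unfolding biproduct_def retract_def by blast

lemma biproduct_no_hom:
  assumes r: "is_rep n X" "is_rep n Z" "is_rep n W" "is_rep n Y" and b: "biproduct n W X Z s p t q"
  shows "no_hom n W Y \<longleftrightarrow> no_hom n X Y \<and> no_hom n Z Y"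
proof
  assume XZ: "no_hom n X Y \<and> no_hom n Z Y"
  show "no_hom n W Y" unfolding no_hom_def
  proof (intro allI impI ballI)
    fix f i assume f: "morphism n W Y f" and i: "i \<in> {1..n}"
    note [simp] = biproduct_dim[OF b i] morphism_dim[OF f i]
    note m = biproduct_morphism[OF b]
    have "f i = f i * (s i * p i + t i * q i)" by (simp add: biproduct_eqs[OF b i] mat_ring)
    also have "\<dots> = (f i * s i) * p i + (f i * t i) * q i" by (simp add: mat_ring)
    also have "\<dots> = 0\<^sub>m (dimv Y i) (dimv W i)"
      using no_homD[OF _ morphism_comp[OF r(1,3,4) m(1) f] i] no_homD[OF _ morphism_comp[OF r(2,3,4) m(3)
          f] i] XZ
      by (simp add: mat_ring)
    finally show "f i = 0\<^sub>m (dimv Y i) (dimv W i)" .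
  qed
qed (use retract_no_hom r biproduct_retract[OF b] in blast)

lemma biproduct_no_ext:
  assumes r: "is_rep n X" "is_rep n Z" "is_rep n W" "is_rep n Y" and b: "biproduct n W X Z s p t q"
  shows "no_ext n W Y \<longleftrightarrow> no_ext n X Y \<and> no_ext n Z Y"
proof
  assume XZ: "no_ext n X Y \<and> no_ext n Z Y"
  note m = biproduct_morphism[OF b]
  show "no_ext n W Y"
  proof (rule no_extI)
    fix c :: "nat \<Rightarrow> 'a mat"
    assume c: "\<And>i. i \<in> {1..<n} \<Longrightarrow> dim_row (c i) = dimv Y (Suc i)" "\<And>i. i \<in> {1..<n} \<Longrightarrow> dim_col (c i) = dimv W i"
    obtain h where h: "\<And>i. i \<in> {1..n} \<Longrightarrow> dim_row (h i) = dimv Y i" "\<And>i. i \<in> {1..n} \<Longrightarrow> dim_col (h i) = dimv X i"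
      "\<And>i. i \<in> {1..<n} \<Longrightarrow> c i * s i = h (Suc i) * arr X i - arr Y i * h i"
      by (rule no_extE[of n X Y "\<lambda>i. c i * s i"]) (use XZ c biproduct_dim[OF b] in auto)
    obtain k where k: "\<And>i. i \<in> {1..n} \<Longrightarrow> dim_row (k i) = dimv Y i" "\<And>i. i \<in> {1..n} \<Longrightarrow> dim_col (k i) = dimv Z i"
      "\<And>i. i \<in> {1..<n} \<Longrightarrow> c i * t i = k (Suc i) * arr Z i - arr Y i * k i"
      by (rule no_extE[of n Z Y "\<lambda>i. c i * t i"]) (use XZ c biproduct_dim[OF b] in auto)
    have "c i = (h (Suc i) * p (Suc i) + k (Suc i) * q (Suc i)) * arr W i - arr Y i * (h i * p i + k i * q i)"
      if i: "i \<in> {1..<n}" for i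
    proof -
      have i': "i \<in> {1..n}" "Suc i \<in> {1..n}" using i by auto
      note [simp] = h(1)[OF i'(1)] h(1)[OF i'(2)] h(2)[OF i'(1)] h(2)[OF i'(2)]
        k(1)[OF i'(1)] k(1)[OF i'(2)] k(2)[OF i'(1)] k(2)[OF i'(2)] c(1)[OF i] c(2)[OF i]
        rep_dim[OF r(1) i] rep_dim[OF r(2) i] rep_dim[OF r(3) i] rep_dim[OF r(4) i]
        biproduct_dim[OF b i'(1)] biproduct_dim[OF b i'(2)]
      have "c i = c i * (s i * p i + t i * q i)" by (simp add: biproduct_eqs[OF b i'(1)] mat_ring)
      also have "\<dots> = (c i * s i) * p i + (c i * t i) * q i" by (simp add: mat_ring)
      also have "\<dots> = (h (Suc i) * (arr X i * p i) - arr Y i * (h i * p i)) + (k (Suc i) * (arr Z i * q i)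
          - arr Y i * (k i * q i))"
        unfolding h(3)[OF i] k(3)[OF i] by (simp add: mat_ring)
      also have "\<dots> = (h (Suc i) * (arr X i * p i) + k (Suc i) * (arr Z i * q i)) - (arr Y i * (h i * p i)
          + arr Y i * (k i * q i))"
        by (intro eq_matI) auto
      finally show ?thesis
        unfolding morphism_comm[OF m(2) i, symmetric] morphism_comm[OF m(4)
            i, symmetric] by (simp add: mat_ring)
    qed
    then show "\<exists>h. (\<forall>i\<in>{1..n}. dim_row (h i) = dimv Y i \<and> dim_col (h i) = dimv W i) \<and>
      (\<forall>i\<in>{1..<n}. c i = h (Suc i) * arr W i - arr Y i * h i)"
      using h k biproduct_dim[OF b] by (intro exI[of _ "\<lambda>i. h i * p i + k i * q i"]) auto
  qed
qed (use retract_no_ext r biproduct_retract[OF b] in blast)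

lemma is_rep_direct_sum: "(\<And>X. X \<in> set Xs \<Longrightarrow> is_rep n X) \<Longrightarrow> is_rep n (direct_sum Xs)"
proof (induction Xs)
  case Nil
  then show ?case by (simp add: is_rep_def direct_sum_def)
next
  case (Cons X Xs)
  have "is_rep n X" "is_rep n (direct_sum Xs)" using Cons by auto
  then show ?case
    by (auto simp: is_rep_def direct_sum_def Let_def intro!: four_block_carrier_mat)
qed

lemma biproduct_direct_sum:
  assumes r: "is_rep n X" "\<And>X. X \<in> set Xs \<Longrightarrow> is_rep n X"
  shows "biproduct n (direct_sum (X # Xs)) X (direct_sum Xs)
    (\<lambda>i. inL (dimv X i) (dimv (direct_sum Xs) i)) (\<lambda>i. prL (dimv X i) (dimv (direct_sum Xs) i))
    (\<lambda>i. inR (dimv X i) (dimv (direct_sum Xs) i)) (\<lambda>i. prR (dimv X i) (dimv (direct_sum Xs) i))"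
proof -
  let ?W = "direct_sum (X # Xs)" and ?Z = "direct_sum Xs"
  have rZ: "is_rep n ?Z" by (rule is_rep_direct_sum[OF r(2)])
  have dW: "dimv ?W i = dimv X i + dimv ?Z i" for i by (simp add: direct_sum_def)
  have aW: "arr ?W i = inL (dimv X (Suc i)) (dimv ?Z (Suc i)) * (arr X i * prL (dimv X i) (dimv ?Z i)) +
      inR (dimv X (Suc i)) (dimv ?Z (Suc i)) * (arr ?Z i * prR (dimv X i) (dimv ?Z i))" if i: "i \<in> {1..<n}"
          for i
  proof -
    have "arr ?W i = four_block_mat (arr X i) (0\<^sub>m (dimv X (Suc i)) (dimv ?Z i)) (0\<^sub>m (dimv ?Z (Suc i))
        (dimv X i)) (arr ?Z i)"
      using rep_dim[OF r(1) i] rep_dim[OF rZ i] by (simp add: direct_sum_def Let_def)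
    then show ?thesis
      by (subst four_block_diag[symmetric]) (use rep_dim[OF r(1)
          i] rep_dim[OF rZ i] in \<open>auto intro: carrier_matI\<close>)
  qed
  have comm: "inL (dimv X (Suc i)) (dimv ?Z (Suc i)) * arr X i = arr ?W i * inL (dimv X i) (dimv ?Z i)"
    "prL (dimv X (Suc i)) (dimv ?Z (Suc i)) * arr ?W i = arr X i * prL (dimv X i) (dimv ?Z i)"
    "inR (dimv X (Suc i)) (dimv ?Z (Suc i)) * arr ?Z i = arr ?W i * inR (dimv X i) (dimv ?Z i)"
    "prR (dimv X (Suc i)) (dimv ?Z (Suc i)) * arr ?W i = arr ?Z i * prR (dimv X i) (dimv ?Z i)"
    if i: "i \<in> {1..<n}" for i
  proof -
    note [simp] = rep_dim[OF r(1) i] rep_dim[OF rZ i]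
    show "inL (dimv X (Suc i)) (dimv ?Z (Suc i)) * arr X i = arr ?W i * inL (dimv X i) (dimv ?Z i)"
      "prL (dimv X (Suc i)) (dimv ?Z (Suc i)) * arr ?W i = arr X i * prL (dimv X i) (dimv ?Z i)"
      "inR (dimv X (Suc i)) (dimv ?Z (Suc i)) * arr ?Z i = arr ?W i * inR (dimv X i) (dimv ?Z i)"
      "prR (dimv X (Suc i)) (dimv ?Z (Suc i)) * arr ?W i = arr ?Z i * prR (dimv X i) (dimv ?Z i)"
      unfolding aW[OF i] by (simp_all add: mat_ring block_eqs block_cancel)
  qed
  show ?thesis
    unfolding biproduct_def
    by (intro conjI ballI morphismI comm) (simp_all add: dW block_eqs)
qed

lemma vanish_direct_sum:
  assumes r: "\<And>X. X \<in> set Xs \<Longrightarrow> is_rep n X" "is_rep n Y"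
  shows "no_hom n (direct_sum Xs) Y \<longleftrightarrow> (\<forall>X\<in>set Xs. no_hom n X Y)"
    and "no_ext n (direct_sum Xs) Y \<longleftrightarrow> (\<forall>X\<in>set Xs. no_ext n X Y)"
proof -
  have "(no_hom n (direct_sum Xs) Y \<longleftrightarrow> (\<forall>X\<in>set Xs. no_hom n X Y)) \<and>
    (no_ext n (direct_sum Xs) Y \<longleftrightarrow> (\<forall>X\<in>set Xs. no_ext n X Y))"
    using r(1)
  proof (induction Xs)
    case Nil
    have d: "dimv (direct_sum []) i = 0" "arr (direct_sum []) i = 0\<^sub>m 0 0" for i
      by (simp_all add: direct_sum_def)
    have "no_hom n (direct_sum []) Y"
      unfolding no_hom_def by (intro allI impI ballI mat_no_cols) (auto simp: d dest: morphism_dim)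
    moreover have "no_ext n (direct_sum []) Y"
      using rep_dim[OF r(2)] by (intro no_extI exI[of _ "\<lambda>i. 0\<^sub>m (dimv Y i) 0"] conjI ballI mat_no_cols)
          (auto simp: d)
    ultimately show ?case by simp
  next
    case (Cons X Xs)
    have rX: "is_rep n X" "is_rep n (direct_sum Xs)" "is_rep n (direct_sum (X # Xs))"
      using Cons.prems by (auto intro!: is_rep_direct_sum)
    have b: "\<exists>s p t q. biproduct n (direct_sum (X # Xs)) X (direct_sum Xs) s p t q"
      using biproduct_direct_sum[OF rX(1), of Xs] Cons.prems by auto
    then show ?case
      using biproduct_no_hom[OF rX r(2)] biproduct_no_ext[OF rX r(2)] Cons by auto
  qed
  then show "no_hom n (direct_sum Xs) Y \<longleftrightarrow> (\<forall>X\<in>set Xs. no_hom n X Y)"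
    and "no_ext n (direct_sum Xs) Y \<longleftrightarrow> (\<forall>X\<in>set Xs. no_ext n X Y)" by auto
qed

lemma isomorphicE:
  assumes "isomorphic n X Y"
  obtains f g where "is_rep n X" "is_rep n Y" "morphism n X Y f" "morphism n Y X g"
    "\<And>i. i \<in> {1..n} \<Longrightarrow> g i * f i = 1\<^sub>m (dimv X i)" "\<And>i. i \<in> {1..n} \<Longrightarrow> f i * g i = 1\<^sub>m (dimv Y i)"
proof -
  obtain f g where "is_rep n X" "is_rep n Y" and H: "f \<in> Hom n X Y" "g \<in> Hom n Y X"
    and e: "comp_hom n g f = id_hom n X" "comp_hom n f g = id_hom n Y"
    using assms by (auto simp: isomorphic_def is_iso_def)
  moreover have "g i * f i = 1\<^sub>m (dimv X i)" "f i * g i = 1\<^sub>m (dimv Y i)" if "i \<in> {1..n}" for i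
    using fun_cong[OF e(1), of i] fun_cong[OF e(2), of i] that by (simp_all add: comp_hom_def id_hom_def)
  ultimately show ?thesis using that unfolding Hom_iff by blast
qed

lemma isomorphicI:
  assumes "is_rep n X" "is_rep n Y" "morphism n X Y f" "morphism n Y X g"
    "\<And>i. i \<in> {1..n} \<Longrightarrow> g i * f i = 1\<^sub>m (dimv X i)" "\<And>i. i \<in> {1..n} \<Longrightarrow> f i * g i = 1\<^sub>m (dimv Y i)"
  shows "isomorphic n X Y"
proof -
  have "is_iso n X Y (restrict f {1..n})"
    unfolding is_iso_def using assms(5,6)
    by (intro conjI restrict_in_Hom[OF assms(3)] bexI[OF _ restrict_in_Hom[OF assms(4)]])
      (auto simp: comp_hom_def id_hom_def fun_eq_iff restrict_def)
  then show ?thesis using assms(1,2) by (auto simp: isomorphic_def)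
qed

lemma isomorphic_retract: "isomorphic n X Y \<Longrightarrow> retract n X Y \<and> retract n Y X"
  unfolding retract_def by (elim isomorphicE) blast

lemma isomorphic_no_hom: "isomorphic n X X' \<Longrightarrow> is_rep n Y \<Longrightarrow> no_hom n X Y \<longleftrightarrow> no_hom n X' Y"
  and isomorphic_no_ext: "isomorphic n X X' \<Longrightarrow> is_rep n Y \<Longrightarrow> no_ext n X Y \<longleftrightarrow> no_ext n X' Y"
  using isomorphic_retract[of n X X'] retract_no_hom retract_no_ext unfolding isomorphic_def by blast+

section \<open>Interval modules\<close>

text \<open>Representations are continued by \<open>0\<close> at the vertex \<open>n + 1\<close>; a vertex \<open>n + 1\<close> makes the
  projective modules behave like all other interval modules.\<close>

definition xdim :: "nat \<Rightarrow> 'k::field qrep \<Rightarrow> nat \<Rightarrow> nat" where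
  "xdim n Y i = (if i \<le> n then dimv Y i else 0)"

definition xarr :: "nat \<Rightarrow> 'k::field qrep \<Rightarrow> nat \<Rightarrow> 'k mat" where
  "xarr n Y i = (if i < n then arr Y i else 0\<^sub>m (xdim n Y (Suc i)) (xdim n Y i))"

text \<open>The composite of the arrows from \<open>a\<close> to \<open>b\<close>. Since the
  recursion runs over the end point, the start \<open>a = Suc b\<close> is met in the else branch of
  the second clause.\<close>

primrec path :: "nat \<Rightarrow> 'k::field qrep \<Rightarrow> nat \<Rightarrow> nat \<Rightarrow> 'k mat" where
  "path n Y a 0 = 1\<^sub>m (xdim n Y a)"
| "path n Y a (Suc b) = (if a \<le> b then xarr n Y b * path n Y a b else 1\<^sub>m (xdim n Y a))"

text \<open>Elements are matrices with one column, so that \<open>mat_ring\<close> applies to them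
  as well.\<close>

definition path_inj :: "nat \<Rightarrow> 'k::field qrep \<Rightarrow> nat \<Rightarrow> nat \<Rightarrow> bool" where
  "path_inj n Y a b \<longleftrightarrow> (\<forall>x\<in>carrier_mat (xdim n Y a) 1.
     path n Y a b * x = 0\<^sub>m (xdim n Y b) 1 \<longrightarrow> x = 0\<^sub>m (xdim n Y a) 1)"

definition path_surj :: "nat \<Rightarrow> 'k::field qrep \<Rightarrow> nat \<Rightarrow> nat \<Rightarrow> bool" where
  "path_surj n Y a b \<longleftrightarrow> (\<forall>y\<in>carrier_mat (xdim n Y b) 1. \<exists>x\<in>carrier_mat (xdim n Y a) 1. path n Y a b * x = y)"

text \<open>Between two vertices of the support the constant matrix is the identity of size
  \<open>1\<close>; every other arrow is a matrix with no rows or no columns.\<close>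

definition interval :: "nat \<Rightarrow> nat \<Rightarrow> 'k::field qrep" where
  "interval a b = QRep (\<lambda>i. if a \<le> i \<and> i < b then 1 else 0)
     (\<lambda>i. mat (if a \<le> Suc i \<and> Suc i < b then 1 else 0) (if a \<le> i \<and> i < b then 1 else 0) (\<lambda>_. 1))"

lemma xdim_eq [simp]: "i \<le> n \<Longrightarrow> xdim n Y i = dimv Y i" "n < i \<Longrightarrow> xdim n Y i = 0"
  by (simp_all add: xdim_def)

lemma xarr_eq: "i < n \<Longrightarrow> xarr n Y i = arr Y i"
  by (simp add: xarr_def)

lemma xarr_dim: "is_rep n Y \<Longrightarrow> 1 \<le> i \<Longrightarrow> dim_row (xarr n Y i) = xdim n Y (Suc i) \<and>
    dim_col (xarr n Y i) = xdim n Y i"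
  using rep_dim[of n Y i] by (auto simp: xarr_def)

lemma path_refl [simp]: "path n Y a a = 1\<^sub>m (xdim n Y a)"
  by (cases a) simp_all

lemma path_Suc: "a \<le> b \<Longrightarrow> path n Y a (Suc b) = xarr n Y b * path n Y a b"
  by simp

declare path.simps(2) [simp del]

lemma path_dim:
  assumes "is_rep n Y" "1 \<le> a" "a \<le> b"
  shows "dim_row (path n Y a b) = xdim n Y b" "dim_col (path n Y a b) = xdim n Y a"
  using assms(3) by (induction b rule: dec_induct) (use assms(1,2) in \<open>simp_all add: path_Suc xarr_dim\<close>)

lemma path_comp:
  assumes r: "is_rep n Y" and a: "1 \<le> a" "a \<le> b" and "b \<le> c"
  shows "path n Y b c * path n Y a b = path n Y a c"
  using assms(4)
proof (induction c rule: dec_induct)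
  case base
  then show ?case using a r by (simp add: mat_ring path_dim)
next
  case (step c)
  then show ?case
    using a xarr_dim[OF r, of c] path_dim[OF r, of b c] path_dim[OF r, of a b]
    by (simp add: path_Suc mat_assoc)
qed

definition xmap :: "nat \<Rightarrow> (nat \<Rightarrow> 'k::field mat) \<Rightarrow> nat \<Rightarrow> 'k mat" where
  "xmap n f i = (if i \<le> n then f i else 0\<^sub>m 0 0)"

lemma xmap_eq [simp]: "i \<le> n \<Longrightarrow> xmap n f i = f i"
  by (simp add: xmap_def)

lemma xmap_dim:
  "morphism n X Y f \<Longrightarrow> 1 \<le> i \<Longrightarrow> dim_row (xmap n f i) = xdim n Y i \<and> dim_col (xmap n f i) = xdim n X i"
  using morphism_dim[of n X Y f i] by (auto simp: xmap_def)

lemma xmap_mult_one: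
  assumes "\<And>i. i \<in> {1..n} \<Longrightarrow> f i * g i = 1\<^sub>m (dimv X i)" "1 \<le> i"
  shows "xmap n f i * xmap n g i = 1\<^sub>m (xdim n X i)"
  using assms by (cases "i \<le> n") (auto simp: xmap_def)

lemma path_natural:
  assumes r: "is_rep n X" "is_rep n Y" and f: "morphism n X Y f" and ab: "1 \<le> a" "a \<le> b" "b \<le> Suc n"
  shows "xmap n f b * path n X a b = path n Y a b * xmap n f a"
  using ab(2,3)
proof (induction b rule: dec_induct)
  case base
  then show ?case using ab xmap_dim[OF f, of a] by (simp add: mat_ring)
next
  case (step c)
  note [simp] = xmap_dim[OF f ab(1)] path_dim[OF r(1) ab(1) step(1)] path_dim[OF r(2) ab(1) step(1)]
  show ?case
  proof (cases "c < n")
    case True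
    then have c: "c \<in> {1..<n}" using step ab by auto
    note [simp] = rep_dim[OF r(1) c] rep_dim[OF r(2) c] morphism_dim_Suc[OF f c]
    have "f (Suc c) * path n X a (Suc c) = (f (Suc c) * arr X c) * path n X a c"
      using c step by (simp add: path_Suc xarr_eq mat_assoc)
    also have "\<dots> = arr Y c * (f c * path n X a c)" unfolding morphism_comm[OF f c] using c by (simp add:
        mat_assoc)
    also have "\<dots> = path n Y a (Suc c) * xmap n f a"
      using step c ab morphism_dim[OF f, of a] by (simp add: path_Suc xarr_eq mat_assoc)
    finally show ?thesis using c by simp
  next
    case False
    then show ?thesis
      using step xarr_dim[OF r(1), of c] xarr_dim[OF r(2), of c] ab morphism_dim[OF f, of a]
      by (intro mat_no_rows) (auto simp: path_Suc xmap_def)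
  qed
qed

lemma interval_sel [simp]:
  "dimv (interval a b) i = (if a \<le> i \<and> i < b then 1 else 0)"
  "dim_row (arr (interval a b) i) = (if a \<le> Suc i \<and> Suc i < b then 1 else 0)"
  "dim_col (arr (interval a b) i) = (if a \<le> i \<and> i < b then 1 else 0)"
  by (simp_all add: interval_def)

lemma interval_arr: "a \<le> i \<Longrightarrow> Suc i < b \<Longrightarrow> arr (interval a b) i = 1\<^sub>m 1"
  by (intro eq_matI) (auto simp: interval_def)

lemma is_rep_interval: "is_rep n (interval a b)"
  unfolding is_rep_def by (intro ballI carrier_matI) auto

section \<open>Morphisms and extensions from an interval module\<close>

definition from_interval :: "nat \<Rightarrow> 'k::field qrep \<Rightarrow> nat \<Rightarrow> nat \<Rightarrow> 'k mat \<Rightarrow> nat \<Rightarrow> 'k mat" where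
  "from_interval n Y a b x i = (if a \<le> i \<and> i < b then path n Y a i * x else 0\<^sub>m (dimv Y i) 0)"

lemma morphism_from_interval:
  assumes r: "is_rep n Y" and ab: "1 \<le> a" "a < b" "b \<le> Suc n"
    and x: "x \<in> carrier_mat (xdim n Y a) 1" "path n Y a b * x = 0\<^sub>m (xdim n Y b) 1"
  shows "morphism n (interval a b) Y (from_interval n Y a b x)"
proof (rule morphismI)
  fix i assume i: "i \<in> {1..n}"
  show "dim_row (from_interval n Y a b x i) = dimv Y i" "dim_col (from_interval n Y a b x i)
      = dimv (interval a b) i"
    using i x(1) path_dim[OF r ab(1), of i] by (auto simp: from_interval_def)
next
  fix i assume i: "i \<in> {1..<n}"
  note rd = rep_dim[OF r i]
  consider "a \<le> i" "Suc i < b" | "a \<le> i" "Suc i = b" | "\<not> (a \<le> i \<and> i < b)" by linarith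
  then show "from_interval n Y a b x (Suc i) * arr (interval a b) i = arr Y i * from_interval n Y a b x i"
  proof cases
    case 1
    have d: "dim_row (path n Y a i) = dimv Y i" "dim_col (path n Y a i) = xdim n Y a"
      using path_dim[OF r ab(1) 1(1)] i by auto
    show ?thesis
      using 1 i x(1) rd d by (simp add: from_interval_def interval_arr path_Suc xarr_eq mat_ring)
  next
    case 2
    have d: "dim_row (path n Y a i) = dimv Y i" "dim_col (path n Y a i) = xdim n Y a"
      using path_dim[OF r ab(1) 2(1)] i by auto
    have "arr Y i * (path n Y a i * x) = path n Y a b * x"
      using 2 i x(1) rd d by (auto simp: path_Suc xarr_eq mat_assoc)
    then have "arr Y i * from_interval n Y a b x i = 0\<^sub>m (dimv Y b) 1"
      using 2 i x(2) by (auto simp: from_interval_def)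
    moreover have "from_interval n Y a b x (Suc i) * arr (interval a b) i = 0\<^sub>m (dimv Y b) 1"
      using 2 by (intro eq_matI) (auto simp: from_interval_def scalar_prod_def)
    ultimately show ?thesis by simp
  next
    case 3
    then show ?thesis by (intro mat_no_cols) (use rd i in \<open>auto simp: from_interval_def path_dim[OF r ab(1)]\<close>)
  qed
qed

lemma from_interval_start: "a < b \<Longrightarrow> a \<le> n \<Longrightarrow> x \<in> carrier_mat (xdim n Y a) 1 \<Longrightarrow> from_interval n Y a b x a = x"
  by (simp add: from_interval_def)

lemma morphism_from_interval_eq:
  assumes r: "is_rep n Y" and ab: "1 \<le> a" "a < b" "b \<le> Suc n" and f: "morphism n (interval a b) Y f"
  shows "\<And>i. a \<le> i \<Longrightarrow> i < b \<Longrightarrow> f i = path n Y a i * f a"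
    and "f a \<in> carrier_mat (xdim n Y a) 1" "path n Y a b * f a = 0\<^sub>m (xdim n Y b) 1"
proof -
  show fa: "f a \<in> carrier_mat (xdim n Y a) 1"
    using morphism_dim[OF f, of a] ab by (intro carrier_matI) auto
  show eq: "f i = path n Y a i * f a" if "a \<le> i" "i < b" for i
    using that
  proof (induction i rule: dec_induct)
    case base
    then show ?case using fa by (simp add: mat_ring)
  next
    case (step i)
    then have i: "i \<in> {1..<n}" using ab by auto
    have "f (Suc i) = f (Suc i) * arr (interval a b) i"
      using step morphism_dim_Suc[OF f i] by (simp add: interval_arr mat_ring)
    also have "\<dots> = arr Y i * (path n Y a i * f a)" unfolding morphism_comm[OF f i] using step by simp
    also have "\<dots> = path n Y a (Suc i) * f a"
      using step i rep_dim[OF r i] path_dim[OF r ab(1), of i] fa by (simp add: path_Suc xarr_eq mat_assoc)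
    finally show ?case .
  qed
  show "path n Y a b * f a = 0\<^sub>m (xdim n Y b) 1"
  proof (cases "b \<le> n")
    case True
    define c where "c = b - 1"
    have c: "c \<in> {1..<n}" "b = Suc c" "a \<le> c" using ab True by (auto simp: c_def)
    have "path n Y a b * f a = arr Y c * f c"
      using c rep_dim[OF r c(1)] path_dim[OF r ab(1), of c] fa eq[of c] by (simp add: path_Suc xarr_eq
          mat_assoc)
    also have "\<dots> = f b * arr (interval a b) c" using morphism_comm[OF f c(1)] c by simp
    also have "\<dots> = 0\<^sub>m (dimv Y b) 1"
      using c morphism_dim_Suc[OF f c(1)] by (intro eq_matI) (auto simp: scalar_prod_def)
    finally show ?thesis using True by simp
  next
    case False
    then show ?thesis using path_dim[OF r ab(1), of b] ab fa by (intro mat_no_rows) auto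
  qed
qed

text \<open>The module is generated by one element at \<open>a\<close>, subject to the single
  relation that its image at \<open>b\<close> is zero. Hence morphisms to \<open>Y\<close>
  correspond to the kernel of the path from \<open>Y a\<close> to \<open>Y b\<close>; for
  \<open>b = n + 1\<close> the relation is empty.\<close>

lemma no_hom_interval:
  assumes r: "is_rep n Y" and ab: "1 \<le> a" "a < b" "b \<le> Suc n"
  shows "no_hom n (interval a b) Y \<longleftrightarrow> path_inj n Y a b"
proof
  assume H: "no_hom n (interval a b) Y"
  show "path_inj n Y a b" unfolding path_inj_def
  proof (intro ballI impI)
    fix x assume x: "x \<in> carrier_mat (xdim n Y a) 1" "path n Y a b * x = 0\<^sub>m (xdim n Y b) 1"
    have "from_interval n Y a b x a = 0\<^sub>m (dimv Y a) (dimv (interval a b :: 'a qrep) a)"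
      by (rule no_homD[OF H morphism_from_interval[OF r ab x]]) (use ab in auto)
    then show "x = 0\<^sub>m (xdim n Y a) 1"
      using from_interval_start[of a b n x Y] x ab by simp
  qed
next
  assume P: "path_inj n Y a b"
  show "no_hom n (interval a b) Y" unfolding no_hom_def
  proof (intro allI impI ballI)
    fix f i assume f: "morphism n (interval a b) Y f" and i: "i \<in> {1..n}"
    note e = morphism_from_interval_eq[OF r ab f]
    have fa: "f a = 0\<^sub>m (xdim n Y a) 1" using P e(2,3) by (auto simp: path_inj_def)
    show "f i = 0\<^sub>m (dimv Y i) (dimv (interval a b :: 'a qrep) i)"
    proof (cases "a \<le> i \<and> i < b")
      case True
      then show ?thesis using e(1)[of i] i path_dim[OF r ab(1), of i] unfolding fa by (simp add: mat_ring)
    next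
      case False
      then show ?thesis using morphism_dim[OF f i] by (intro mat_no_cols) auto
    qed
  qed
qed

text \<open>The group is the cokernel of the path from \<open>Y a\<close> to \<open>Y b\<close>. In
  terms of cocycles: inside the support \<open>h\<close> is determined by its value at
  \<open>a\<close>, and the only obstruction comes from the arrow that leaves the support and has
  its values in \<open>Y b\<close>.\<close>

lemma no_ext_interval:
  assumes r: "is_rep n Y" and ab: "1 \<le> a" "a < b" "b \<le> Suc n"
  shows "no_ext n (interval a b) Y \<longleftrightarrow> path_surj n Y a b"
proof
  assume E: "no_ext n (interval a b) Y"
  show "path_surj n Y a b" unfolding path_surj_def
  proof
    fix y :: "'a mat" assume y: "y \<in> carrier_mat (xdim n Y b) 1"
    show "\<exists>x\<in>carrier_mat (xdim n Y a) 1. path n Y a b * x = y"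
    proof (cases "b \<le> n")
      case False
      then show ?thesis using y path_dim[OF r ab(1), of b] ab
        by (intro bexI[of _ "0\<^sub>m (xdim n Y a) 1"] mat_no_rows) auto
    next
      case True
      \<comment> \<open>A cocycle on the arrow leaving the support. Being zero on the inner arrows,
        it forces \<open>h\<close> to be transported from \<open>h a\<close>, so \<open>y\<close> is
        minus the image of \<open>h a\<close>.\<close>
      let ?c = "\<lambda>i. if Suc i = b then y else 0\<^sub>m (dimv Y (Suc i)) (dimv (interval a b :: 'a qrep) i)"
      obtain h where h: "\<And>i. i \<in> {1..n} \<Longrightarrow> dim_row (h i) = dimv Y i"
        "\<And>i. i \<in> {1..n} \<Longrightarrow> dim_col (h i) = dimv (interval a b :: 'a qrep) i"
        "\<And>i. i \<in> {1..<n} \<Longrightarrow> ?c i = h (Suc i) * arr (interval a b) i - arr Y i * h i"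
        by (rule no_extE[OF E, of ?c]) (use y ab True in auto)
      have ha: "h a \<in> carrier_mat (xdim n Y a) 1" using h(1,2)[of a] ab True by (intro carrier_matI) auto
      have eq: "h i = path n Y a i * h a" if "a \<le> i" "i < b" for i
        using that
      proof (induction i rule: dec_induct)
        case base
        then show ?case using ha by (simp add: mat_ring)
      next
        case (step i)
        then have i: "i \<in> {1..<n}" and i': "i \<in> {1..n}" "Suc i \<in> {1..n}" using ab by auto
        have z: "0\<^sub>m (dimv Y (Suc i)) 1 = h (Suc i) - arr Y i * h i"
          using h(3)[OF i] h(1,2)[OF i'(2)] step by (simp add: interval_arr mat_ring)
        have "h (Suc i) = arr Y i * h i"
        proof (rule eq_matI)
          show d: "dim_row (h (Suc i)) = dim_row (arr Y i * h i)"
              "dim_col (h (Suc i)) = dim_col (arr Y i * h i)"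
            using h(1,2)[OF i'(2)] h(1,2)[OF i'(1)] rep_dim[OF r i] step by auto
          fix j k assume jk: "j < dim_row (arr Y i * h i)" "k < dim_col (arr Y i * h i)"
          have "(h (Suc i) - arr Y i * h i) $$ (j, k) = 0"
            unfolding z[symmetric] using jk d h(1,2)[OF i'(1)] rep_dim[OF r i] step by auto
          then show "h (Suc i) $$ (j, k) = (arr Y i * h i) $$ (j, k)" using jk d by simp
        qed
        also have "\<dots> = path n Y a (Suc i) * h a"
          using step i rep_dim[OF r i] path_dim[OF r ab(1), of i] ha by (simp add: path_Suc xarr_eq mat_assoc)
        finally show ?case .
      qed
      define c where "c = b - 1"
      have c: "c \<in> {1..<n}" "b = Suc c" "a \<le> c" using ab True by (auto simp: c_def)
      have c': "c \<in> {1..n}" "Suc c \<in> {1..n}" using c by auto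
      have P: "path n Y a b * h a = arr Y c * h c"
        using c rep_dim[OF r c(1)] path_dim[OF r ab(1), of c] ha eq[of c] by (simp add: path_Suc xarr_eq
            mat_assoc)
      have "y = h b * arr (interval a b) c - arr Y c * h c" using h(3)[OF c(1)] c by simp
      also have "h b * arr (interval a b) c = 0\<^sub>m (dimv Y b) 1"
        using c h(1,2)[OF c'(2)] by (intro eq_matI) (auto simp: scalar_prod_def)
      finally have y': "y = 0\<^sub>m (dimv Y b) 1 - path n Y a b * h a" unfolding P .
      have "path n Y a b * (0\<^sub>m (xdim n Y a) 1 - h a) = y"
        unfolding y' using ha path_dim[OF r ab(1), of b] ab True by (simp add: mat_ring)
      then show ?thesis using ha by (intro bexI[of _ "0\<^sub>m (xdim n Y a) 1 - h a"]) (auto intro: carrier_matI)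
    qed
  qed
next
  assume P: "path_surj n Y a b"
  show "no_ext n (interval a b) Y"
  proof (rule no_extI)
    fix c :: "nat \<Rightarrow> 'a mat"
    assume c: "\<And>i. i \<in> {1..<n} \<Longrightarrow> dim_row (c i) = dimv Y (Suc i)"
      "\<And>i. i \<in> {1..<n} \<Longrightarrow> dim_col (c i) = dimv (interval a b :: 'a qrep) i"
    \<comment> \<open>\<open>z\<close> solves the equations of the inner arrows with value
      \<open>0\<close> at \<open>a\<close>. Adding the path images of some \<open>x\<close> keeps
      them valid, and surjectivity allows \<open>x\<close> to be chosen for the last arrow.\<close>
    define z where "z = rec_nat (0\<^sub>m (dimv Y a) 1) (\<lambda>k u. arr Y (a + k) * u + c (a + k))"
    have z0: "z 0 = 0\<^sub>m (dimv Y a) 1" and zS: "z (Suc k) = arr Y (a + k) * z k + c (a + k)" for k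
      by (simp_all add: z_def)
    have zd: "dim_row (z k) = dimv Y (a + k)" "dim_col (z k) = 1" if "a + k < b" for k
    proof -
      have "dim_row (z k) = dimv Y (a + k) \<and> dim_col (z k) = 1"
        using that
      proof (induction k)
        case (Suc k)
        then have i: "a + k \<in> {1..<n}" using ab by auto
        show ?case using Suc c[OF i] rep_dim[OF r i] by (simp add: zS)
      qed (simp add: z0)
      then show "dim_row (z k) = dimv Y (a + k)" "dim_col (z k) = 1" by auto
    qed
    obtain x where x: "x \<in> carrier_mat (xdim n Y a) 1"
      and xb: "b \<le> n \<Longrightarrow> path n Y a b * x = 0\<^sub>m (dimv Y b) 1 - (arr Y (b - 1) * z (b - 1 - a) + c (b - 1))"
    proof (cases "b \<le> n")
      case True
      have i: "b - 1 \<in> {1..<n}" "Suc (b - 1) = b" "a + (b - 1 - a) = b - 1" using ab True by auto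
      have "0\<^sub>m (dimv Y b) 1 - (arr Y (b - 1) * z (b - 1 - a) + c (b - 1)) \<in> carrier_mat (xdim n Y b) 1"
        using True c[OF i(1)] i ab by (intro carrier_matI) auto
      then show ?thesis using P that unfolding path_surj_def by metis
    next
      case False
      then show ?thesis using that[of "0\<^sub>m (xdim n Y a) 1"] by simp
    qed
    define h where "h i = (if a \<le> i \<and> i < b then path n Y a i * x + z (i - a) else 0\<^sub>m (dimv Y i) 0)" for i
    have hd: "dim_row (h i) = dimv Y i \<and> dim_col (h i) = dimv (interval a b :: 'a qrep) i"
        if i: "i \<in> {1..n}" for i
      using i x zd[of "i - a"] path_dim[OF r ab(1), of i] by (auto simp: h_def)
    have "c i = h (Suc i) * arr (interval a b) i - arr Y i * h i" if i: "i \<in> {1..<n}" for i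
    proof -
      note rd = rep_dim[OF r i] and cd = c[OF i]
      consider "a \<le> i" "Suc i < b" | "a \<le> i" "Suc i = b" | "\<not> (a \<le> i \<and> i < b)" by linarith
      then show ?thesis
      proof cases
        case 1
        have d: "dim_row (path n Y a i) = dimv Y i" "dim_col (path n Y a i) = xdim n Y a"
          using path_dim[OF r ab(1) 1(1)] i by auto
        have zi: "dim_row (z (i - a)) = dimv Y i" "dim_col (z (i - a)) = 1" using zd[of "i - a"] 1 by auto
        have "h (Suc i) = arr Y i * (path n Y a i * x) + (arr Y i * z (i - a) + c i)"
          using 1 i rd d x zS[of "i - a"] by (simp add: h_def path_Suc xarr_eq mat_assoc Suc_diff_le)
        moreover have "arr Y i * h i = arr Y i * (path n Y a i * x) + arr Y i * z (i - a)"
          using 1 i rd d x zi by (simp add: h_def mat_ring)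
        ultimately show ?thesis
          using 1 rd cd zi x d hd[of "Suc i"] i by (simp add: interval_arr mat_ring) (intro eq_matI, auto)
      next
        case 2
        have d: "dim_row (path n Y a i) = dimv Y i" "dim_col (path n Y a i) = xdim n Y a"
          using path_dim[OF r ab(1) 2(1)] i by auto
        have zi: "dim_row (z (i - a)) = dimv Y i" "dim_col (z (i - a)) = 1" using zd[of "i - a"] 2 by auto
        have bi: "b - 1 = i" "b \<le> n" using 2 i by auto
        have "path n Y a b * x = arr Y i * (path n Y a i * x)"
          using 2 i x rd d by (auto simp: path_Suc xarr_eq mat_assoc)
        then have "arr Y i * (path n Y a i * x) = 0\<^sub>m (dimv Y b) 1 - (arr Y i * z (i - a) + c i)"
          using xb[OF bi(2), unfolded bi(1)] by (rule trans[OF sym])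
        then have "arr Y i * h i = (0\<^sub>m (dimv Y b) 1 - (arr Y i * z (i - a) + c i)) + arr Y i * z (i - a)"
          using 2 i rd d x zi by (simp add: h_def mat_ring)
        moreover have "h (Suc i) * arr (interval a b) i = 0\<^sub>m (dimv Y b) 1"
          using 2 by (intro eq_matI) (auto simp: h_def scalar_prod_def)
        ultimately show ?thesis using 2 rd cd zi by (intro eq_matI) auto
      next
        case 3
        then show ?thesis using cd rd hd[of "Suc i"] hd[of i] i by (intro mat_no_cols) auto
      qed
    qed
    then show "\<exists>h. (\<forall>i\<in>{1..n}. dim_row (h i) = dimv Y i \<and> dim_col (h i) = dimv (interval a b :: 'a qrep) i) \<and>
      (\<forall>i\<in>{1..<n}. c i = h (Suc i) * arr (interval a b) i - arr Y i * h i)"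
      using hd by blast
  qed
qed

definition path_bij :: "nat \<Rightarrow> 'k::field qrep \<Rightarrow> nat \<Rightarrow> nat \<Rightarrow> bool" where
  "path_bij n Y a b \<longleftrightarrow> (\<exists>B. dim_row B = xdim n Y a \<and> dim_col B = xdim n Y b \<and>
     B * path n Y a b = 1\<^sub>m (xdim n Y a) \<and> path n Y a b * B = 1\<^sub>m (xdim n Y b))"

lemma path_inj_surj_iff_bij:
  assumes r: "is_rep n Y" and ab: "1 \<le> a" "a \<le> b"
  shows "path_inj n Y a b \<and> path_surj n Y a b \<longleftrightarrow> path_bij n Y a b"
proof
  let ?A = "path n Y a b" and ?a = "xdim n Y a" and ?b = "xdim n Y b"
  note [simp] = path_dim[OF r ab]
  {
    assume P: "path_inj n Y a b \<and> path_surj n Y a b"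
    have A: "?A \<in> carrier_mat ?b ?a" by (rule carrier_matI) auto
    have "\<exists>C\<in>carrier_mat ?a ?b. ?A * C = 1\<^sub>m ?b"
    proof (rule mat_solve_cols[OF A])
      fix j assume j: "j < ?b"
      let ?y = "mat ?b 1 (\<lambda>(i, _). 1\<^sub>m ?b $$ (i, j)) :: 'a mat"
      obtain x where x: "x \<in> carrier_mat ?a 1" "?A * x = ?y"
        using P unfolding path_surj_def by (meson mat_carrier)
      have "?A *\<^sub>v col x 0 = col ?y 0" using col_mult2[OF A x(1), of 0] x(2) by simp
      also have "\<dots> = col (1\<^sub>m ?b) j" using j by (intro eq_vecI) auto
      finally show "\<exists>v\<in>carrier_vec ?a. ?A *\<^sub>v v = col (1\<^sub>m ?b) j"
        using col_carrier_vec[OF _ x(1), of 0] by (intro bexI[of _ "col x 0"]) auto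
    qed simp
    then obtain C where C: "C \<in> carrier_mat ?a ?b" "?A * C = 1\<^sub>m ?b" by blast
    note [simp] = carrier_matD[OF C(1)]
    have "C * ?A = 1\<^sub>m ?a"
    proof (rule eq_matI)
      fix i j assume ij: "i < dim_row (1\<^sub>m ?a)" "j < dim_col (1\<^sub>m ?a)"
      let ?e = "mat ?a 1 (\<lambda>(i, _). if i = j then 1 else 0) :: 'a mat"
      have "?A * ((C * ?A - 1\<^sub>m ?a) * ?e) = (?A * C) * (?A * ?e) - ?A * ?e"
        by (simp add: mat_ring)
      also have "\<dots> = 0\<^sub>m ?b 1" unfolding C(2) by (simp add: mat_ring)
      finally have "?A * ((C * ?A - 1\<^sub>m ?a) * ?e) = 0\<^sub>m ?b 1" .
      moreover have "(C * ?A - 1\<^sub>m ?a) * ?e \<in> carrier_mat ?a 1" by (rule carrier_matI) auto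
      ultimately have 0: "(C * ?A - 1\<^sub>m ?a) * ?e = 0\<^sub>m ?a 1"
        using P unfolding path_inj_def by blast
      have De: "(D * ?e) $$ (i, 0) = D $$ (i, j)" if "dim_row D = ?a" "dim_col D = ?a" for D :: "'a mat"
        using that ij by (simp add: scalar_prod_def if_distrib[of "\<lambda>x. _ * x"] sum.delta cong: if_cong)
      have "(C * ?A - 1\<^sub>m ?a) $$ (i, j) = 0\<^sub>m ?a 1 $$ (i, 0)"
        unfolding 0[symmetric] by (rule De[symmetric]) auto
      then show "(C * ?A) $$ (i, j) = 1\<^sub>m ?a $$ (i, j)" using ij by simp
    qed auto
    then show "path_bij n Y a b" unfolding path_bij_def using C by (intro exI[of _ C]) simp
  }
  assume "path_bij n Y a b"
  then obtain B where B: "dim_row B = ?a" "dim_col B = ?b" "B * ?A = 1\<^sub>m ?a" "?A * B = 1\<^sub>m ?b"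
    unfolding path_bij_def by blast
  have "x = 0\<^sub>m ?a 1" if x: "x \<in> carrier_mat ?a 1" "?A * x = 0\<^sub>m ?b 1" for x
    using mat_assoc[of B ?A x] x B by (simp add: mat_oneL mat_zeroR)
  moreover have "?A * (B * y) = y" "B * y \<in> carrier_mat ?a 1" if "y \<in> carrier_mat ?b 1" for y
    using mat_assoc[of ?A B y] that B by (auto simp: mat_oneL intro: carrier_matI)
  ultimately show "path_inj n Y a b \<and> path_surj n Y a b" unfolding path_inj_def path_surj_def by blast
qed

lemma interval_vanish_iff:
  assumes "is_rep n Y" "1 \<le> a" "a < b" "b \<le> Suc n"
  shows "no_hom n (interval a b) Y \<and> no_ext n (interval a b) Y \<longleftrightarrow> path_bij n Y a b"
  using assms by (simp add: no_hom_interval no_ext_interval path_inj_surj_iff_bij)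

section \<open>Classification of indecomposables\<close>

lemma one_mat_eq_zero: "1\<^sub>m k = (0\<^sub>m k k :: 'k::field mat) \<Longrightarrow> k = 0"
proof (rule ccontr)
  assume e: "1\<^sub>m k = (0\<^sub>m k k :: 'k mat)" and "k \<noteq> 0"
  have "(1\<^sub>m k :: 'k mat) $$ (0, 0) = 0\<^sub>m k k $$ (0, 0)" by (simp only: e)
  then show False using \<open>k \<noteq> 0\<close> by simp
qed

lemma mult_through_zero: "dim_col A = 0 \<Longrightarrow> dim_row B = 0 \<Longrightarrow> A * B = 0\<^sub>m (dim_row A) (dim_col B)"
  for A B :: "'k::field mat"
  by (intro eq_matI) (auto simp: scalar_prod_def)

lemma path_bijE:
  assumes "path_bij n Y a b"
  obtains B where "dim_row B = xdim n Y a" "dim_col B = xdim n Y b"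
    "B * path n Y a b = 1\<^sub>m (xdim n Y a)" "path n Y a b * B = 1\<^sub>m (xdim n Y b)"
  using assms unfolding path_bij_def by blast

lemma path_bijI:
  "dim_row B = xdim n Y a \<Longrightarrow> dim_col B = xdim n Y b \<Longrightarrow>
   B * path n Y a b = 1\<^sub>m (xdim n Y a) \<Longrightarrow> path n Y a b * B = 1\<^sub>m (xdim n Y b) \<Longrightarrow> path_bij n Y a b"
  unfolding path_bij_def by blast

lemma retract_path_bij:
  assumes r: "is_rep n X" "is_rep n W" and "retract n X W" and cd: "1 \<le> c" "c < d" "d \<le> Suc n"
    and W: "path_bij n W c d"
  shows "path_bij n X c d"
proof -
  obtain s p where s: "morphism n X W s" and p: "morphism n W X p"
    and ps: "\<And>i. i \<in> {1..n} \<Longrightarrow> p i * s i = 1\<^sub>m (dimv X i)"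
    using assms(3) by (auto simp: retract_def)
  obtain B where B: "dim_row B = xdim n W c" "dim_col B = xdim n W d"
    "B * path n W c d = 1\<^sub>m (xdim n W c)" "path n W c d * B = 1\<^sub>m (xdim n W d)"
    by (rule path_bijE[OF W])
  have cd': "c \<le> d" and d1: "1 \<le> d" using cd by auto
  let ?s = "xmap n s" and ?p = "xmap n p"
  have one: "?p i * ?s i = 1\<^sub>m (xdim n X i)" if "1 \<le> i" for i
    by (rule xmap_mult_one[OF _ that]) (rule ps)
  note [simp] = xmap_dim[OF s cd(1)] xmap_dim[OF s d1] xmap_dim[OF p cd(1)] xmap_dim[OF p d1] B(1,2)
    path_dim[OF r(1) cd(1) cd'] path_dim[OF r(2) cd(1) cd']
  show ?thesis
  proof (rule path_bijI[of "?p c * (B * ?s d)"])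
    have "(?p c * (B * ?s d)) * path n X c d = ?p c * (B * (?s d * path n X c d))" by (simp add: mat_assoc)
    also have "\<dots> = ?p c * ((B * path n W c d) * ?s c)"
      unfolding path_natural[OF r s cd(1) cd' cd(3)] by (simp add: mat_assoc)
    finally show "(?p c * (B * ?s d)) * path n X c d = 1\<^sub>m (xdim n X c)"
      by (simp add: B mat_oneL one[OF cd(1)])
    have "path n X c d * (?p c * (B * ?s d)) = (path n X c d * ?p c) * (B * ?s d)" by (simp add: mat_assoc)
    also have "\<dots> = ?p d * ((path n W c d * B) * ?s d)"
      unfolding path_natural[OF r(2,1) p cd(1) cd' cd(3), symmetric] by (simp add: mat_assoc)
    finally show "path n X c d * (?p c * (B * ?s d)) = 1\<^sub>m (xdim n X d)"
      by (simp add: B mat_oneL one[OF d1])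
  qed auto
qed

lemma isomorphic_path_bij:
  "isomorphic n X Y \<Longrightarrow> 1 \<le> c \<Longrightarrow> c < d \<Longrightarrow> d \<le> Suc n \<Longrightarrow> path_bij n X c d \<longleftrightarrow> path_bij n Y c d"
  using isomorphic_retract[of n X Y] retract_path_bij unfolding isomorphic_def by blast

lemma xdim_interval: "b \<le> Suc n \<Longrightarrow> xdim n (interval a b) i = (if a \<le> i \<and> i < b then 1 else 0)"
  by (auto simp: xdim_def)

lemma path_interval:
  assumes "a \<le> c" "c \<le> d" "d < b" "b \<le> Suc n"
  shows "path n (interval a b) c d = 1\<^sub>m 1"
  using assms(2,3)
proof (induction d rule: dec_induct)
  case base
  then show ?case using assms by simp
next
  case (step i)
  then show ?case using assms by (simp add: path_Suc xarr_eq interval_arr mat_ring)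
qed

text \<open>All spaces have dimension \<open>0\<close> or \<open>1\<close>, and paths within the
  support are identities; so bijectivity is equality of dimensions. The vertex \<open>n + 1\<close>,
  never in the support, has dimension \<open>0\<close> as it should.\<close>

lemma path_bij_interval:
  assumes ab: "1 \<le> a" "a < b" "b \<le> Suc n" and cd: "1 \<le> c" "c < d" "d \<le> Suc n"
  shows "path_bij n (interval a b :: 'k::field qrep) c d \<longleftrightarrow> (c \<in> {a..<b} \<longleftrightarrow> d \<in> {a..<b})"
proof -
  let ?M = "interval a b :: 'k qrep"
  have r: "is_rep n ?M" by (rule is_rep_interval)
  have cd': "c \<le> d" using cd by simp
  note pd = path_dim[OF r cd(1) cd'] and xd = xdim_interval[OF ab(3)]
  have z: "0\<^sub>m 1 1 \<noteq> (1\<^sub>m 1 :: 'k mat)" by (rule notI) (drule one_mat_eq_zero[OF sym], simp)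
  have no: "\<not> path_bij n ?M c d" if ne: "xdim n ?M c \<noteq> xdim n ?M d"
  proof
    assume "path_bij n ?M c d"
    then obtain B where B: "dim_row B = xdim n ?M c" "dim_col B = xdim n ?M d"
      "B * path n ?M c d = 1\<^sub>m (xdim n ?M c)" "path n ?M c d * B = 1\<^sub>m (xdim n ?M d)"
      by (rule path_bijE)
    consider "xdim n ?M c = 0" "xdim n ?M d = 1" | "xdim n ?M c = 1" "xdim n ?M d = 0"
      using ne by (auto simp: xd split: if_splits)
    then show False
    proof cases
      case 1
      then show False using B mult_through_zero[of "path n ?M c d" B] pd z by simp
    next
      case 2
      then show False using B mult_through_zero[of B "path n ?M c d"] pd z by simp
    qed
  qed
  consider "c \<in> {a..<b}" "d \<in> {a..<b}" | "c \<notin> {a..<b}" "d \<notin> {a..<b}" | "c \<in> {a..<b} \<longleftrightarrow> d \<notin> {a..<b}" by blast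
  then show ?thesis
  proof cases
    case 1
    then have "path n ?M c d = 1\<^sub>m 1" using ab cd by (intro path_interval) auto
    then have "path_bij n ?M c d" using 1 by (intro path_bijI[of "1\<^sub>m 1"]) (auto simp: xd)
    then show ?thesis using 1 by blast
  next
    case 2
    then have "xdim n ?M c = 0" "xdim n ?M d = 0" by (auto simp: xd)
    then have "path_bij n ?M c d" using pd by (intro path_bijI[of "0\<^sub>m 0 0"] mat_no_rows) auto
    then show ?thesis using 2 by blast
  next
    case 3
    then have "xdim n ?M c \<noteq> xdim n ?M d" by (auto simp: xd)
    then show ?thesis using 3 no by blast
  qed
qed

lemma direct_sum_single [simp]: "direct_sum [Z] = (Z :: 'k::field qrep)"
proof -
  have "diag_block_mat [A] = A" for A :: "'k mat"
    by (simp add: Let_def) (intro eq_matI, auto)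
  then show ?thesis by (cases Z) (simp add: direct_sum_def)
qed

text \<open>The complement is the cokernel of \<open>s\<close>. Its section \<open>t\<close>, chosen
  at each vertex separately, is replaced by \<open>v = t - s * (p * t)\<close>, which lies in the
  kernel of \<open>p\<close>; this makes \<open>v\<close> and \<open>u\<close> commute with the
  arrows.\<close>

lemma retract_complement:
  assumes r: "is_rep n X" "is_rep n V" and s: "morphism n X V s" and p: "morphism n V X p"
    and ps: "\<And>i. i \<in> {1..n} \<Longrightarrow> p i * s i = 1\<^sub>m (dimv X i)"
  obtains Z t q where "is_rep n Z" "biproduct n V X Z s p t q"
proof -
  have "\<exists>w u t r. u \<in> carrier_mat w (dimv V i) \<and> t \<in> carrier_mat (dimv V i) w \<and>
      r \<in> carrier_mat (dimv X i) (dimv V i) \<and>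
    u * s i = 0\<^sub>m w (dimv X i) \<and> u * t = 1\<^sub>m w \<and> t * u + s i * r = 1\<^sub>m (dimv V i)" if i: "i \<in> {1..n}" for i
  proof -
    have "s i \<in> carrier_mat (dimv V i) (dimv X i)" using s i by (auto simp: morphism_def)
    then show ?thesis by (rule cokernel_exists) blast
  qed
  then obtain w u t r where c: "\<And>i. i \<in> {1..n} \<Longrightarrow> u i \<in> carrier_mat (w i) (dimv V i) \<and>
      t i \<in> carrier_mat (dimv V i) (w i) \<and>
    r i \<in> carrier_mat (dimv X i) (dimv V i) \<and>
    u i * s i = 0\<^sub>m (w i) (dimv X i) \<and> u i * t i = 1\<^sub>m (w i) \<and> t i * u i + s i * r i = 1\<^sub>m (dimv V i)"
    by metis
  define v where "v i = t i - s i * (p i * t i)" for i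
  define Z where "Z = QRep w (\<lambda>i. u (Suc i) * (arr V i * v i))"
  have d: "dim_row (u i) = w i" "dim_col (u i) = dimv V i" "dim_row (t i) = dimv V i" "dim_col (t i) = w i"
    "dim_row (r i) = dimv X i" "dim_col (r i) = dimv V i" "dim_row (s i) = dimv V i" "dim_col (s i) = dimv X i"
    "dim_row (p i) = dimv X i" "dim_col (p i) = dimv V i" "dim_row (v i) = dimv V i" "dim_col (v i) = w i"
    if "i \<in> {1..n}" for i
    using c[OF that] morphism_dim[OF s that] morphism_dim[OF p that] by (auto simp: v_def)
  have e: "p i * v i = 0\<^sub>m (dimv X i) (w i)" "u i * v i = 1\<^sub>m (w i)" "u i * s i = 0\<^sub>m (w i) (dimv X i)"
    "s i * p i + v i * u i = 1\<^sub>m (dimv V i)" if i: "i \<in> {1..n}" for i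
  proof -
    note [simp] = d[OF i]
    have us: "u i * s i = 0\<^sub>m (w i) (dimv X i)" and ut: "u i * t i = 1\<^sub>m (w i)"
      and tu: "t i * u i + s i * r i = 1\<^sub>m (dimv V i)" using c[OF i] by auto
    have ps': "p i * (s i * M) = M" if "dim_row M = dimv X i" for M
      using that mat_assoc[of "p i" "s i" M] by (simp add: ps[OF i] mat_oneL)
    have us': "u i * (s i * M) = 0\<^sub>m (w i) (dim_col M)" if "dim_row M = dimv X i" for M
      using that mat_assoc[of "u i" "s i" M] by (simp add: us mat_zeroL)
    show "u i * s i = 0\<^sub>m (w i) (dimv X i)" by (rule us)
    show "p i * v i = 0\<^sub>m (dimv X i) (w i)" by (simp add: v_def mat_ring ps')
    show "u i * v i = 1\<^sub>m (w i)" by (simp add: v_def mat_ring us' ut)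
    have sp: "s i * (p i * (t i * u i + s i * r i)) = s i * (p i * (t i * u i)) + s i * r i"
      by (simp add: mat_ring ps')
    have "s i * p i + v i * u i = s i * (p i * (t i * u i + s i * r i))
        + (t i * u i - s i * (p i * (t i * u i)))"
      unfolding tu by (simp add: v_def mat_ring)
    also have "\<dots> = t i * u i + s i * r i" unfolding sp by (intro eq_matI) auto
    finally show "s i * p i + v i * u i = 1\<^sub>m (dimv V i)" unfolding tu .
  qed
  have sd: "dimv Z i = w i" for i by (simp add: Z_def)
  have rZ: "is_rep n Z" unfolding is_rep_def using d by (intro ballI carrier_matI) (auto simp: Z_def)
  have comm: "v (Suc i) * arr Z i = arr V i * v i \<and> u (Suc i) * arr V i = arr Z i * u i" if i: "i \<in> {1..<n}"
      for i
  proof -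
    have i': "i \<in> {1..n}" "Suc i \<in> {1..n}" using i by auto
    note [simp] = d[OF i'(1)] d[OF i'(2)] rep_dim[OF r(1) i] rep_dim[OF r(2) i]
    have aZ: "arr Z i = u (Suc i) * (arr V i * v i)" by (simp add: Z_def)
    have "arr V i * v i = (s (Suc i) * p (Suc i) + v (Suc i) * u (Suc i)) * (arr V i * v i)"
      by (simp add: e[OF i'(2)] mat_oneL)
    also have "\<dots> = s (Suc i) * ((p (Suc i) * arr V i) * v i) + v (Suc i) * arr Z i"
      by (simp add: aZ mat_ring)
    also have "(p (Suc i) * arr V i) * v i = 0\<^sub>m (dimv X (Suc i)) (w i)"
      unfolding morphism_comm[OF p i] by (simp add: mat_ring e[OF i'(1)])
    finally have 1: "arr V i * v i = v (Suc i) * arr Z i" by (simp add: aZ mat_ring)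
    have "u (Suc i) * arr V i = (u (Suc i) * arr V i) * (s i * p i + v i * u i)"
      by (simp add: e[OF i'(1)] mat_oneR)
    also have "\<dots> = u (Suc i) * ((arr V i * s i) * p i) + arr Z i * u i"
      by (simp add: aZ mat_ring)
    also have "u (Suc i) * ((arr V i * s i) * p i) = (u (Suc i) * s (Suc i)) * (arr X i * p i)"
      unfolding morphism_comm[OF s i, symmetric] by (simp add: mat_assoc)
    finally have 2: "u (Suc i) * arr V i = arr Z i * u i" by (simp add: e[OF i'(2)] aZ mat_ring)
    show ?thesis using 1 2 by simp
  qed
  have "biproduct n V X Z s p v u"
    unfolding biproduct_def
  proof (intro conjI s p ballI)
    show "morphism n Z V v" "morphism n V Z u"
      by (rule morphismI; use comm d sd in simp)+
  qed (simp_all add: ps e sd)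
  then show ?thesis using that rZ by blast
qed

text \<open>A nonzero element \<open>x\<close> of the first nonzero space generates an interval
  submodule, ending where \<open>x\<close> dies. A functional that is \<open>1\<close> on the last
  nonzero image of \<open>x\<close>, pulled back along the paths, is a retraction onto it. So the
  interval is a direct summand, and it must be everything.\<close>

lemma indecomposable_isomorphic_interval:
  assumes "indecomposable n M"
  obtains a b where "1 \<le> a" "a < b" "b \<le> Suc n" "isomorphic n M (interval a b)"
proof -
  have r: "is_rep n M" and nz: "\<exists>i. i \<in> {1..n} \<and> dimv M i \<noteq> 0"
    and ind: "\<And>X Y. is_rep n X \<Longrightarrow> is_rep n Y \<Longrightarrow> isomorphic n M (direct_sum [X, Y]) \<Longrightarrow> is_zero n X \<or> is_zero n Y"
    using assms by (auto simp: indecomposable_def is_zero_def)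
  define a where "a = (LEAST i. i \<in> {1..n} \<and> dimv M i \<noteq> 0)"
  have a: "a \<in> {1..n}" "dimv M a \<noteq> 0" using LeastI_ex[OF nz] by (auto simp: a_def)
  have below: "dimv M i = 0" if "1 \<le> i" "i < a" for i
    using not_less_Least[of i "\<lambda>i. i \<in> {1..n} \<and> dimv M i \<noteq> 0"] that a by (auto simp: a_def)
  define x where "x = mat (dimv M a) 1 (\<lambda>_. 1 :: 'a)"
  have x: "x \<in> carrier_mat (xdim n M a) 1" "x \<noteq> 0\<^sub>m (dimv M a) 1"
  proof -
    show "x \<in> carrier_mat (xdim n M a) 1" using a by (auto simp: x_def)
    show "x \<noteq> 0\<^sub>m (dimv M a) 1"
    proof
      assume "x = 0\<^sub>m (dimv M a) 1"
      then have "x $$ (0, 0) = 0\<^sub>m (dimv M a) 1 $$ (0, 0)" by (rule arg_cong)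
      then show False using a(2) by (simp add: x_def)
    qed
  qed
  let ?P = "\<lambda>b. a < b \<and> path n M a b * x = 0\<^sub>m (xdim n M b) 1"
  have "?P (Suc n)"
    using a x(1) path_dim[OF r, of a "Suc n"] by (auto intro!: mat_no_rows)
  then have "\<exists>b. ?P b" by blast
  define b where "b = (LEAST b. ?P b)"
  have b: "a < b" "path n M a b * x = 0\<^sub>m (xdim n M b) 1" using LeastI_ex[OF \<open>\<exists>b. ?P b\<close>] by (auto simp: b_def)
  have bn: "b \<le> Suc n" unfolding b_def by (rule Least_le) (rule \<open>?P (Suc n)\<close>)
  define m where "m = b - 1"
  have m: "a \<le> m" "m < b" "b = Suc m" "m \<le> n" "m \<in> {1..n}" using b bn a by (auto simp: m_def)
  have a1: "1 \<le> a" using a by simp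
  define y where "y = path n M a m * x"
  have y: "y \<in> carrier_mat (dimv M m) 1" using x(1) m path_dim[OF r a1 m(1)] by (auto simp: y_def intro!:
      carrier_matI)
  have y0: "y \<noteq> 0\<^sub>m (dimv M m) 1"
  proof (cases "m = a")
    case True
    then show ?thesis using x a by (simp add: y_def mat_oneL)
  next
    case False
    then have "\<not> ?P m" using not_less_Least[of m ?P] m by (auto simp: b_def)
    then show ?thesis using False m by (simp add: y_def)
  qed
  then obtain j where j: "j < dimv M m" "y $$ (j, 0) \<noteq> 0"
    using y by (auto simp: mat_eq_iff)
  obtain d where d: "dimv M m = Suc d" using j by (cases "dimv M m") auto
  obtain \<phi> where \<phi>: "\<phi> \<in> carrier_mat 1 (dimv M m)" "\<phi> * y = 1\<^sub>m 1"
    using split_column[of y d j] y j d by metis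
  let ?I = "interval a b :: 'a qrep"
  let ?s = "from_interval n M a b x"
  define p where "p i = (if a \<le> i \<and> i < b then \<phi> * path n M i m else 0\<^sub>m 0 (dimv M i))" for i
  have s: "morphism n ?I M ?s" by (rule morphism_from_interval[OF r a1 b(1) bn x(1) b(2)])
  have p: "morphism n M ?I p"
  proof (rule morphismI)
    fix i assume i: "i \<in> {1..n}"
    show "dim_row (p i) = dimv ?I i" "dim_col (p i) = dimv M i"
      using i \<phi> m path_dim[OF r, of i m] by (auto simp: p_def)
  next
    fix i assume i: "i \<in> {1..<n}"
    note rd = rep_dim[OF r i]
    consider "a \<le> i" "Suc i < b" | "Suc i = a" | "\<not> (a \<le> Suc i \<and> Suc i < b)" by linarith
    then show "p (Suc i) * arr M i = arr ?I i * p i"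
    proof cases
      case 1
      have "path n M i (Suc i) = arr M i" using i rd by (simp add: path_Suc xarr_eq mat_oneR)
      then have "path n M (Suc i) m * arr M i = path n M i m"
        using path_comp[OF r, of i "Suc i" m] 1 m i by simp
      moreover have "p (Suc i) * arr M i = \<phi> * (path n M (Suc i) m * arr M i)"
        using 1 m i \<phi> rd path_dim[OF r, of "Suc i" m] by (simp add: p_def mat_assoc)
      moreover have "arr ?I i * p i = p i"
        using 1 \<phi> by (simp add: interval_arr p_def mat_oneL)
      ultimately show ?thesis using 1 by (simp add: p_def)
    next
      case 2
      \<comment> \<open>Minimality of \<open>a\<close> enters here: as the space at \<open>i\<close>
        is zero, the functional has nothing to annihilate on the arrow into
        \<open>a\<close>.\<close>
      then show ?thesis
        using below[of i] i rd \<phi>(1) by (intro mat_no_cols) (auto simp: p_def)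
    next
      case 3
      then show ?thesis
        using i rd \<phi> m path_dim[OF r, of i m] by (intro mat_no_rows) (auto simp: p_def)
    qed
  qed
  have ps: "p i * ?s i = 1\<^sub>m (dimv ?I i)" if i: "i \<in> {1..n}" for i
  proof (cases "a \<le> i \<and> i < b")
    case True
    then have le: "a \<le> i" "i \<le> m" using m by auto
    have "p i * ?s i = \<phi> * ((path n M i m * path n M a i) * x)"
      using True i m(4) x(1) \<phi> path_dim[OF r a1 le(1)] path_dim[OF r _ le(2)]
      by (simp add: p_def from_interval_def mat_assoc)
    also have "\<dots> = 1\<^sub>m 1" unfolding path_comp[OF r a1 le] using \<phi>(2) by (simp add: y_def)
    finally show ?thesis using True by simp
  next
    case False
    then show ?thesis by (intro mat_no_rows) (auto simp: p_def from_interval_def)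
  qed
  obtain Z t q where Z: "is_rep n Z" "biproduct n M ?I Z ?s p t q"
    by (rule retract_complement[OF is_rep_interval r s p ps])
  have rs: "is_rep n (direct_sum [?I, Z])" using Z is_rep_interval by (intro is_rep_direct_sum) auto
  have "isomorphic n M (direct_sum [?I, Z])"
  proof -
    have "\<exists>s p t q. biproduct n (direct_sum [?I, Z]) ?I Z s p t q"
      using biproduct_direct_sum[OF is_rep_interval, of "[Z]" n a b] Z(1) by auto
    then obtain s' p' t' q' where b': "biproduct n (direct_sum [?I, Z]) ?I Z s' p' t' q'" by blast
    obtain h k where "morphism n M (direct_sum [?I, Z]) h" "morphism n (direct_sum [?I, Z]) M k"
      "\<And>i. i \<in> {1..n} \<Longrightarrow> k i * h i = 1\<^sub>m (dimv M i)" "\<And>i. i \<in> {1..n} \<Longrightarrow>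
          h i * k i = 1\<^sub>m (dimv (direct_sum [?I, Z]) i)"
      by (rule biproduct_compare[OF Z(1) is_rep_interval r rs Z(2) b']) blast
    then show ?thesis by (intro isomorphicI r rs)
  qed
  then have "is_zero n ?I \<or> is_zero n Z" by (rule ind[OF is_rep_interval Z(1)])
  moreover have "\<not> is_zero n ?I" using a b(1) by (auto simp: is_zero_def)
  ultimately have Z0: "dimv Z i = 0" if "i \<in> {1..n}" for i using that by (auto simp: is_zero_def)
  have "?s i * p i = 1\<^sub>m (dimv M i)" if i: "i \<in> {1..n}" for i
    using biproduct_eqs(5)[OF Z(2) i] biproduct_dim[OF Z(2) i] mult_through_zero[of "t i" "q i"] Z0[OF i]
    by (simp add: mat_add_zeroR)
  then have "isomorphic n M ?I" using ps by (intro isomorphicI[OF r is_rep_interval p s])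
  then show ?thesis using that a1 b(1) bn by blast
qed

lemma isomorphic_interval_eq:
  assumes iso: "isomorphic n (interval a b :: 'k::field qrep) (interval c d)"
    and ab: "1 \<le> a" "a < b" "b \<le> Suc n" and cd: "1 \<le> c" "c < d" "d \<le> Suc n"
  shows "a = c \<and> b = d"
proof -
  obtain f g where f: "morphism n (interval a b :: 'k qrep) (interval c d) f"
      and g: "morphism n (interval c d) (interval a b) g"
    and e: "\<And>i. i \<in> {1..n} \<Longrightarrow> g i * f i = 1\<^sub>m (dimv (interval a b :: 'k qrep) i)"
      "\<And>i. i \<in> {1..n} \<Longrightarrow> f i * g i = 1\<^sub>m (dimv (interval c d :: 'k qrep) i)"
    by (rule isomorphicE[OF iso]) blast
  have z: "1\<^sub>m 1 \<noteq> (0\<^sub>m 1 1 :: 'k mat)" by (rule notI) (drule one_mat_eq_zero, simp)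
  have mem: "i \<in> {a..<b} \<longleftrightarrow> i \<in> {c..<d}" if i: "i \<in> {1..n}" for i
  proof -
    have "i \<in> {c..<d}" if "i \<in> {a..<b}"
    proof (rule ccontr)
      assume "i \<notin> {c..<d}"
      then have "g i * f i = 0\<^sub>m 1 1"
        using that morphism_dim[OF f i] morphism_dim[OF g i] by (subst mult_through_zero) auto
      then show False using e(1)[OF i] that z by simp
    qed
    moreover have "i \<in> {a..<b}" if "i \<in> {c..<d}"
    proof (rule ccontr)
      assume "i \<notin> {a..<b}"
      then have "f i * g i = 0\<^sub>m 1 1"
        using that morphism_dim[OF f i] morphism_dim[OF g i] by (subst mult_through_zero) auto
      then show False using e(2)[OF i] that z by simp
    qed
    ultimately show ?thesis by blast
  qed
  have "{a..<b} = {c..<d}"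
  proof (rule Set.set_eqI)
    fix i show "i \<in> {a..<b} \<longleftrightarrow> i \<in> {c..<d}"
      using mem[of i] ab cd by (cases "i \<in> {1..n}") auto
  qed
  then show ?thesis using ab cd by (simp add: Ico_eq_Ico)
qed

section \<open>Perpendicular categories of chords\<close>

text \<open>An endomorphism is the same scalar at all vertices of the support. The idempotent of a
  summand is therefore \<open>0\<close> or \<open>1\<close> on the whole support, and one of the two
  summands is zero.\<close>

lemma indecomposable_interval:
  assumes ab: "1 \<le> a" "a < b" "b \<le> Suc n"
  shows "indecomposable n (interval a b :: 'k::field qrep)"
  unfolding indecomposable_def
proof (intro conjI allI impI)
  let ?M = "interval a b :: 'k qrep"
  show rM: "is_rep n ?M" by (rule is_rep_interval)
  show "\<not> is_zero n ?M" using ab by (auto simp: is_zero_def)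
  fix X Y :: "'k qrep"
  assume r: "is_rep n X" "is_rep n Y" and iso: "isomorphic n ?M (direct_sum [X, Y])"
  let ?W = "direct_sum [X, Y]"
  have rW: "is_rep n ?W" using r by (intro is_rep_direct_sum) auto
  obtain s p t q where b: "biproduct n ?W X Y s p t q"
    using biproduct_direct_sum[of n X "[Y]"] r by auto
  obtain f g where f: "morphism n ?M ?W f" and g: "morphism n ?W ?M g"
    and gf: "\<And>i. i \<in> {1..n} \<Longrightarrow> g i * f i = 1\<^sub>m (dimv ?M i)"
    and fg: "\<And>i. i \<in> {1..n} \<Longrightarrow> f i * g i = 1\<^sub>m (dimv ?W i)"
    by (rule isomorphicE[OF iso]) blast
  note m = biproduct_morphism[OF b]
  define S where "S = (\<lambda>i. g i * s i)"
  define P where "P = (\<lambda>i. p i * f i)"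
  define T where "T = (\<lambda>i. g i * t i)"
  define Q where "Q = (\<lambda>i. q i * f i)"
  have S: "morphism n X ?M S" and P: "morphism n ?M X P" and T: "morphism n Y ?M T" and Q: "morphism n ?M Y Q"
    unfolding S_def P_def T_def Q_def by (intro morphism_comp[of n _ ?W] r rW rM m f g)+
  have eqs: "P i * S i = 1\<^sub>m (dimv X i)" "Q i * T i = 1\<^sub>m (dimv Y i)"
    "S i * P i + T i * Q i = 1\<^sub>m (dimv ?M i)" if i: "i \<in> {1..n}" for i
  proof -
    note [simp] = biproduct_dim[OF b i] morphism_dim[OF f i] morphism_dim[OF g i]
    have fg': "f i * (g i * A) = A" if "dim_row A = dimv ?W i" for A
      using that mat_assoc[of "f i" "g i" A] by (simp add: fg[OF i] mat_oneL)
    show "P i * S i = 1\<^sub>m (dimv X i)" "Q i * T i = 1\<^sub>m (dimv Y i)"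
      by (simp_all add: P_def S_def Q_def T_def mat_assoc fg' biproduct_eqs[OF b i])
    have "S i * P i + T i * Q i = g i * ((s i * p i + t i * q i) * f i)"
      by (simp add: P_def S_def Q_def T_def mat_ring)
    then show "S i * P i + T i * Q i = 1\<^sub>m (dimv ?M i)"
      using gf[OF i] by (simp add: biproduct_eqs[OF b i] mat_oneL)
  qed
  have "morphism n ?M ?M (\<lambda>i. S i * P i)" by (rule morphism_comp[OF rM r(1) rM P S])
  note E = morphism_from_interval_eq[OF rM ab this]
  have a: "a \<in> {1..n}" using ab by auto
  have const: "S i * P i = S a * P a" if "a \<le> i" "i < b" for i
    using E(1)[OF that] path_interval[OF order_refl that ab(3), where ?'a =
        'k] morphism_dim[OF S a] morphism_dim[OF P a] ab
    by (simp add: mat_oneL)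
  define e where "e = S a * P a"
  have ed: "dim_row e = 1" "dim_col e = 1" using morphism_dim[OF S a] morphism_dim[OF P a] ab by (auto simp:
      e_def)
  have "e * e = e"
  proof -
    note [simp] = morphism_dim[OF S a] morphism_dim[OF P a]
    have "e * e = S a * ((P a * S a) * P a)" by (simp add: e_def mat_assoc)
    then show ?thesis by (simp add: eqs(1)[OF a] mat_oneL e_def)
  qed
  then have "(e * e) $$ (0, 0) = e $$ (0, 0)" by simp
  then have "e $$ (0, 0) * e $$ (0, 0) = e $$ (0, 0)" using ed by (simp add: scalar_prod_def)
  then have "e $$ (0, 0) = 0 \<or> e $$ (0, 0) = 1" by simp
  then have "e = 0\<^sub>m 1 1 \<or> e = 1\<^sub>m 1" using ed by (auto intro!: eq_matI)
  then show "is_zero n X \<or> is_zero n Y"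
  proof
    assume e0: "e = 0\<^sub>m 1 1"
    have "dimv X i = 0" if i: "i \<in> {1..n}" for i
    proof (rule one_mat_eq_zero[where ?'k = 'k])
      note [simp] = morphism_dim[OF S i] morphism_dim[OF P i]
      have "P i * S i = P i * ((S i * P i) * S i)" by (simp add: mat_assoc eqs(1)[OF i] mat_oneL mat_oneR)
      also have "S i * P i = 0\<^sub>m (dimv ?M i) (dimv ?M i)"
      proof (cases "a \<le> i \<and> i < b")
        case True
        then show ?thesis using const[of i] e0 by (simp add: e_def)
      qed (intro mat_no_rows, auto)
      finally show "1\<^sub>m (dimv X i) = (0\<^sub>m (dimv X i) (dimv X i) :: 'k mat)"
        unfolding eqs(1)[OF i] by (simp add: mat_zeroL mat_zeroR)
    qed
    then show ?thesis by (simp add: is_zero_def)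
  next
    assume e1: "e = 1\<^sub>m 1"
    have "dimv Y i = 0" if i: "i \<in> {1..n}" for i
    proof (rule one_mat_eq_zero[where ?'k = 'k])
      note [simp] = morphism_dim[OF T i] morphism_dim[OF Q i] morphism_dim[OF S i] morphism_dim[OF P i]
      have "Q i * T i = Q i * ((T i * Q i) * T i)" by (simp add: mat_assoc eqs(2)[OF i] mat_oneL mat_oneR)
      also have "T i * Q i = 0\<^sub>m (dimv ?M i) (dimv ?M i)"
      proof (cases "a \<le> i \<and> i < b")
        case True
        have "1\<^sub>m 1 + T i * Q i = 1\<^sub>m 1" using eqs(3)[OF i] const[of i] True e1 by (simp add: e_def)
        then have "(1\<^sub>m 1 + T i * Q i) $$ (0, 0) = 1\<^sub>m 1 $$ (0, 0)" by simp
        then have "(T i * Q i) $$ (0, 0) = 0" using True by simp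
        then show ?thesis using True by (intro eq_matI) auto
      qed (intro mat_no_rows, auto)
      finally show "1\<^sub>m (dimv Y i) = (0\<^sub>m (dimv Y i) (dimv Y i) :: 'k mat)"
        unfolding eqs(2)[OF i] by (simp add: mat_zeroL mat_zeroR)
    qed
    then show ?thesis by (simp add: is_zero_def)
  qed
qed

text \<open>By \<open>interval_vanish_iff\<close> this is the right perpendicular category of the
  interval modules in \<open>S\<close>; left perpendicular categories are brought to this form by
  \<open>dual\<close>.\<close>

definition chord_perp :: "nat \<Rightarrow> (nat \<times> nat) set \<Rightarrow> 'k::field qrep set" where
  "chord_perp n S = {Y. is_rep n Y \<and> (\<forall>(c, d)\<in>S. path_bij n Y c d)}"

lemma path_bij_refl: "path_bij n Y a a"
  by (rule path_bijI[of "1\<^sub>m (xdim n Y a)"]) auto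

lemma path_bij_trans:
  assumes r: "is_rep n Y" and abc: "1 \<le> a" "a \<le> b" "b \<le> c" and "path_bij n Y a b" "path_bij n Y b c"
  shows "path_bij n Y a c"
proof -
  obtain B where B: "dim_row B = xdim n Y a" "dim_col B = xdim n Y b"
    "B * path n Y a b = 1\<^sub>m (xdim n Y a)" "path n Y a b * B = 1\<^sub>m (xdim n Y b)" by (rule path_bijE[OF assms(5)])
  obtain C where C: "dim_row C = xdim n Y b" "dim_col C = xdim n Y c"
    "C * path n Y b c = 1\<^sub>m (xdim n Y b)" "path n Y b c * C = 1\<^sub>m (xdim n Y c)" by (rule path_bijE[OF assms(6)])
  note [simp] = path_dim[OF r abc(1,2)] path_dim[OF r order_trans[OF abc(1,2)] abc(3)] B(1,2) C(1,2)
  show ?thesis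
  proof (rule path_bijI[of "B * C"]; (unfold path_comp[OF r abc, symmetric])?)
    have "(B * C) * (path n Y b c * path n Y a b) = B * ((C * path n Y b c) * path n Y a b)"
        by (simp add: mat_assoc)
    then show "(B * C) * (path n Y b c * path n Y a b) = 1\<^sub>m (xdim n Y a)" by (simp add: B C mat_oneL)
    have "(path n Y b c * path n Y a b) * (B * C) = path n Y b c * ((path n Y a b * B) * C)"
        by (simp add: mat_assoc)
    then show "(path n Y b c * path n Y a b) * (B * C) = 1\<^sub>m (xdim n Y c)" by (simp add: B C mat_oneL)
  qed auto
qed

lemma path_bij_cancel:
  assumes r: "is_rep n Y" and abc: "1 \<le> a" "a \<le> b" "b \<le> c" and "path_bij n Y a c" "path_bij n Y b c"
  shows "path_bij n Y a b"
proof -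
  obtain B where B: "dim_row B = xdim n Y a" "dim_col B = xdim n Y c"
    "B * path n Y a c = 1\<^sub>m (xdim n Y a)" "path n Y a c * B = 1\<^sub>m (xdim n Y c)" by (rule path_bijE[OF assms(5)])
  obtain C where C: "dim_row C = xdim n Y b" "dim_col C = xdim n Y c"
    "C * path n Y b c = 1\<^sub>m (xdim n Y b)" "path n Y b c * C = 1\<^sub>m (xdim n Y c)" by (rule path_bijE[OF assms(6)])
  note [simp] = path_dim[OF r abc(1,2)] path_dim[OF r order_trans[OF abc(1,2)] abc(3)] B(1,2) C(1,2)
  note pc = path_comp[OF r abc]
  show ?thesis
  proof (rule path_bijI[of "B * path n Y b c"])
    show "(B * path n Y b c) * path n Y a b = 1\<^sub>m (xdim n Y a)" by (simp add: mat_assoc pc B)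
    have "path n Y a b * (B * path n Y b c) = (C * path n Y b c) * (path n Y a b * (B * path n Y b c))"
      by (simp add: C mat_oneL)
    also have "\<dots> = C * (((path n Y b c * path n Y a b) * B) * path n Y b c)" by (simp add: mat_assoc)
    finally show "path n Y a b * (B * path n Y b c) = 1\<^sub>m (xdim n Y b)" by (simp add: pc B C mat_oneL)
  qed auto
qed

lemma path_bij_end: "path_bij n Y a (Suc n) \<Longrightarrow> is_rep n Y \<Longrightarrow> 1 \<le> a \<Longrightarrow> a \<le> n \<Longrightarrow> dimv Y a = 0"
proof (elim path_bijE)
  fix B assume r: "is_rep n Y" and a: "1 \<le> a" "a \<le> n" and B: "dim_row B = xdim n Y a"
      "dim_col B = xdim n Y (Suc n)"
    "B * path n Y a (Suc n) = 1\<^sub>m (xdim n Y a)"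
  then have "1\<^sub>m (dimv Y a) = (0\<^sub>m (dimv Y a) (dimv Y a) :: 'a mat)"
    using mult_through_zero[of B "path n Y a (Suc n)"] path_dim[OF r a(1), of "Suc n"] by simp
  then show "dimv Y a = 0" by (rule one_mat_eq_zero)
qed

section \<open>Relatively projective interval modules\<close>

lemma chord_perpD:
  "Y \<in> chord_perp n S \<Longrightarrow> is_rep n Y" "Y \<in> chord_perp n S \<Longrightarrow> (c, d) \<in> S \<Longrightarrow> path_bij n Y c d"
  by (auto simp: chord_perp_def)

lemma isomorphic_chord_perp:
  assumes "isomorphic n X Y" "\<And>c d. (c, d) \<in> S \<Longrightarrow> 1 \<le> c \<and> c < d \<and> d \<le> Suc n" "X \<in> chord_perp n S"
  shows "Y \<in> chord_perp n S"
  using assms isomorphic_path_bij[OF assms(1)] unfolding chord_perp_def isomorphic_def by blast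

text \<open>The cokernel of a morphism between objects of \<open>chord_perp n S\<close> lies in \<open>chord_perp n S\<close> again.\<close>

lemma epi_in_chord_perp_splits:
  assumes S: "\<And>c d. (c, d) \<in> S \<Longrightarrow> 1 \<le> c \<and> c < d \<and> d \<le> Suc n"
    and X: "X \<in> chord_perp n S" and Y: "Y \<in> chord_perp n S" and epi: "is_epi_in n (chord_perp n S) X Y g"
    and i: "i \<in> {1..n}"
  obtains r where "dim_row r = dimv X i" "dim_col r = dimv Y i" "g i * r = 1\<^sub>m (dimv Y i)"
proof -
  note rX = chord_perpD(1)[OF X] and rY = chord_perpD(1)[OF Y]
  have gH: "g \<in> Hom n X Y" and cancel: "\<And>W u v. W \<in> chord_perp n S \<Longrightarrow> u \<in> Hom n Y W \<Longrightarrow> v \<in> Hom n Y W \<Longrightarrow>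
      comp_hom n u g = comp_hom n v g \<Longrightarrow> u = v"
    using epi unfolding is_epi_in_def by blast+
  have g: "morphism n X Y g" using gH by (simp add: Hom_iff)
  have "\<exists>w u t r. u \<in> carrier_mat w (dimv Y i) \<and> t \<in> carrier_mat (dimv Y i) w \<and>
      r \<in> carrier_mat (dimv X i) (dimv Y i) \<and>
    u * g i = 0\<^sub>m w (dimv X i) \<and> u * t = 1\<^sub>m w \<and> t * u + g i * r = 1\<^sub>m (dimv Y i)" if i: "i \<in> {1..n}" for i
  proof -
    have "g i \<in> carrier_mat (dimv Y i) (dimv X i)" using g i by (auto simp: morphism_def)
    then show ?thesis by (rule cokernel_exists) blast
  qed
  then obtain w u t r where c: "\<And>i. i \<in> {1..n} \<Longrightarrow> u i \<in> carrier_mat (w i) (dimv Y i) \<and>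
      t i \<in> carrier_mat (dimv Y i) (w i) \<and>
    r i \<in> carrier_mat (dimv X i) (dimv Y i) \<and>
    u i * g i = 0\<^sub>m (w i) (dimv X i) \<and> u i * t i = 1\<^sub>m (w i) \<and> t i * u i + g i * r i = 1\<^sub>m (dimv Y i)"
    by metis
  have d: "dim_row (u i) = w i" "dim_col (u i) = dimv Y i" "dim_row (t i) = dimv Y i" "dim_col (t i) = w i"
    "dim_row (r i) = dimv X i" "dim_col (r i) = dimv Y i" "dim_row (g i) = dimv Y i" "dim_col (g i) = dimv X i"
    and e: "u i * g i = 0\<^sub>m (w i) (dimv X i)" "u i * t i = 1\<^sub>m (w i)" "t i * u i + g i * r i = 1\<^sub>m (dimv Y i)"
    if "i \<in> {1..n}" for i
    using c[OF that] morphism_dim[OF g that] by auto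
  define W where "W = QRep w (\<lambda>i. u (Suc i) * (arr Y i * t i))"
  have Wd: "dimv W i = w i" for i by (simp add: W_def)
  have rW: "is_rep n W" unfolding is_rep_def using d by (intro ballI carrier_matI) (auto simp: W_def)
  have u: "morphism n Y W u"
  proof (rule morphismI)
    fix i assume i: "i \<in> {1..<n}"
    then have i': "i \<in> {1..n}" "Suc i \<in> {1..n}" by auto
    note [simp] = d[OF i'(1)] d[OF i'(2)] rep_dim[OF rX i] rep_dim[OF rY i]
    have aW: "arr W i = u (Suc i) * (arr Y i * t i)" by (simp add: W_def)
    have "u (Suc i) * arr Y i = (u (Suc i) * arr Y i) * (t i * u i + g i * r i)"
      by (simp add: e[OF i'(1)] mat_oneR)
    also have "\<dots> = arr W i * u i + u (Suc i) * ((arr Y i * g i) * r i)"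
      by (simp add: aW mat_ring)
    also have "u (Suc i) * ((arr Y i * g i) * r i) = (u (Suc i) * g (Suc i)) * (arr X i * r i)"
      unfolding morphism_comm[OF g i, symmetric] by (simp add: mat_assoc)
    finally show "u (Suc i) * arr Y i = arr W i * u i" by (simp add: e[OF i'(2)] aW mat_ring)
  qed (simp_all add: d Wd)
  have "path_bij n W p q" if pq: "(p, q) \<in> S" for p q
  proof -
    have p: "1 \<le> p" and pq': "p \<le> q" and q: "1 \<le> q" "q \<le> Suc n" using S[OF pq] by auto
    obtain A where A: "dim_row A = xdim n X p" "dim_col A = xdim n X q"
      "A * path n X p q = 1\<^sub>m (xdim n X p)" "path n X p q * A = 1\<^sub>m (xdim n X q)"
      by (rule path_bijE[OF chord_perpD(2)[OF X pq]])
    obtain B where B: "dim_row B = xdim n Y p" "dim_col B = xdim n Y q"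
      "B * path n Y p q = 1\<^sub>m (xdim n Y p)" "path n Y p q * B = 1\<^sub>m (xdim n Y q)"
      by (rule path_bijE[OF chord_perpD(2)[OF Y pq]])
    let ?g = "xmap n g" and ?u = "xmap n u" and ?t = "xmap n t" and ?r = "xmap n r"
    have dx: "dim_row (?t i) = xdim n Y i" "dim_col (?t i) = xdim n W i" "dim_row (?r i) = xdim n X i"
      "dim_col (?r i) = xdim n Y i" if "1 \<le> i" for i
      using d[of i] that by (auto simp: xmap_def xdim_def Wd)
    have ex: "?u i * ?g i = 0\<^sub>m (xdim n W i) (xdim n X i)" "?u i * ?t i = 1\<^sub>m (xdim n W i)"
      "?t i * ?u i + ?g i * ?r i = 1\<^sub>m (xdim n Y i)" if "1 \<le> i" for i
      using e[of i] that by (auto simp: xmap_def xdim_def Wd)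
    note [simp] = dx[OF p] dx[OF q(1)] xmap_dim[OF g p] xmap_dim[OF g q(1)] xmap_dim[OF u p] xmap_dim[OF u q(1)]
      A(1,2) B(1,2) path_dim[OF rX p pq'] path_dim[OF rY p pq'] path_dim[OF rW p pq']
    note nu = path_natural[OF rY rW u p pq' q(2)] and ng = path_natural[OF rX rY g p pq' q(2)]
    \<comment> \<open>The inverses \<open>A\<close> and \<open>B\<close> of the two paths are
      compatible with \<open>g\<close>, so \<open>B\<close> induces a map between the cokernels,
      which inverts the path of \<open>W\<close>.\<close>
    have Bg: "B * ?g q = ?g p * A"
    proof -
      have "B * ?g q = B * ((?g q * path n X p q) * A)" by (simp add: mat_assoc A mat_oneR)
      also have "\<dots> = (B * path n Y p q) * (?g p * A)" unfolding ng by (simp add: mat_assoc)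
      finally show ?thesis by (simp add: B mat_oneL)
    qed
    show ?thesis
    proof (rule path_bijI[of "?u p * (B * ?t q)"])
      let ?E = "(?t q * ?u q + ?g q * ?r q) * path n Y p q"
      have "?u p * (B * ?E) = ?u p * (B * (?t q * (?u q * path n Y p q))) + (?u p * (B * ?g q))
          * (?r q * path n Y p q)"
        by (simp add: mat_ring)
      also have "?u p * (B * ?g q) = (?u p * ?g p) * A" unfolding Bg by (simp add: mat_assoc)
      also have "?u p * (B * (?t q * (?u q * path n Y p q))) + (?u p * ?g p) * A * (?r q * path n Y p q) =
          ?u p * (B * (?t q * (path n W p q * ?u p)))"
        by (simp add: ex(1)[OF p] nu mat_ring)
      also have "?u p * (B * ?E) = ?u p" by (simp add: ex(3)[OF q(1)] mat_oneL B mat_oneR)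
      finally have inv: "?u p * (B * (?t q * (path n W p q * ?u p))) = ?u p" by (rule sym)
      have "((?u p * (B * ?t q)) * path n W p q) * (?u p * ?t p) =
          (?u p * (B * (?t q * (path n W p q * ?u p)))) * ?t p"
        by (simp add: mat_assoc)
      also have "\<dots> = ?u p * ?t p" unfolding inv ..
      finally have "((?u p * (B * ?t q)) * path n W p q) * (?u p * ?t p) = ?u p * ?t p" .
      then show "(?u p * (B * ?t q)) * path n W p q = 1\<^sub>m (xdim n W p)"
        by (simp add: ex(2)[OF p] mat_oneR)
      have "path n W p q * (?u p * (B * ?t q)) = (path n W p q * ?u p) * (B * ?t q)" by (simp add: mat_assoc)
      also have "\<dots> = ?u q * ((path n Y p q * B) * ?t q)" unfolding nu[symmetric] by (simp add: mat_assoc)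
      finally show "path n W p q * (?u p * (B * ?t q)) = 1\<^sub>m (xdim n W q)"
        by (simp add: B mat_oneL ex(2)[OF q(1)])
    qed auto
  qed
  then have W: "W \<in> chord_perp n S" using rW by (auto simp: chord_perp_def)
  have zH: "zero_hom n Y W \<in> Hom n Y W"
    unfolding zero_hom_def by (rule restrict_in_Hom[OF morphism_zero[OF rY rW]])
  \<comment> \<open>The cokernel projection and the zero map agree after \<open>g\<close>. As
    \<open>W\<close> belongs to the category, they are equal, and the decomposition of the identity
    at \<open>i\<close> reduces to \<open>g i * r i\<close>.\<close>
  have "comp_hom n (restrict u {1..n}) g = comp_hom n (zero_hom n Y W) g"
    unfolding comp_hom_def by (rule restrict_ext) (simp add: e d zero_hom_def mat_zeroL Wd)
  then have "restrict u {1..n} = zero_hom n Y W" by (rule cancel[OF W restrict_in_Hom[OF u] zH])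
  then have "restrict u {1..n} i = zero_hom n Y W i" by (rule fun_cong)
  then have "u i = 0\<^sub>m (w i) (dimv Y i)" using i by (simp add: zero_hom_def Wd)
  then have "1\<^sub>m (dimv Y i) = t i * 0\<^sub>m (w i) (dimv Y i) + g i * r i" using e(3)[OF i] by simp
  then have "g i * r i = 1\<^sub>m (dimv Y i)" using d[OF i] by (simp add: mat_ring)
  then show ?thesis using that[of "r i"] d[OF i] by simp
qed

lemma projective_in_isomorphic:
  assumes iso: "isomorphic n P P'" and P': "P' \<in> C" and C: "\<And>X. X \<in> C \<Longrightarrow> is_rep n X"
    and proj: "projective_in n C P"
  shows "projective_in n C P'"
  unfolding projective_in_def
proof (intro conjI P' ballI allI impI)
  fix X Y g h assume X: "X \<in> C" and Y: "Y \<in> C" and g: "is_epi_in n C X Y g" and h: "h \<in> Hom n P' Y"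
  obtain f where "is_rep n P" "is_rep n P'" "is_iso n P P' f" using iso by (auto simp: isomorphic_def)
  then obtain f' where r: "is_rep n P" "is_rep n P'" and f: "f \<in> Hom n P P'" "f' \<in> Hom n P' P"
    and e: "comp_hom n f f' = id_hom n P'"
    by (auto simp: is_iso_def)
  have gH: "g \<in> Hom n X Y" using g by (simp add: is_epi_in_def)
  have hf: "comp_hom n h f \<in> Hom n P Y" by (rule comp_hom_in_Hom[OF r C[OF Y] f(1) h])
  obtain k where k: "k \<in> Hom n P X" "comp_hom n g k = comp_hom n h f"
    using proj X Y g hf unfolding projective_in_def by blast
  have "comp_hom n g (comp_hom n k f') = h"
    using comp_hom_assoc[OF f(2) k(1) gH] comp_hom_assoc[OF f(2) f(1) h] k(2) e comp_id_hom(1)[OF h] by simp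
  then show "\<exists>k\<in>Hom n P' X. comp_hom n g k = h"
    using comp_hom_in_Hom[OF r(2,1) C[OF X] f(2) k(1)] by blast
qed

section \<open>Following chords upwards, and projective interval modules\<close>

inductive_set reach :: "(nat \<times> nat) set \<Rightarrow> nat \<Rightarrow> nat set" for S b where
  reach_base: "b \<in> reach S b"
| reach_step: "m \<in> reach S b \<Longrightarrow> (m, m') \<in> S \<Longrightarrow> m' \<in> reach S b"

text \<open>A chord that enters the stretch from \<open>b\<close> to \<open>m\<close> from below, or
  leaves it upwards, does so at a reached vertex: otherwise its end there would lie strictly between
  two consecutive vertices of the chain from \<open>b\<close> to \<open>m\<close>, and it would
  cross that step.\<close>

lemma reach_closed:
  assumes S: "\<And>c d. (c, d) \<in> S \<Longrightarrow> c < d"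
    and nc: "\<And>p q r s. (p, q) \<in> S \<Longrightarrow> (r, s) \<in> S \<Longrightarrow> \<not> (p < r \<and> r < q \<and> q < s)"
    and "m \<in> reach S b"
  shows "b \<le> m \<and> (\<forall>c d. (c, d) \<in> S \<longrightarrow> b \<le> c \<longrightarrow> c \<le> m \<longrightarrow> m < d \<longrightarrow> c \<in> reach S b) \<and>
    (\<forall>c d. (c, d) \<in> S \<longrightarrow> c < b \<longrightarrow> b \<le> d \<longrightarrow> d \<le> m \<longrightarrow> d \<in> reach S b)"
  using assms(3)
proof induction
  case reach_base
  show ?case by (auto simp: reach.reach_base dest: le_antisym)
next
  case (reach_step m m')
  have m: "m < m'" "m' \<in> reach S b" using S reach_step reach.reach_step by blast+
  have "c \<in> reach S b" if cd: "(c, d) \<in> S" "b \<le> c" "c \<le> m'" "m' < d" for c d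
  proof -
    have "\<not> (m < c \<and> c < m')" using nc[OF reach_step(2) cd(1)] cd by auto
    then consider "c \<le> m" | "c = m'" using cd by linarith
    then show ?thesis using cd m reach_step.IH by cases auto
  qed
  moreover have "d \<in> reach S b" if cd: "(c, d) \<in> S" "c < b" "b \<le> d" "d \<le> m'" for c d
  proof -
    have "\<not> (m < d \<and> d < m')" using nc[OF cd(1) reach_step(2)] cd reach_step.IH by auto
    then consider "d \<le> m" | "d = m'" using cd by linarith
    then show ?thesis using cd m reach_step.IH by cases auto
  qed
  ultimately show ?case using m reach_step.IH by auto
qed

lemma reach_path_bij:
  assumes S: "\<And>c d. (c, d) \<in> S \<Longrightarrow> 1 \<le> c \<and> c < d \<and> d \<le> Suc n" and b: "1 \<le> b" "b \<le> Suc n"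
    and Y: "Y \<in> chord_perp n S" and "m \<in> reach S b"
  shows "b \<le> m \<and> m \<le> Suc n \<and> path_bij n Y b m"
  using assms(5)
proof induction
  case reach_base
  then show ?case using b by (simp add: path_bij_refl)
next
  case (reach_step m m')
  then show ?case
    using S[OF reach_step(2)] path_bij_trans[OF chord_perpD(1)[OF Y] b(1),
        of m m'] chord_perpD(2)[OF Y reach_step(2)]
    by auto
qed

lemma projective_in_interval:
  fixes S :: "(nat \<times> nat) set" and a b n :: nat
  assumes S: "\<And>c d. (c, d) \<in> S \<Longrightarrow> 1 \<le> c \<and> c < d \<and> d \<le> Suc n"
    and nc: "\<And>p q r s. (p, q) \<in> S \<Longrightarrow> (r, s) \<in> S \<Longrightarrow> \<not> (p < r \<and> r < q \<and> q < s)"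
    and ab: "1 \<le> a" "a < b" "b \<le> Suc n"
    and perp: "\<And>c d. (c, d) \<in> S \<Longrightarrow> c \<in> {a..<b} \<longleftrightarrow> d \<in> {a..<b}"
  shows "projective_in n (chord_perp n S) (interval a b :: 'k::field qrep) \<longleftrightarrow>
    \<not> (\<exists>l\<in>{1..Suc n}. b < l \<and> (\<forall>(c, d)\<in>S. c \<in> {b..<l} \<longleftrightarrow> d \<in> {b..<l}))"
proof
  let ?C = "chord_perp n S :: 'k qrep set"
  have mem: "interval p q \<in> ?C" if "1 \<le> p" "p < q" "q \<le> Suc n" "\<And>c d. (c, d) \<in> S \<Longrightarrow>
      c \<in> {p..<q} \<longleftrightarrow> d \<in> {p..<q}" for p q
  proof -
    have "path_bij n (interval p q :: 'k qrep) c d" if "(c, d) \<in> S" for c d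
      using path_bij_interval[OF \<open>1 \<le> p\<close> \<open>p < q\<close> \<open>q \<le> Suc n\<close>, of c d] S[OF that] \<open>\<And>c d. (c, d) \<in> S \<Longrightarrow>
          c \<in> {p..<q} \<longleftrightarrow> d \<in> {p..<q}\<close>[OF that]
      by blast
    then show ?thesis using is_rep_interval unfolding chord_perp_def by blast
  qed
  let ?M = "interval a b :: 'k qrep"
  have M: "?M \<in> ?C" using ab perp by (rule mem)
  have an: "a \<in> {1..n}" using ab by auto
  {
    assume proj: "projective_in n ?C ?M"
    show "\<not> (\<exists>l\<in>{1..Suc n}. b < l \<and> (\<forall>(c, d)\<in>S. c \<in> {b..<l} \<longleftrightarrow> d \<in> {b..<l}))"
    proof
      assume "\<exists>l\<in>{1..Suc n}. b < l \<and> (\<forall>(c, d)\<in>S. c \<in> {b..<l} \<longleftrightarrow> d \<in> {b..<l})"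
      then obtain l where l: "b < l" "l \<le> Suc n" "\<And>c d. (c, d) \<in> S \<Longrightarrow> c \<in> {b..<l} \<longleftrightarrow> d \<in> {b..<l}"
        by fastforce
      let ?X = "interval a l :: 'k qrep"
      have al: "1 \<le> a" "a < l" "l \<le> Suc n" using ab l by auto
      have X: "?X \<in> ?C"
      proof (rule mem[OF al])
        fix c d assume "(c, d) \<in> S"
        then show "c \<in> {a..<l} \<longleftrightarrow> d \<in> {a..<l}" using perp[of c d] l(3)[of c d] ab l(1) by auto
      qed
      have x1: "1\<^sub>m 1 \<in> carrier_mat (xdim n ?M a) 1" using ab by auto
      have "path n ?M a l * 1\<^sub>m 1 = 0\<^sub>m (xdim n ?M l) 1"
        using path_dim[OF is_rep_interval al(1), of l n a b, where ?'a = 'k] ab l al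
        by (intro mat_no_rows) (auto simp: xdim_interval)
      note g = morphism_from_interval[OF is_rep_interval al x1 this]
      let ?g = "restrict (from_interval n ?M a l (1\<^sub>m 1)) {1..n}"
      have g1: "?g i = 1\<^sub>m 1" if "a \<le> i" "i < b" for i
        using that ab l path_interval[of a a i b n, where ?'a = 'k] by (simp add: from_interval_def mat_oneL)
      have gH: "?g \<in> Hom n ?X ?M" by (rule restrict_in_Hom[OF g])
      have "is_epi_in n ?C ?X ?M ?g"
        unfolding is_epi_in_def
      proof (intro conjI gH ballI impI)
        fix W u v assume uv: "u \<in> Hom n ?M W" "v \<in> Hom n ?M W" and e: "comp_hom n u ?g = comp_hom n v ?g"
        show "u = v"
        proof (rule Hom_eqI[OF uv])
          fix i assume i: "i \<in> {1..n}"
          have d: "dim_row (u i) = dimv W i" "dim_col (u i) = dimv ?M i" "dim_row (v i) = dimv W i"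
              "dim_col (v i) = dimv ?M i"
            using uv i by (auto simp: Hom_iff dest!: morphism_dim)
          show "u i = v i"
          proof (cases "a \<le> i \<and> i < b")
            case True
            then have "u i * 1\<^sub>m 1 = v i * 1\<^sub>m 1"
              using fun_cong[OF e, of i] i g1[of i] by (simp add: comp_hom_def)
            then show ?thesis using d True by (simp add: mat_oneR)
          next
            case False
            then show ?thesis using d by (intro mat_no_cols) auto
          qed
        qed
      qed
      then obtain k where k: "k \<in> Hom n ?M ?X" "comp_hom n ?g k = id_hom n ?M"
        using proj X M id_hom_in_Hom[OF is_rep_interval] unfolding projective_in_def by blast
      then have km: "morphism n ?M ?X k" by (simp add: Hom_iff)
      \<comment> \<open>A section would send the generator at \<open>a\<close> to an element that
        dies at \<open>b\<close>. But \<open>?X\<close> continues beyond \<open>b\<close>, so this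
        element is zero and cannot be mapped back to the generator.\<close>
      have "path n ?X a b = 1\<^sub>m 1" using ab l by (intro path_interval) auto
      then have ka: "k a = 0\<^sub>m 1 1"
        using morphism_from_interval_eq(2,3)[OF is_rep_interval ab km] ab l by (simp add: xdim_interval
            mat_oneL)
      have "?g a * k a = 1\<^sub>m 1"
        using fun_cong[OF k(2), of a] an ab by (simp add: comp_hom_def id_hom_def)
      then have "1\<^sub>m 1 = (0\<^sub>m 1 1 :: 'k mat)" using g1[of a] ab unfolding ka by (simp add: mat_oneL)
      then show False using one_mat_eq_zero by force
    qed
  }
  assume nl: "\<not> (\<exists>l\<in>{1..Suc n}. b < l \<and> (\<forall>(c, d)\<in>S. c \<in> {b..<l} \<longleftrightarrow> d \<in> {b..<l}))"
  have S': "c < d" if "(c, d) \<in> S" for c d using S that by blast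
  have R: "b \<le> m \<and> m \<le> Suc n" if "m \<in> reach S b" for m
    using that by induction (use S ab in fastforce)+
  \<comment> \<open>Let \<open>m\<close> be the greatest reached vertex. If
    \<open>m \<le> n\<close>, then \<open>m + 1\<close> is not a witness, so some chord has exactly
    one end in \<open>{b..m}\<close>. It cannot leave at the top, since its upper end would then be
    reached; so it comes from below and ends at a reached vertex. Its upper end lies outside
    \<open>{a..<b}\<close>, hence so does its lower end.\<close>
  have cases: "Suc n \<in> reach S b \<or> (\<exists>c d. (c, d) \<in> S \<and> c < a \<and> d \<in> reach S b)"
  proof -
    define m where "m = Max (reach S b)"
    have fin: "finite (reach S b)" by (rule finite_subset[of _ "{..Suc n}"]) (use R in auto)
    have m: "m \<in> reach S b" unfolding m_def using fin reach_base by (intro Max_in) auto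
    have mx: "x \<le> m" if "x \<in> reach S b" for x unfolding m_def using fin that by simp
    note cl = reach_closed[OF S' nc m]
    show ?thesis
    proof (cases "m = Suc n")
      case False
      then have "Suc m \<in> {1..Suc n}" "b < Suc m" using R[OF m] by auto
      then obtain c d where cd: "(c, d) \<in> S" "\<not> (c \<in> {b..<Suc m} \<longleftrightarrow> d \<in> {b..<Suc m})" using nl by blast
      have "\<not> (b \<le> c \<and> c \<le> m \<and> m < d)"
      proof
        assume "b \<le> c \<and> c \<le> m \<and> m < d"
        then have "d \<in> reach S b" using cl cd(1) reach_step by blast
        then show False using mx[of d] \<open>b \<le> c \<and> c \<le> m \<and> m < d\<close> by simp
      qed
      then have *: "c < b" "b \<le> d" "d \<le> m" using cd S'[OF cd(1)] by auto
      then have "d \<in> reach S b" using cl cd(1) by blast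
      moreover have "c < a" using perp[OF cd(1)] * by auto
      ultimately show ?thesis using cd(1) by blast
    qed (use m in auto)
  qed
  show "projective_in n ?C ?M"
    unfolding projective_in_def
  proof (intro conjI M ballI allI impI)
    fix X Y :: "'k qrep" and g h
    assume X: "X \<in> ?C" and Y: "Y \<in> ?C" and epi: "is_epi_in n ?C X Y g" and hH: "h \<in> Hom n ?M Y"
    note rX = chord_perpD(1)[OF X] and rY = chord_perpD(1)[OF Y]
    have gH: "g \<in> Hom n X Y" using epi by (simp add: is_epi_in_def)
    have g: "morphism n X Y g" and h: "morphism n ?M Y h" using gH hH by (simp_all add: Hom_iff)
    obtain r where r: "dim_row r = dimv X a" "dim_col r = dimv Y a" "g a * r = 1\<^sub>m (dimv Y a)"
      by (rule epi_in_chord_perp_splits[OF S X Y epi an])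
    note hy = morphism_from_interval_eq[OF rY ab h]
    have han [simp]: "a \<le> n" using an by simp
    have ya: "dim_row (h a) = dimv Y a" "dim_col (h a) = 1" using hy(2) by auto
    define x0 where "x0 = r * h a"
    have x0: "dim_row x0 = dimv X a" "dim_col x0 = 1" using r ya by (auto simp: x0_def)
    note [simp] = morphism_dim[OF g an] r(1,2) ya x0
    have gx0: "g a * x0 = h a"
      using mat_assoc[of "g a" r "h a"] r by (simp add: x0_def mat_oneL)
    have ab': "a \<le> b" using ab by simp
    note [simp] = path_dim[OF rX ab(1) ab'] path_dim[OF rY ab(1) ab']
    \<comment> \<open>A lift of \<open>h\<close> amounts to a preimage of \<open>h a\<close> under
      \<open>g a\<close> that dies at \<open>b\<close>. So far \<open>x0\<close> is just some
      preimage.\<close>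
    have "\<exists>x. dim_row x = dimv X a \<and> dim_col x = 1 \<and> g a * x = h a \<and> path n X a b * x = 0\<^sub>m (xdim n X b) 1"
    proof (cases "Suc n \<in> reach S b")
      case True
      have "xdim n X b = 0"
        using reach_path_bij[OF S _ ab(3) X True] ab path_bij_end[of n X b] rX by (cases "b \<le> n") auto
      then have "path n X a b * x0 = 0\<^sub>m (xdim n X b) 1" by (intro mat_no_rows) auto
      then show ?thesis using gx0 x0 by blast
    next
      case False
      then obtain c d where cd: "(c, d) \<in> S" "c < a" "d \<in> reach S b" using cases by blast
      have b1: "1 \<le> b" and c1: "1 \<le> c" using ab S[OF cd(1)] by auto
      have ca: "c \<le> a" and cb: "c \<le> b" and bd: "b \<le> d" using cd ab R[OF cd(3)] by auto
      have bc: "path_bij n Z c b" if "Z \<in> ?C" for Z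
        using path_bij_cancel[OF chord_perpD(1)[OF that] c1 cb bd chord_perpD(2)[OF that cd(1)]]
          reach_path_bij[OF S b1 ab(3) that cd(3)] by blast
      obtain A where A: "dim_row A = xdim n X c" "dim_col A = xdim n X b" "path n X c b * A = 1\<^sub>m (xdim n X b)"
        by (rule path_bijE[OF bc[OF X]])
      obtain B where B: "dim_row B = xdim n Y c" "dim_col B = xdim n Y b" "B * path n Y c b = 1\<^sub>m (xdim n Y c)"
        by (rule path_bijE[OF bc[OF Y]])
      let ?g = "xmap n g"
      note [simp] = A(1,2) B(1,2) xmap_dim[OF g c1] xmap_dim[OF g b1]
        path_dim[OF rX c1 ca] path_dim[OF rY c1 ca] path_dim[OF rX c1 cb] path_dim[OF rY c1 cb]
      define z where "z = A * (path n X a b * x0)"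
      have zd [simp]: "dim_row z = xdim n X c" "dim_col z = 1" by (auto simp: z_def)
      have z: "path n X c b * z = path n X a b * x0"
        using mat_assoc[of "path n X c b" A "path n X a b * x0"] by (simp add: z_def A mat_oneL)
      have "path n Y c b * (?g c * z) = (path n Y c b * ?g c) * z" by (simp add: mat_assoc)
      also have "\<dots> = ?g b * (path n X c b * z)"
        unfolding path_natural[OF rX rY g c1 cb ab(3), symmetric] by (simp add: mat_assoc)
      also have "\<dots> = (?g b * path n X a b) * x0" unfolding z by (simp add: mat_assoc)
      also have "\<dots> = path n Y a b * (g a * x0)"
        unfolding path_natural[OF rX rY g ab(1) ab' ab(3)] by (simp add: mat_assoc)
      also have "\<dots> = 0\<^sub>m (xdim n Y b) 1" unfolding gx0 by (rule hy(3))
      finally have gz: "?g c * z = 0\<^sub>m (xdim n Y c) 1"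
        using mat_assoc[of B "path n Y c b" "?g c * z"] by (simp add: B(3) mat_oneL mat_zeroR)
      \<comment> \<open>\<open>z\<close> is the element over \<open>c\<close> with the same image at
        \<open>b\<close> as \<open>x0\<close>, so subtracting its image at \<open>a\<close> makes
        \<open>x0\<close> die at \<open>b\<close>. The image under \<open>g\<close> does not change:
        by naturality \<open>?g c * z\<close> dies at \<open>b\<close>, and the path of
        \<open>Y\<close> from \<open>c\<close> to \<open>b\<close> is injective.\<close>
      let ?x = "x0 - path n X c a * z"
      have "g a * (path n X c a * z) = (?g a * path n X c a) * z" by (simp add: mat_assoc)
      also have "\<dots> = path n Y c a * (?g c * z)"
        unfolding path_natural[OF rX rY g c1 ca le_SucI[OF han]] by (simp add: mat_assoc)
      finally have "g a * (path n X c a * z) = 0\<^sub>m (dimv Y a) 1" unfolding gz by (simp add: mat_zeroR)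
      then have 1: "g a * ?x = h a" by (simp add: mat_minus_distL gx0 mat_minus_zeroR)
      have "path n X a b * (path n X c a * z) = path n X a b * x0"
        using path_comp[OF rX c1 ca ab'] z by (simp flip: mat_assoc)
      then have 2: "path n X a b * ?x = 0\<^sub>m (xdim n X b) 1"
        by (simp add: mat_minus_distL mat_minus_self)
      show ?thesis using 1 2 by (intro exI[of _ ?x]) simp
    qed
    then obtain x where x: "dim_row x = dimv X a" "dim_col x = 1" "g a * x = h a"
        "path n X a b * x = 0\<^sub>m (xdim n X b) 1"
      by blast
    have xc: "x \<in> carrier_mat (xdim n X a) 1" using x by (intro carrier_matI) auto
    note k = morphism_from_interval[OF rX ab xc x(4)]
    let ?k = "restrict (from_interval n X a b x) {1..n}"
    have kH: "?k \<in> Hom n ?M X" by (rule restrict_in_Hom[OF k])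
    have "comp_hom n g ?k = h"
    proof (rule Hom_eqI[OF comp_hom_in_Hom[OF is_rep_interval rX rY kH gH] hH])
      fix i assume i: "i \<in> {1..n}"
      note [simp] = morphism_dim[OF g i] morphism_dim[OF h i]
      show "comp_hom n g ?k i = h i"
      proof (cases "a \<le> i \<and> i < b")
        case True
        then have ai: "a \<le> i" "i \<le> n" using i by auto
        note [simp] = path_dim[OF rX ab(1) ai(1)] path_dim[OF rY ab(1) ai(1)]
        have "g i * (path n X a i * x) = (xmap n g i * path n X a i) * x" using x ai by (simp add: mat_assoc)
        also have "\<dots> = path n Y a i * (g a * x)"
          unfolding path_natural[OF rX rY g ab(1) ai(1) le_SucI[OF ai(2)]] using x by (simp add: mat_assoc)
        also have "\<dots> = h i" unfolding x(3) using hy(1)[of i] True by simp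
        finally show ?thesis using i True by (simp add: comp_hom_def from_interval_def)
      next
        case False
        then show ?thesis using i by (intro mat_no_cols) (auto simp: comp_hom_def from_interval_def)
      qed
    qed
    then show "\<exists>k\<in>Hom n ?M X. comp_hom n g k = h" using kH by blast
  qed
qed

lemma projective_in_isomorphic_interval:
  fixes S :: "(nat \<times> nat) set" and a b n :: nat and M :: "'k::field qrep"
  assumes S: "\<And>c d. (c, d) \<in> S \<Longrightarrow> 1 \<le> c \<and> c < d \<and> d \<le> Suc n"
    and nc: "\<And>p q r s. (p, q) \<in> S \<Longrightarrow> (r, s) \<in> S \<Longrightarrow> \<not> (p < r \<and> r < q \<and> q < s)"
    and ab: "1 \<le> a" "a < b" "b \<le> Suc n"
    and perp: "\<And>c d. (c, d) \<in> S \<Longrightarrow> c \<in> {a..<b} \<longleftrightarrow> d \<in> {a..<b}"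
    and iso: "isomorphic n M (interval a b)"
  shows "projective_in n (chord_perp n S) M \<longleftrightarrow>
    \<not> (\<exists>l\<in>{1..Suc n}. b < l \<and> (\<forall>(c, d)\<in>S. c \<in> {b..<l} \<longleftrightarrow> d \<in> {b..<l}))"
proof -
  have I: "(interval a b :: 'k qrep) \<in> chord_perp n S"
    using path_bij_interval[OF ab] S perp is_rep_interval unfolding chord_perp_def by blast
  have M: "M \<in> chord_perp n S"
    by (rule isomorphic_chord_perp[OF isomorphic_sym[OF iso] S I])
  have rC: "is_rep n X" if "X \<in> chord_perp n S" for X :: "'k qrep" using that by (simp add: chord_perp_def)
  have "projective_in n (chord_perp n S) M \<longleftrightarrow> projective_in n (chord_perp n S) (interval a b :: 'k qrep)"
    using projective_in_isomorphic[OF iso I rC] projective_in_isomorphic[OF isomorphic_sym[OF iso] M rC] by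
        blast
  also note projective_in_interval[OF S nc ab perp]
  finally show ?thesis .
qed

section \<open>Duality\<close>

text \<open>Dual spaces reverse the arrows, and renumbering the vertices by \<open>n + 1 - i\<close>
  restores the orientation; the arrow leaving \<open>i\<close> is then the transpose of the one
  leaving \<open>n - i\<close>.\<close>

definition dual :: "nat \<Rightarrow> 'k::field qrep \<Rightarrow> 'k qrep" where
  "dual n X = QRep (\<lambda>i. dimv X (Suc n - i)) (\<lambda>i. transpose_mat (arr X (n - i)))"

definition dual_map :: "nat \<Rightarrow> (nat \<Rightarrow> 'k::field mat) \<Rightarrow> nat \<Rightarrow> 'k mat" where
  "dual_map n f = (\<lambda>i\<in>{1..n}. transpose_mat (f (Suc n - i)))"

text \<open>\<open>dual n (dual n X)\<close> differs from \<open>X\<close>, but only in the irrelevant values outside \<open>{1..n}\<close>.\<close>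

definition agree :: "nat \<Rightarrow> 'k::field qrep \<Rightarrow> 'k qrep \<Rightarrow> bool" where
  "agree n X Y \<longleftrightarrow> (\<forall>i\<in>{1..n}. dimv X i = dimv Y i) \<and> (\<forall>i\<in>{1..<n}. arr X i = arr Y i)"

lemma mat_transpose_mult: "dim_col A = dim_row B \<Longrightarrow> transpose_mat (A * B) = transpose_mat B * transpose_mat A"
  for A B :: "'k::field mat"
  by (rule transpose_mult[of _ "dim_row A" "dim_col A" _ "dim_col B"]) auto

lemma dual_sel [simp]: "dimv (dual n X) i = dimv X (Suc n - i)"
    "arr (dual n X) i = transpose_mat (arr X (n - i))"
  by (simp_all add: dual_def)

lemma is_rep_dual: "is_rep n X \<Longrightarrow> is_rep n (dual n X)"
  unfolding is_rep_def
proof (intro ballI)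
  fix i assume X: "\<forall>i\<in>{1..<n}. arr X i \<in> carrier_mat (dimv X (Suc i)) (dimv X i)" and i: "i \<in> {1..<n}"
  have "n - i \<in> {1..<n}" and e: "Suc n - i = Suc (n - i)" "Suc n - Suc i = n - i" using i by auto
  then show "arr (dual n X) i \<in> carrier_mat (dimv (dual n X) (Suc i)) (dimv (dual n X) i)"
    using X by (auto simp: e)
qed

lemma morphism_dual:
  assumes r: "is_rep n X" "is_rep n Y" and f: "morphism n X Y f"
  shows "morphism n (dual n Y) (dual n X) (dual_map n f)"
proof (rule morphismI)
  fix i assume "i \<in> {1..n}"
  then have i: "i \<in> {1..n}" "Suc n - i \<in> {1..n}" by auto
  show "dim_row (dual_map n f i) = dimv (dual n X) i" "dim_col (dual_map n f i) = dimv (dual n Y) i"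
    using i(1) morphism_dim[OF f i(2)] by (auto simp: dual_map_def)
next
  fix i assume i: "i \<in> {1..<n}"
  define j where "j = n - i"
  have j: "j \<in> {1..<n}" "Suc n - i = Suc j" "n - i = j" using i by (auto simp: j_def)
  note d = rep_dim[OF r(1) j(1)] rep_dim[OF r(2) j(1)] morphism_dim_Suc[OF f j(1)]
  have "transpose_mat (f j) * transpose_mat (arr Y j) = transpose_mat (arr X j) * transpose_mat (f (Suc j))"
    using d by (subst (1 2) mat_transpose_mult[symmetric]) (auto simp: morphism_comm[OF f j(1)])
  then show "dual_map n f (Suc i) * arr (dual n Y) i = arr (dual n X) i * dual_map n f i"
    using i j by (simp add: dual_map_def)
qed

lemma agree_refl: "agree n X X" by (simp add: agree_def)

lemma agree_morphism: "agree n X X' \<Longrightarrow> agree n Y Y' \<Longrightarrow> morphism n X Y f \<longleftrightarrow> morphism n X' Y' f"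
  by (simp add: agree_def morphism_def)

lemma agree_Hom: "agree n X X' \<Longrightarrow> agree n Y Y' \<Longrightarrow> Hom n X Y = Hom n X' Y'"
  by (auto simp: Hom_iff agree_morphism)

lemma agree_is_rep: "agree n X Y \<Longrightarrow> is_rep n X \<longleftrightarrow> is_rep n Y"
  by (auto simp: agree_def is_rep_def)

lemma agree_dual_dual: "agree n (dual n (dual n X)) X"
  by (auto simp: agree_def)

lemma agree_isomorphic:
  assumes "agree n X Y" "is_rep n X"
  shows "isomorphic n X Y"
proof -
  have r: "is_rep n Y" using assms agree_is_rep by blast
  have m: "morphism n X Y (\<lambda>i. 1\<^sub>m (dimv X i))" "morphism n Y X (\<lambda>i. 1\<^sub>m (dimv X i))"
    using morphism_id[OF assms(2)] agree_morphism[OF agree_refl assms(1)] agree_morphism[OF assms(1)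
        agree_refl] by blast+
  show ?thesis
    by (rule isomorphicI[OF assms(2) r m]) (use assms(1) in \<open>auto simp: agree_def\<close>)
qed

lemma Hom_dual_dual [simp]:
  "Hom n (dual n (dual n X)) Y = Hom n X Y" "Hom n X (dual n (dual n Y)) = Hom n X Y"
  by (rule agree_Hom; rule agree_dual_dual agree_refl)+

lemma dual_map_Hom: "is_rep n X \<Longrightarrow> is_rep n Y \<Longrightarrow> f \<in> Hom n X Y \<Longrightarrow> dual_map n f \<in> Hom n (dual n Y) (dual n X)"
  using morphism_dual by (auto simp: Hom_iff dual_map_def)

lemma dual_map_dual_map: "f \<in> Hom n X Y \<Longrightarrow> dual_map n (dual_map n f) = f"
  by (auto simp: dual_map_def Hom_iff extensional_def fun_eq_iff restrict_def)

lemma dual_map_comp: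
  assumes f: "f \<in> Hom n X Y" and g: "g \<in> Hom n Y Z"
  shows "dual_map n (comp_hom n g f) = comp_hom n (dual_map n f) (dual_map n g)"
proof
  fix i
  show "dual_map n (comp_hom n g f) i = comp_hom n (dual_map n f) (dual_map n g) i"
  proof (cases "i \<in> {1..n}")
    case True
    then have j: "Suc n - i \<in> {1..n}" by auto
    show ?thesis
      using True j morphism_dim[of n X Y f, OF _ j] morphism_dim[of n Y Z g, OF _ j] f g
      by (simp add: dual_map_def comp_hom_def Hom_iff mat_transpose_mult)
  qed (auto simp: dual_map_def comp_hom_def)
qed

lemma no_hom_dual:
  assumes r: "is_rep n X" "is_rep n Y"
  shows "no_hom n (dual n Y) (dual n X) \<longleftrightarrow> no_hom n X Y"
proof -
  have *: "no_hom n X Y" if r: "is_rep n X" "is_rep n Y" and H: "no_hom n (dual n Y) (dual n X)"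
      for X Y :: "'a qrep"
    unfolding no_hom_def
  proof (intro allI impI ballI)
    fix f i assume f: "morphism n X Y f" and i: "i \<in> {1..n}"
    then have j: "Suc n - i \<in> {1..n}" "Suc n - (Suc n - i) = i" by auto
    have "transpose_mat (f i) = 0\<^sub>m (dimv X i) (dimv Y i)"
      using no_homD[OF H morphism_dual[OF r f] j(1)] j i by (simp add: dual_map_def)
    then have "transpose_mat (transpose_mat (f i)) = transpose_mat (0\<^sub>m (dimv X i) (dimv Y i))"
        by (rule arg_cong)
    then show "f i = 0\<^sub>m (dimv Y i) (dimv X i)" by simp
  qed
  have "no_hom n (dual n (dual n X)) (dual n (dual n Y)) \<longleftrightarrow> no_hom n X Y"
    unfolding no_hom_def agree_morphism[OF agree_dual_dual agree_dual_dual] by simp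
  then show ?thesis using *[OF r] *[OF is_rep_dual[OF r(2)] is_rep_dual[OF r(1)]] by blast
qed

lemma agree_no_ext: "agree n X X' \<Longrightarrow> agree n Y Y' \<Longrightarrow> no_ext n X Y \<longleftrightarrow> no_ext n X' Y'"
proof -
  assume a: "agree n X X'" "agree n Y Y'"
  have "(\<forall>i\<in>{1..<n}. c i \<in> carrier_mat (dimv Y (Suc i)) (dimv X i)) \<longleftrightarrow>
      (\<forall>i\<in>{1..<n}. c i \<in> carrier_mat (dimv Y' (Suc i)) (dimv X' i))"
    "(\<forall>i\<in>{1..n}. c i \<in> carrier_mat (dimv Y i) (dimv X i)) \<longleftrightarrow>
      (\<forall>i\<in>{1..n}. c i \<in> carrier_mat (dimv Y' i) (dimv X' i))"
    "(\<forall>i\<in>{1..<n}. c i = h (Suc i) * arr X i - arr Y i * h i) \<longleftrightarrow>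
      (\<forall>i\<in>{1..<n}. c i = h (Suc i) * arr X' i - arr Y' i * h i)" for c h :: "nat \<Rightarrow> 'a mat"
    by (rule ball_cong[OF refl]; use a in \<open>auto simp: agree_def\<close>)+
  then show ?thesis unfolding no_ext_def by (simp only:)
qed

text \<open>Transposition and reversal exchange the two terms of \<open>h X - Y h\<close>, hence the
  sign in \<open>?k\<close>.\<close>

lemma no_ext_dual:
  assumes r: "is_rep n X" "is_rep n Y"
  shows "no_ext n (dual n Y) (dual n X) \<longleftrightarrow> no_ext n X Y"
proof -
  have *: "no_ext n X Y" if r: "is_rep n X" "is_rep n Y" and E: "no_ext n (dual n Y) (dual n X)"
      for X Y :: "'a qrep"
  proof (rule no_extI)
    fix c :: "nat \<Rightarrow> 'a mat"
    assume c: "\<And>i. i \<in> {1..<n} \<Longrightarrow> dim_row (c i) = dimv Y (Suc i)" "\<And>i. i \<in> {1..<n} \<Longrightarrow> dim_col (c i) = dimv X i"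
    let ?c = "\<lambda>i. transpose_mat (c (n - i))"
    have e: "n - i \<in> {1..<n}" "Suc n - i = Suc (n - i)" "Suc n - Suc i = n - i" if "i \<in> {1..<n}" for i
      using that by auto
    obtain h where h: "\<And>i. i \<in> {1..n} \<Longrightarrow> dim_row (h i) = dimv (dual n X) i" "\<And>i. i \<in> {1..n} \<Longrightarrow>
        dim_col (h i) = dimv (dual n Y) i"
      "\<And>i. i \<in> {1..<n} \<Longrightarrow> ?c i = h (Suc i) * arr (dual n Y) i - arr (dual n X) i * h i"
    proof (rule no_extE[OF E, of ?c])
      fix i assume i: "i \<in> {1..<n}"
      show "dim_row (?c i) = dimv (dual n X) (Suc i)" "dim_col (?c i) = dimv (dual n Y) i"
        using c[OF e(1)[OF i]] by (simp_all add: e[OF i])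
    qed blast
    let ?k = "\<lambda>i. - transpose_mat (h (Suc n - i))"
    have "c j = ?k (Suc j) * arr X j - arr Y j * ?k j" if j: "j \<in> {1..<n}" for j
    proof -
      define i where "i = n - j"
      have i: "i \<in> {1..<n}" "n - i = j" "Suc n - j = Suc i" "Suc n - Suc j = i" using j by (auto simp: i_def)
      have i': "i \<in> {1..n}" "Suc i \<in> {1..n}" using i by auto
      have s: "Suc n - i = Suc j" "Suc n - Suc i = j" using i j by auto
      have d: "dim_row (h i) = dimv X (Suc j)" "dim_col (h i) = dimv Y (Suc j)"
          "dim_row (h (Suc i)) = dimv X j" "dim_col (h (Suc i)) = dimv Y j"
        using h(1,2)[OF i'(1)] h(1,2)[OF i'(2)] by (auto simp: s i(2))
      note [simp] = d rep_dim[OF r(1) j] rep_dim[OF r(2) j] c[OF j]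
      have "transpose_mat (c j) = h (Suc i) * transpose_mat (arr Y j) - transpose_mat (arr X j) * h i"
        using h(3)[OF i(1)] i by simp
      then have "c j = transpose_mat (h (Suc i) * transpose_mat (arr Y j) - transpose_mat (arr X j) * h i)"
        by (metis transpose_transpose)
      also have "\<dots> = transpose_mat (h (Suc i) * transpose_mat (arr Y j))
          - transpose_mat (transpose_mat (arr X j) * h i)"
        by (intro eq_matI) auto
      also have "\<dots> = arr Y j * transpose_mat (h (Suc i)) - transpose_mat (h i) * arr X j"
        by (simp add: mat_transpose_mult)
      also have "\<dots> = - transpose_mat (h i) * arr X j - arr Y j * (- transpose_mat (h (Suc i)))"
        by (intro eq_matI) (auto simp: scalar_prod_def sum_negf)
      finally show ?thesis using i by simp
    qed
    moreover have "dim_row (?k i) = dimv Y i" "dim_col (?k i) = dimv X i" if "i \<in> {1..n}" for i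
    proof -
      have "Suc n - i \<in> {1..n}" "Suc n - (Suc n - i) = i" using that by auto
      then show "dim_row (?k i) = dimv Y i" "dim_col (?k i) = dimv X i" using h(1,2)[of "Suc n - i"] by auto
    qed
    ultimately show "\<exists>h. (\<forall>i\<in>{1..n}. dim_row (h i) = dimv Y i \<and> dim_col (h i) = dimv X i) \<and>
        (\<forall>i\<in>{1..<n}. c i = h (Suc i) * arr X i - arr Y i * h i)"
      by (intro exI[of _ ?k]) blast
  qed
  show ?thesis
    using *[OF r] *[OF is_rep_dual[OF r(2)] is_rep_dual[OF r(1)]] agree_no_ext[OF agree_dual_dual
        agree_dual_dual] by blast
qed

lemma biproduct_dual:
  assumes r: "is_rep n W" "is_rep n X" "is_rep n Z" and b: "biproduct n W X Z s p t q"
  shows "biproduct n (dual n W) (dual n X) (dual n Z) (dual_map n p) (dual_map n s) (dual_map n q)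
      (dual_map n t)"
  unfolding biproduct_def
proof (intro conjI ballI)
  note m = biproduct_morphism[OF b]
  show "morphism n (dual n X) (dual n W) (dual_map n p)" "morphism n (dual n W) (dual n X) (dual_map n s)"
    "morphism n (dual n Z) (dual n W) (dual_map n q)" "morphism n (dual n W) (dual n Z) (dual_map n t)"
    by (intro morphism_dual r m)+
  fix i assume i: "i \<in> {1..n}"
  then have j: "Suc n - i \<in> {1..n}" by auto
  note [simp] = biproduct_dim[OF b j]
  have a: "transpose_mat (A + B) = transpose_mat A + transpose_mat B"
    if "dim_row A = dim_row B" "dim_col A = dim_col B" for A B :: "'a mat"
    using that by (intro eq_matI) auto
  show "dual_map n s i * dual_map n p i = 1\<^sub>m (dimv (dual n X) i)"
    "dual_map n t i * dual_map n q i = 1\<^sub>m (dimv (dual n Z) i)"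
    "dual_map n s i * dual_map n q i = 0\<^sub>m (dimv (dual n X) i) (dimv (dual n Z) i)"
    "dual_map n t i * dual_map n p i = 0\<^sub>m (dimv (dual n Z) i) (dimv (dual n X) i)"
    "dual_map n p i * dual_map n s i + dual_map n q i * dual_map n t i = 1\<^sub>m (dimv (dual n W) i)"
    using i by (simp_all add: dual_map_def biproduct_eqs[OF b j] flip: mat_transpose_mult a)
qed

text \<open>Biproducts pass to duals by exchanging inclusions and projections, so the block matrices
  of the sum need not be transposed.\<close>

lemma vanish_dual_direct_sum:
  assumes r: "\<And>X. X \<in> set Xs \<Longrightarrow> is_rep n X" "is_rep n Y"
  shows "no_hom n (dual n (direct_sum Xs)) Y \<longleftrightarrow> (\<forall>X\<in>set Xs. no_hom n (dual n X) Y)"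
    and "no_ext n (dual n (direct_sum Xs)) Y \<longleftrightarrow> (\<forall>X\<in>set Xs. no_ext n (dual n X) Y)"
proof -
  have "(no_hom n (dual n (direct_sum Xs)) Y \<longleftrightarrow> (\<forall>X\<in>set Xs. no_hom n (dual n X) Y)) \<and>
    (no_ext n (dual n (direct_sum Xs)) Y \<longleftrightarrow> (\<forall>X\<in>set Xs. no_ext n (dual n X) Y))"
    using r(1)
  proof (induction Xs)
    case Nil
    have "agree n (dual n (direct_sum [])) (direct_sum [] :: 'a qrep)"
      by (auto simp: agree_def direct_sum_def intro: mat_no_rows)
    then have "isomorphic n (dual n (direct_sum [])) (direct_sum [] :: 'a qrep)"
      by (rule agree_isomorphic[OF _ is_rep_dual[OF is_rep_direct_sum]]) simp
    then show ?case
      using vanish_direct_sum[of "[]" n Y] r(2) isomorphic_no_hom isomorphic_no_ext by fastforce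
  next
    case (Cons X Xs)
    have rX: "is_rep n X" "is_rep n (direct_sum Xs)" "is_rep n (direct_sum (X # Xs))"
      using Cons.prems by (auto intro!: is_rep_direct_sum)
    obtain s p t q where "biproduct n (direct_sum (X # Xs)) X (direct_sum Xs) s p t q"
      using biproduct_direct_sum[OF rX(1), of Xs] Cons.prems by auto
    note b = biproduct_dual[OF rX(3,1,2) this]
    note rd = is_rep_dual[OF rX(1)] is_rep_dual[OF rX(2)] is_rep_dual[OF rX(3)] r(2)
    show ?case
      unfolding biproduct_no_hom[OF rd b] biproduct_no_ext[OF rd b] using Cons by auto
  qed
  then show "no_hom n (dual n (direct_sum Xs)) Y \<longleftrightarrow> (\<forall>X\<in>set Xs. no_hom n (dual n X) Y)"
    and "no_ext n (dual n (direct_sum Xs)) Y \<longleftrightarrow> (\<forall>X\<in>set Xs. no_ext n (dual n X) Y)" by auto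
qed

lemma isomorphic_dual: "isomorphic n X Y \<Longrightarrow> isomorphic n (dual n X) (dual n Y)"
proof (elim isomorphicE)
  fix f g assume r: "is_rep n X" "is_rep n Y" and f: "morphism n X Y f" and g: "morphism n Y X g"
    and e: "\<And>i. i \<in> {1..n} \<Longrightarrow> g i * f i = 1\<^sub>m (dimv X i)" "\<And>i. i \<in> {1..n} \<Longrightarrow> f i * g i = 1\<^sub>m (dimv Y i)"
  show ?thesis
  proof (rule isomorphicI[OF is_rep_dual[OF r(1)] is_rep_dual[OF r(2)] morphism_dual[OF r(2,1)
      g] morphism_dual[OF r f]])
    fix i assume i: "i \<in> {1..n}"
    then have j: "Suc n - i \<in> {1..n}" by auto
    note [simp] = morphism_dim[OF f j] morphism_dim[OF g j]
    show "dual_map n f i * dual_map n g i = 1\<^sub>m (dimv (dual n X) i)"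
        "dual_map n g i * dual_map n f i = 1\<^sub>m (dimv (dual n Y) i)"
      using i by (simp_all add: dual_map_def e[OF j] flip: mat_transpose_mult)
  qed
qed

text \<open>The support consists of the vertices \<open>n + 1 - i\<close> with
  \<open>a \<le> i < b\<close>, so a chord end \<open>v\<close> becomes \<open>n + 2 - v\<close> and
  the two ends swap.\<close>

lemma isomorphic_dual_interval:
  assumes ab: "1 \<le> a" "a < b" "b \<le> Suc n"
  shows "isomorphic n (dual n (interval a b)) (interval (n + 2 - b) (n + 2 - a) :: 'k::field qrep)"
proof (rule agree_isomorphic[OF _ is_rep_dual[OF is_rep_interval]])
  show "agree n (dual n (interval a b)) (interval (n + 2 - b) (n + 2 - a) :: 'k qrep)"
    unfolding agree_def
  proof (intro conjI ballI)
    fix i assume i: "i \<in> {1..<n}"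
    have "a \<le> n - i \<and> n - i < b \<longleftrightarrow> n + 2 - b \<le> Suc i \<and> Suc i < n + 2 - a"
      "a \<le> Suc (n - i) \<and> Suc (n - i) < b \<longleftrightarrow> n + 2 - b \<le> i \<and> i < n + 2 - a"
      using i ab by auto
    moreover have "transpose_mat (mat r c (\<lambda>_. 1)) = (mat c r (\<lambda>_. 1) :: 'k mat)" for r c
      by (intro eq_matI) auto
    ultimately show "arr (dual n (interval a b)) i = arr (interval (n + 2 - b) (n + 2 - a) :: 'k qrep) i"
      by (simp add: interval_def)
  qed (use ab in auto)
qed

text \<open>The hypotheses express that \<open>dual\<close> matches \<open>C\<close> with
  \<open>C'\<close> without asking for \<open>dual n (dual n X) = X\<close>. The difference is
  invisible to morphisms by \<open>Hom_dual_dual\<close>, so monomorphisms and liftings can be moved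
  to the other side and back.\<close>

lemma injective_in_dual:
  assumes C: "\<And>X. X \<in> C \<longleftrightarrow> is_rep n X \<and> dual n X \<in> C'" and C': "\<And>X. X \<in> C' \<Longrightarrow> is_rep n X \<and> dual n X \<in> C"
    and I: "is_rep n I"
  shows "injective_in n C I \<longleftrightarrow> projective_in n C' (dual n I)"
proof
  have rC: "is_rep n X" if "X \<in> C" for X using C that by blast
  have rC': "is_rep n X" if "X \<in> C'" for X using C' that by blast
  {
    assume inj: "injective_in n C I"
    show "projective_in n C' (dual n I)"
      unfolding projective_in_def
    proof (intro conjI ballI allI impI)
      show "dual n I \<in> C'" using inj C unfolding injective_in_def by blast
      fix X Y g h assume X: "X \<in> C'" and Y: "Y \<in> C'" and epi: "is_epi_in n C' X Y g"
          and h: "h \<in> Hom n (dual n I) Y"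
      have g: "g \<in> Hom n X Y" using epi by (simp add: is_epi_in_def)
      have dX: "dual n X \<in> C" and dY: "dual n Y \<in> C" using C' X Y by auto
      have dg: "dual_map n g \<in> Hom n (dual n Y) (dual n X)" by (rule dual_map_Hom[OF rC'[OF X] rC'[OF Y] g])
      have mono: "is_mono_in n C (dual n Y) (dual n X) (dual_map n g)"
        unfolding is_mono_in_def
      proof (intro conjI dg ballI impI)
        fix W u v assume W: "W \<in> C" and u: "u \<in> Hom n W (dual n Y)" and v: "v \<in> Hom n W (dual n Y)"
          and e: "comp_hom n (dual_map n g) u = comp_hom n (dual_map n g) v"
        have du: "dual_map n u \<in> Hom n Y (dual n W)" and dv: "dual_map n v \<in> Hom n Y (dual n W)"
          using dual_map_Hom[OF rC[OF W] rC[OF dY] u] dual_map_Hom[OF rC[OF W] rC[OF dY] v] by simp_all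
        have "comp_hom n (dual_map n u) g = comp_hom n (dual_map n v) g"
          using dual_map_comp[OF u dg] dual_map_comp[OF v dg] e dual_map_dual_map[OF g] by simp
        then have "dual_map n u = dual_map n v"
          using epi du dv C W unfolding is_epi_in_def by blast
        then show "u = v" using dual_map_dual_map[OF u] dual_map_dual_map[OF v] by metis
      qed
      have "dual_map n h \<in> Hom n (dual n Y) I"
        using dual_map_Hom[OF is_rep_dual[OF I] rC'[OF Y] h] by simp
      then obtain k where k: "k \<in> Hom n (dual n X) I" "comp_hom n k (dual_map n g) = dual_map n h"
        using inj mono dX dY unfolding injective_in_def by blast
      have "dual_map n k \<in> Hom n (dual n I) X" using dual_map_Hom[OF rC[OF dX] I k(1)] by simp
      moreover have "comp_hom n g (dual_map n k) = h"
        using dual_map_comp[OF dg k(1)] dual_map_dual_map[OF g] dual_map_dual_map[OF h] k(2) by simp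
      ultimately show "\<exists>k\<in>Hom n (dual n I) X. comp_hom n g k = h" by blast
    qed
  }
  assume proj: "projective_in n C' (dual n I)"
  show "injective_in n C I"
    unfolding injective_in_def
  proof (intro conjI ballI allI impI)
    show "I \<in> C" using proj C I unfolding projective_in_def by blast
    fix X Y f h assume X: "X \<in> C" and Y: "Y \<in> C" and mono: "is_mono_in n C X Y f" and h: "h \<in> Hom n X I"
    have f: "f \<in> Hom n X Y" using mono by (simp add: is_mono_in_def)
    have dX: "dual n X \<in> C'" and dY: "dual n Y \<in> C'" using C X Y by auto
    have df: "dual_map n f \<in> Hom n (dual n Y) (dual n X)" by (rule dual_map_Hom[OF rC[OF X] rC[OF Y] f])
    have epi: "is_epi_in n C' (dual n Y) (dual n X) (dual_map n f)"
      unfolding is_epi_in_def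
    proof (intro conjI df ballI impI)
      fix W u v assume W: "W \<in> C'" and u: "u \<in> Hom n (dual n X) W" and v: "v \<in> Hom n (dual n X) W"
        and e: "comp_hom n u (dual_map n f) = comp_hom n v (dual_map n f)"
      have du: "dual_map n u \<in> Hom n (dual n W) X" and dv: "dual_map n v \<in> Hom n (dual n W) X"
        using dual_map_Hom[OF rC'[OF dX] rC'[OF W] u] dual_map_Hom[OF rC'[OF dX] rC'[OF W] v] by simp_all
      have "comp_hom n f (dual_map n u) = comp_hom n f (dual_map n v)"
        using dual_map_comp[OF df u] dual_map_comp[OF df v] e dual_map_dual_map[OF f] by simp
      then have "dual_map n u = dual_map n v"
        using mono du dv C' W unfolding is_mono_in_def by blast
      then show "u = v" using dual_map_dual_map[OF u] dual_map_dual_map[OF v] by metis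
    qed
    have "dual_map n h \<in> Hom n (dual n I) (dual n X)" by (rule dual_map_Hom[OF rC[OF X] I h])
    then obtain k where k: "k \<in> Hom n (dual n I) (dual n Y)" "comp_hom n (dual_map n f) k = dual_map n h"
      using proj epi dX dY unfolding projective_in_def by blast
    have "dual_map n k \<in> Hom n Y I" using dual_map_Hom[OF is_rep_dual[OF I] rC'[OF dY] k(1)] by simp
    moreover have "comp_hom n (dual_map n k) f = h"
      using dual_map_comp[OF k(1) df] dual_map_dual_map[OF f] dual_map_dual_map[OF h] k(2) by simp
    ultimately show "\<exists>k\<in>Hom n Y I. comp_hom n k f = h" by blast
  qed
qed

section \<open>Exceptional sequences as chord sequences\<close>

text \<open>A relation, because the entries of a sequence are interval modules only up to
  isomorphism; it is invariant under \<open>seq_iso\<close> and determines \<open>e\<close> on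
  \<open>{..<n}\<close>.\<close>

definition realizes :: "nat \<Rightarrow> 'k::field qrep list \<Rightarrow> (nat \<Rightarrow> nat \<times> nat) \<Rightarrow> bool" where
  "realizes n Es e \<longleftrightarrow> length Es = n \<and> (\<forall>i<n. 1 \<le> fst (e i) \<and> fst (e i) < snd (e i) \<and> snd (e i) \<le> Suc n \<and>
     isomorphic n (Es ! i) (interval (fst (e i)) (snd (e i))))"

lemma realizesD:
  assumes "realizes n Es e" "i < n"
  shows "1 \<le> fst (e i)" "fst (e i) < snd (e i)" "snd (e i) \<le> Suc n"
    "isomorphic n (Es ! i) (interval (fst (e i)) (snd (e i)))" "is_rep n (Es ! i)"
  using assms by (auto simp: realizes_def isomorphic_def)

lemma isomorphic_dim_zero:
  assumes "isomorphic n X Y" "i \<in> {1..n}" "dimv Y i = 0"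
  shows "dimv X i = (0 :: nat)"
proof -
  obtain f g where f: "morphism n X Y f" and g: "morphism n Y X g" and e: "\<And>i. i \<in> {1..n} \<Longrightarrow>
      g i * f i = 1\<^sub>m (dimv X i)"
    by (rule isomorphicE[OF assms(1)]) blast
  have "1\<^sub>m (dimv X i) = g i * f i" using e[OF assms(2)] by simp
  also have "\<dots> = 0\<^sub>m (dimv X i) (dimv X i)"
    using morphism_dim[OF f assms(2)] morphism_dim[OF g assms(2)] assms(3) by (subst mult_through_zero) auto
  finally show ?thesis by (rule one_mat_eq_zero)
qed

lemma isomorphic_interval_rigid_indecomposable:
  assumes ab: "1 \<le> a" "a < b" "b \<le> Suc n" and iso: "isomorphic n M (interval a b)"
  shows "rigid n M" "indecomposable n M"
proof -
  have r: "is_rep n M" using iso by (simp add: isomorphic_def)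
  have z: "xdim n M b = 0"
    using isomorphic_dim_zero[OF iso, of b] ab by (cases "b \<le> n") auto
  have "path_surj n M a b"
    unfolding path_surj_def
  proof
    fix y :: "'a mat" assume y: "y \<in> carrier_mat (xdim n M b) 1"
    show "\<exists>x\<in>carrier_mat (xdim n M a) 1. path n M a b * x = y"
      using y z path_dim[OF r ab(1), of b] ab by (intro bexI[of _ "0\<^sub>m (xdim n M a) 1"] mat_no_rows) auto
  qed
  then show "rigid n M"
    unfolding rigid_def Ext_vanishes_iff[OF r r] isomorphic_no_ext[OF iso r] no_ext_interval[OF r ab] .
  note ind = indecomposable_interval[OF ab, where ?'k = 'a]
  have "\<not> is_zero n M"
    using isomorphic_dim_zero[OF isomorphic_sym[OF iso]] ind unfolding indecomposable_def is_zero_def by blast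
  moreover have "isomorphic n (interval a b) D" if "isomorphic n M D" for D
    using isomorphic_trans[OF isomorphic_sym[OF iso] that] .
  ultimately show "indecomposable n M"
    using ind r unfolding indecomposable_def by blast
qed

text \<open>The later module supplies the chord and the earlier one the representation. Only the
  first argument is replaced by its interval at once; the second is replaced when the condition has
  become the invariant property \<open>path_bij\<close>.\<close>

lemma realizes_vanish:
  assumes R: "realizes n Es e" and ij: "i < n" "j < n"
  shows "Hom_vanishes n (Es ! j) (Es ! i) \<and> Ext_vanishes n (Es ! j) (Es ! i) \<longleftrightarrow>
    (fst (e j) \<in> chord_ivl (e i) \<longleftrightarrow> snd (e j) \<in> chord_ivl (e i))"
proof -
  note i = realizesD[OF R ij(1)] and j = realizesD[OF R ij(2)]
  have "Hom_vanishes n (Es ! j) (Es ! i) \<and> Ext_vanishes n (Es ! j) (Es ! i) \<longleftrightarrow>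
    path_bij n (Es ! i) (fst (e j)) (snd (e j))"
    unfolding Hom_vanishes_iff[OF j(5) i(5)] Ext_vanishes_iff[OF j(5) i(5)]
      isomorphic_no_hom[OF j(4) i(5)] isomorphic_no_ext[OF j(4) i(5)]
      by (rule interval_vanish_iff[OF i(5) j(1-3)])
  also have "\<dots> \<longleftrightarrow> path_bij n (interval (fst (e i)) (snd (e i)) :: 'a qrep) (fst (e j)) (snd (e j))"
    by (rule isomorphic_path_bij[OF i(4) j(1-3)])
  also have "\<dots> \<longleftrightarrow> (fst (e j) \<in> chord_ivl (e i) \<longleftrightarrow> snd (e j) \<in> chord_ivl (e i))"
    by (rule path_bij_interval[OF i(1-3) j(1-3)])
  finally show ?thesis .
qed

lemma realizes_complete_exceptional:
  assumes R: "realizes n Es e"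
  shows "complete_exceptional n Es \<longleftrightarrow> exceptional_on {..<n} e"
proof -
  have l: "length Es = n" using R by (simp add: realizes_def)
  have "is_rep n E \<and> rigid n E \<and> indecomposable n E" if E: "E \<in> set Es" for E
  proof -
    obtain i where i: "i < n" "E = Es ! i" using E l by (auto simp: in_set_conv_nth)
    show ?thesis
      using realizesD[OF R i(1)] isomorphic_interval_rigid_indecomposable[of "fst (e i)" "snd (e i)"
          n "Es ! i"] i
      by blast
  qed
  note ob = this
  have van: "Hom_vanishes n (Es ! j) (Es ! i) \<and> Ext_vanishes n (Es ! j) (Es ! i) \<longleftrightarrow>
      (fst (e j) \<in> chord_ivl (e i) \<longleftrightarrow> snd (e j) \<in> chord_ivl (e i))" if "j < n" "i < j" for i j
    using realizes_vanish[OF R _ that(1)] that by auto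
  show ?thesis
  proof
    assume "complete_exceptional n Es"
    then have "Hom_vanishes n (Es ! j) (Es ! i) \<and> Ext_vanishes n (Es ! j) (Es ! i)" if "j < n" "i < j" for i j
      using that unfolding complete_exceptional_def by blast
    then show "exceptional_on {..<n} e" unfolding exceptional_on_def using van by blast
  next
    assume "exceptional_on {..<n} e"
    then have "fst (e j) \<in> chord_ivl (e i) \<longleftrightarrow> snd (e j) \<in> chord_ivl (e i)" if "j < n" "i < j" for i j
      using that unfolding exceptional_on_def by auto
    then show "complete_exceptional n Es" unfolding complete_exceptional_def using van ob l by blast
  qed
qed

text \<open>Whichever of the two chords comes first, its interval would contain exactly one end of
  the other.\<close>

lemma exceptional_on_noncrossing:
  assumes "exceptional_on L e" "i \<in> L" "j \<in> L"
  shows "\<not> (fst (e i) < fst (e j) \<and> fst (e j) < snd (e i) \<and> snd (e i) < snd (e j))"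
proof -
  have "i < j \<Longrightarrow> fst (e j) \<in> chord_ivl (e i) \<longleftrightarrow> snd (e j) \<in> chord_ivl (e i)"
    "j < i \<Longrightarrow> fst (e i) \<in> chord_ivl (e j) \<longleftrightarrow> snd (e i) \<in> chord_ivl (e j)"
    using assms unfolding exceptional_on_def by blast+
  then show ?thesis by (cases i j rule: linorder_cases) auto
qed

lemma right_perp_drop:
  assumes R: "realizes n Es e"
  shows "right_perp n (direct_sum (drop k Es)) = chord_perp n (e ` {k..<n})"
proof -
  have l: "length Es = n" using R by (simp add: realizes_def)
  have "drop k Es = map ((!) Es) [k..<n]"
    by (rule nth_equalityI) (use l in auto)
  then have set: "set (drop k Es) = (!) Es ` {k..<n}" by simp
  have rep: "is_rep n X" if "X \<in> set (drop k Es)" for X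
    using that realizesD(5)[OF R] unfolding set by auto
  have "Y \<in> right_perp n (direct_sum (drop k Es)) \<longleftrightarrow> Y \<in> chord_perp n (e ` {k..<n})" for Y
  proof (cases "is_rep n Y")
    case True
    have rs: "is_rep n (direct_sum (drop k Es))" by (rule is_rep_direct_sum) (rule rep)
    have vd: "no_hom n (direct_sum (drop k Es)) Y \<longleftrightarrow> (\<forall>X\<in>set (drop k Es). no_hom n X Y)"
      "no_ext n (direct_sum (drop k Es)) Y \<longleftrightarrow> (\<forall>X\<in>set (drop k Es). no_ext n X Y)"
      by (rule vanish_direct_sum; use rep True in blast)+
    have van: "no_hom n (Es ! j) Y \<and> no_ext n (Es ! j) Y \<longleftrightarrow>
        path_bij n Y (fst (e j)) (snd (e j))" if "j < n" for j
      using realizesD[OF R that] True isomorphic_no_hom[OF _ True] isomorphic_no_ext[OF _ True]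
        interval_vanish_iff[OF True] by metis
    have "(\<forall>j\<in>{k..<n}. no_hom n (Es ! j) Y \<and> no_ext n (Es ! j) Y) \<longleftrightarrow>
        (\<forall>j\<in>{k..<n}. path_bij n Y (fst (e j)) (snd (e j)))"
      by (rule ball_cong[OF refl]) (rule van, simp)
    then show ?thesis
      unfolding right_perp_def chord_perp_def mem_Collect_eq
        Hom_vanishes_iff[OF rs True] Ext_vanishes_iff[OF rs True] vd set ball_simps split_beta
      using True by blast
  qed (auto simp: right_perp_def chord_perp_def)
  then show ?thesis by blast
qed

lemma rel_projective_iff:
  assumes R: "realizes n Es e" and exc: "exceptional_on {..<n} e" and i: "i < n"
  shows "rel_projective n Es i \<longleftrightarrow> chord_proj {..<n} {1..Suc n} e i"
proof -
  let ?S = "e ` {Suc i..<n}"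
  note d = realizesD[OF R i]
  have S: "1 \<le> p \<and> p < q \<and> q \<le> Suc n" if "(p, q) \<in> ?S" for p q
    using that realizesD[OF R] by (metis (no_types, lifting) atLeastLessThan_iff fst_conv imageE snd_conv)
  have nc: "\<not> (p < r \<and> r < q \<and> q < s)" if pq: "(p, q) \<in> ?S" and rs: "(r, s) \<in> ?S" for p q r s
  proof -
    obtain j k where "j < n" "k < n" "e j = (p, q)" "e k = (r, s)" using pq rs by auto
    then show ?thesis using exceptional_on_noncrossing[OF exc, of j k] by simp
  qed
  have perp: "c \<in> {fst (e i)..<snd (e i)} \<longleftrightarrow> f \<in> {fst (e i)..<snd (e i)}" if cf: "(c, f) \<in> ?S" for c f
  proof -
    obtain j where "i < j" "j < n" "e j = (c, f)"
      using cf by (metis (no_types, lifting) Suc_le_eq atLeastLessThan_iff imageE)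
    then show ?thesis using exc i unfolding exceptional_on_def by (metis fst_conv lessThan_iff snd_conv)
  qed
  have "rel_projective n Es i \<longleftrightarrow> projective_in n (chord_perp n ?S) (Es ! i)"
    by (simp add: rel_projective_def right_perp_drop[OF R])
  also have "\<dots> \<longleftrightarrow> \<not> (\<exists>l\<in>{1..Suc n}. snd (e i) < l \<and>
      (\<forall>(c, d)\<in>?S. c \<in> {snd (e i)..<l} \<longleftrightarrow> d \<in> {snd (e i)..<l}))"
    by (rule projective_in_isomorphic_interval[OF S nc d(1-3) perp d(4)])
  also have "\<dots> \<longleftrightarrow> chord_proj {..<n} {1..Suc n} e i"
  proof -
    have "(\<forall>(c, d)\<in>?S. c \<in> {snd (e i)..<l} \<longleftrightarrow> d \<in> {snd (e i)..<l}) \<longleftrightarrow> (\<forall>j\<in>{..<n}. i < j \<longrightarrow>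
      (fst (e j) \<in> {snd (e i)..<l} \<longleftrightarrow> snd (e j) \<in> {snd (e i)..<l}))" for l
      unfolding ball_simps split_beta by (meson Suc_le_eq atLeastLessThan_iff lessThan_iff)
    then show ?thesis unfolding chord_proj_def by simp
  qed
  finally show ?thesis .
qed

text \<open>The dual chords are obtained by \<open>v \<mapsto> n + 2 - v\<close>, and a witness
  \<open>l\<close> for them corresponds to \<open>k = n + 2 - l\<close>. The reflection turns
  half-open intervals around, which is the origin of \<open>{k<..fst (e i)}\<close> in
  \<open>chord_inj\<close>.\<close>

lemma rel_injective_iff:
  assumes R: "realizes n Es e" and exc: "exceptional_on {..<n} e" and i: "i < n"
  shows "rel_injective n Es i \<longleftrightarrow> chord_inj {..<n} {1..Suc n} e i"
proof -
  let ?D = "\<lambda>j. (n + 2 - snd (e j), n + 2 - fst (e j))"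
  let ?S = "?D ` {..<i}"
  let ?C = "left_perp n (direct_sum (take i Es))"
  note d = realizesD[OF R i]
  have l: "length Es = n" using R by (simp add: realizes_def)
  have S: "1 \<le> p \<and> p < q \<and> q \<le> Suc n" if pq: "(p, q) \<in> ?S" for p q
  proof -
    obtain j where "j < i" "p = n + 2 - snd (e j)" "q = n + 2 - fst (e j)" using pq by auto
    then show ?thesis using realizesD(1-3)[OF R, of j] i by auto
  qed
  have nc: "\<not> (p < r \<and> r < q \<and> q < s)" if pq: "(p, q) \<in> ?S" and rs: "(r, s) \<in> ?S" for p q r s
  proof -
    obtain j k where jk: "j < i" "k < i" and e: "p = n + 2 - snd (e j)" "q = n + 2 - fst (e j)"
      "r = n + 2 - snd (e k)" "s = n + 2 - fst (e k)" using pq rs by auto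
    then show ?thesis
      using exceptional_on_noncrossing[OF exc, of k j] realizesD(1-3)[OF R, of j] realizesD(1-3)[OF R, of k] i
      by auto
  qed
  let ?a = "n + 2 - snd (e i)" and ?b = "n + 2 - fst (e i)"
  have ab: "1 \<le> ?a" "?a < ?b" "?b \<le> Suc n" using d(1-3) by auto
  have perp: "c \<in> {?a..<?b} \<longleftrightarrow> f \<in> {?a..<?b}" if cf: "(c, f) \<in> ?S" for c f
  proof -
    obtain j where j: "j < i" "c = n + 2 - snd (e j)" "f = n + 2 - fst (e j)" using cf by auto
    have "fst (e i) \<in> chord_ivl (e j) \<longleftrightarrow> snd (e i) \<in> chord_ivl (e j)"
      using exc i j(1) unfolding exceptional_on_def by auto
    then show ?thesis using j d(1-3) realizesD(1-3)[OF R, of j] i by auto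
  qed
  have rep: "is_rep n X" if "X \<in> set (take i Es)" for X
    using that realizesD(5)[OF R] l by (auto simp: in_set_conv_nth)
  have set: "set (take i Es) = (!) Es ` {..<i}" using l i by (auto simp: nth_image[symmetric] atLeast0LessThan)
  have rs: "is_rep n (direct_sum (take i Es))" by (rule is_rep_direct_sum) (rule rep)
  have iso: "isomorphic n (dual n (Es ! j)) (interval (n + 2 - snd (e j)) (n + 2 - fst (e j)))" if "j < n" for j
    using isomorphic_trans[OF isomorphic_dual isomorphic_dual_interval] realizesD(1-4)[OF R that] by blast
  have van: "no_hom n (dual n (Es ! j)) Y \<and> no_ext n (dual n (Es ! j)) Y \<longleftrightarrow>
      path_bij n Y (n + 2 - snd (e j)) (n + 2 - fst (e j))"
    if Y: "is_rep n Y" and j: "j < i" for Y j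
  proof -
    have jn: "j < n" using j i by simp
    have c: "1 \<le> n + 2 - snd (e j)" "n + 2 - snd (e j) < n + 2 - fst (e j)" "n + 2 - fst (e j) \<le> Suc n"
      using realizesD(1-3)[OF R jn] by auto
    show ?thesis
      unfolding isomorphic_no_hom[OF iso[OF jn] Y] isomorphic_no_ext[OF iso[OF jn] Y]
      by (rule interval_vanish_iff[OF Y c])
  qed
  have C: "X \<in> ?C \<longleftrightarrow> is_rep n X \<and> dual n X \<in> chord_perp n ?S" for X
  proof (cases "is_rep n X")
    case True
    note rd = is_rep_dual[OF True]
    have "X \<in> ?C \<longleftrightarrow> no_hom n (dual n (direct_sum (take i Es))) (dual n X) \<and>
        no_ext n (dual n (direct_sum (take i Es))) (dual n X)"
      using True unfolding left_perp_def mem_Collect_eq Hom_vanishes_iff[OF True rs] Ext_vanishes_iff[OF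
          True rs]
        no_hom_dual[OF True rs] no_ext_dual[OF True rs] by simp
    also have "\<dots> \<longleftrightarrow> (\<forall>j<i. path_bij n (dual n X) (n + 2 - snd (e j)) (n + 2 - fst (e j)))"
    proof -
      have "no_hom n (dual n (direct_sum (take i Es))) (dual n X) \<longleftrightarrow>
          (\<forall>Z\<in>set (take i Es). no_hom n (dual n Z) (dual n X))"
        "no_ext n (dual n (direct_sum (take i Es))) (dual n X) \<longleftrightarrow>
            (\<forall>Z\<in>set (take i Es). no_ext n (dual n Z) (dual n X))"
        by (rule vanish_dual_direct_sum; use rep rd in blast)+
      then show ?thesis unfolding set using van[OF rd] by auto
    qed
    also have "\<dots> \<longleftrightarrow> is_rep n X \<and> dual n X \<in> chord_perp n ?S"
      using True rd by (auto simp: chord_perp_def)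
    finally show ?thesis .
  qed (simp add: left_perp_def)
  have C': "is_rep n X \<and> dual n X \<in> ?C" if "X \<in> chord_perp n ?S" for X :: "'a qrep"
  proof -
    have rX: "is_rep n X" using that by (simp add: chord_perp_def)
    have "isomorphic n X (dual n (dual n X))"
      by (rule isomorphic_sym[OF agree_isomorphic[OF agree_dual_dual]]) (intro is_rep_dual rX)
    then have "dual n (dual n X) \<in> chord_perp n ?S" by (rule isomorphic_chord_perp[OF _ S that])
    then show ?thesis using C rX is_rep_dual by blast
  qed
  have "rel_injective n Es i \<longleftrightarrow> projective_in n (chord_perp n ?S) (dual n (Es ! i))"
    unfolding rel_injective_def by (rule injective_in_dual[OF C C' d(5)])
  also have "\<dots> \<longleftrightarrow> \<not> (\<exists>l\<in>{1..Suc n}. ?b < l \<and> (\<forall>(c, d)\<in>?S. c \<in> {?b..<l} \<longleftrightarrow> d \<in> {?b..<l}))"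
    by (rule projective_in_isomorphic_interval[OF S nc ab perp iso[OF i]])
  also have "(\<exists>l\<in>{1..Suc n}. ?b < l \<and> (\<forall>(c, d)\<in>?S. c \<in> {?b..<l} \<longleftrightarrow> d \<in> {?b..<l})) \<longleftrightarrow>
    (\<exists>k\<in>{1..Suc n}. k < fst (e i) \<and> (\<forall>j\<in>{..<n}. j < i \<longrightarrow>
      (fst (e j) \<in> {k<..fst (e i)} \<longleftrightarrow> snd (e j) \<in> {k<..fst (e i)})))" (is "(\<exists>l\<in>_. ?P l) \<longleftrightarrow> (\<exists>k\<in>_. ?Q k)")
  proof -
    have eq: "?P (n + 2 - k) \<longleftrightarrow> ?Q k" if k: "k \<in> {1..Suc n}" for k
    proof -
      have 1: "?b < n + 2 - k \<longleftrightarrow> k < fst (e i)" using k d(1-3) by auto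
      have 2: "(n + 2 - snd (e j) \<in> {?b..<n + 2 - k} \<longleftrightarrow> n + 2 - fst (e j) \<in> {?b..<n + 2 - k}) \<longleftrightarrow>
        (fst (e j) \<in> {k<..fst (e i)} \<longleftrightarrow> snd (e j) \<in> {k<..fst (e i)})" if "j < i" for j
        using k d(1-3) realizesD(1-3)[OF R, of j] that i by auto
      have "(\<forall>(c, d)\<in>?S. c \<in> {?b..<n + 2 - k} \<longleftrightarrow> d \<in> {?b..<n + 2 - k}) \<longleftrightarrow>
        (\<forall>j\<in>{..<i}. fst (e j) \<in> {k<..fst (e i)} \<longleftrightarrow> snd (e j) \<in> {k<..fst (e i)})"
        using 2 by (simp add: ball_simps)
      note 3 = this
      have 4: "(\<forall>j\<in>{..<n}. j < i \<longrightarrow> X j) \<longleftrightarrow> (\<forall>j\<in>{..<i}. X j)" for X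
        using i by (meson lessThan_iff less_trans)
      show ?thesis by (simp only: 1 3 4)
    qed
    have bij: "n + 2 - k \<in> {1..Suc n}" "n + 2 - (n + 2 - k) = k" if "k \<in> {1..Suc n}" for k using that by auto
    show ?thesis
    proof
      assume "\<exists>l\<in>{1..Suc n}. ?P l"
      then obtain l where l: "l \<in> {1..Suc n}" "?P l" by blast
      have "?P (n + 2 - (n + 2 - l))" unfolding bij(2)[OF l(1)] by (rule l(2))
      then have "?Q (n + 2 - l)" by (rule iffD1[OF eq[OF bij(1)[OF l(1)]]])
      then show "\<exists>k\<in>{1..Suc n}. ?Q k" using bij(1)[OF l(1)] by (rule bexI)
    next
      assume "\<exists>k\<in>{1..Suc n}. ?Q k"
      then obtain k where k: "k \<in> {1..Suc n}" "?Q k" by blast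
      have "?P (n + 2 - k)" using k(2) by (rule iffD2[OF eq[OF k(1)]])
      then show "\<exists>l\<in>{1..Suc n}. ?P l" using bij(1)[OF k(1)] by (rule bexI)
    qed
  qed
  finally show ?thesis unfolding chord_inj_def .
qed

lemma prod_indicator_power:
  fixes x :: "'a::comm_monoid_mult"
  assumes "finite A"
  shows "(\<Prod>i\<in>A. if P i then x else 1) = x ^ card {i \<in> A. P i}"
  using prod.inter_filter[OF assms, of "\<lambda>_. x" P] by simp

lemma realizes_monomial:
  fixes x y z :: "'a::comm_ring_1"
  assumes R: "realizes n Es e" and exc: "exceptional_on {..<n} e"
  shows "x ^ num_p n Es * y ^ num_q n Es * z ^ num_r n Es =
      (\<Prod>i\<in>{..<n}. chord_weight x y z {..<n} {1..Suc n} e i)"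
proof -
  let ?p = "chord_proj {..<n} {1..Suc n} e" and ?q = "chord_inj {..<n} {1..Suc n} e"
  have l: "length Es = n" using R by (simp add: realizes_def)
  have num: "num_p n Es = card {i \<in> {..<n}. ?p i \<and> \<not> ?q i}" "num_q n Es = card {i \<in> {..<n}. ?q i \<and> \<not> ?p i}"
    "num_r n Es = card {i \<in> {..<n}. ?p i \<and> ?q i}"
    unfolding num_p_def num_q_def num_r_def l
    by (rule arg_cong[where f = card], use rel_projective_iff[OF R exc] rel_injective_iff[OF R exc] in auto)+
  have "(\<Prod>i\<in>{..<n}. chord_weight x y z {..<n} {1..Suc n} e i) =
    (\<Prod>i\<in>{..<n}. (if ?p i \<and> \<not> ?q i then x else 1) * (if ?q i \<and> \<not> ?p i then y else 1) * (if ?p i \<and>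
        ?q i then z else 1))"
    by (rule prod.cong) (auto simp: chord_weight_def)
  then show ?thesis unfolding num by (simp add: prod.distrib prod_indicator_power)
qed

section \<open>Isomorphism classes of sequences and the generating function\<close>

definition interval_seq :: "nat \<Rightarrow> (nat \<Rightarrow> nat \<times> nat) \<Rightarrow> 'k::field qrep list" where
  "interval_seq n e = map (\<lambda>i. interval (fst (e i)) (snd (e i))) [0..<n]"

lemma realizes_interval_seq: "e \<in> chord_seqs {..<n} {1..Suc n} \<Longrightarrow> realizes n (interval_seq n e) e"
  by (auto simp: realizes_def interval_seq_def chord_seqs_def PiE_def Pi_def isomorphic_refl is_rep_interval
      dest!: chordsD)

lemma realizes_seq_iso:
  assumes "realizes n Es e" "(Es, Fs) \<in> seq_iso n"
  shows "realizes n Fs e"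
proof -
  have F: "length Fs = n" "\<And>i. i < n \<Longrightarrow> isomorphic n (Es ! i) (Fs ! i)"
    using assms by (auto simp: seq_iso_def list_all2_conv_all_nth realizes_def)
  show ?thesis
    unfolding realizes_def
    using F(1) realizesD(1-3)[OF assms(1)] isomorphic_trans[OF isomorphic_sym[OF F(2)] realizesD(4)[OF
        assms(1)]]
    by blast
qed

lemma realizes_unique:
  assumes "realizes n Es e" "realizes n Es e'" "i < n"
  shows "e i = e' i"
proof -
  note d = realizesD[OF assms(1,3)] and d' = realizesD[OF assms(2,3)]
  have "fst (e i) = fst (e' i) \<and> snd (e i) = snd (e' i)"
    by (rule isomorphic_interval_eq[OF isomorphic_trans[OF isomorphic_sym[OF d(4)] d'(4)] d(1-3) d'(1-3)])
  then show ?thesis by (simp add: prod_eq_iff)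
qed

lemma complete_exceptional_realizes:
  assumes "complete_exceptional n Es"
  obtains e where "realizes n Es e" "e \<in> chord_seqs {..<n} {1..Suc n}"
proof -
  have l: "length Es = n" and ind: "\<And>i. i < n \<Longrightarrow> indecomposable n (Es ! i)"
    using assms by (auto simp: complete_exceptional_def)
  have "\<exists>p. 1 \<le> fst p \<and> fst p < snd p \<and> snd p \<le> Suc n \<and> isomorphic n (Es ! i) (interval (fst p) (snd p))"
      if "i < n" for i
    by (rule indecomposable_isomorphic_interval[OF ind[OF that]]) (metis fst_conv snd_conv)
  then obtain e where e: "\<And>i. i < n \<Longrightarrow> 1 \<le> fst (e i) \<and> fst (e i) < snd (e i) \<and> snd (e i) \<le> Suc n \<and>
      isomorphic n (Es ! i) (interval (fst (e i)) (snd (e i)))" by metis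
  let ?e = "restrict e {..<n}"
  have R: "realizes n Es ?e" using e l by (auto simp: realizes_def)
  moreover have "?e \<in> {..<n} \<rightarrow>\<^sub>E chords {1..Suc n}"
    using e by (force simp: chords_def split_beta)
  ultimately show ?thesis
    using that realizes_complete_exceptional[OF R] assms by (simp add: chord_seqs_def)
qed

text \<open>Surjectivity rests on the classification of the indecomposable modules, injectivity on
  the fact that the isomorphism class of an interval module determines its chord.\<close>

lemma bij_betw_exceptional_classes:
  "bij_betw (\<lambda>e. seq_iso n `` {interval_seq n e}) (chord_seqs {..<n} {1..Suc n})
    (exceptional_classes n :: 'k::field qrep list set set)"
  unfolding bij_betw_def
proof
  let ?I = "interval_seq n :: _ \<Rightarrow> 'k qrep list"
  have ce: "complete_exceptional n (?I e)" if "e \<in> chord_seqs {..<n} {1..Suc n}" for e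
    using that realizes_complete_exceptional[OF realizes_interval_seq[OF that]] by (simp add: chord_seqs_def)
  show "inj_on (\<lambda>e. seq_iso n `` {?I e}) (chord_seqs {..<n} {1..Suc n})"
  proof (rule inj_onI)
    fix e e' assume e: "e \<in> chord_seqs {..<n} {1..Suc n}" and e': "e' \<in> chord_seqs {..<n} {1..Suc n}"
      and eq: "seq_iso n `` {?I e} = seq_iso n `` {?I e'}"
    have "(?I e, ?I e') \<in> seq_iso n"
      by (rule eq_equiv_class[OF eq equiv_seq_iso]) (use ce[OF e'] in simp)
    then have R: "realizes n (?I e') e" by (rule realizes_seq_iso[OF realizes_interval_seq[OF e]])
    have "e i = e' i" if "i < n" for i
      by (rule realizes_unique[OF R realizes_interval_seq[OF e'] that])
    then show "e = e'" using e e' by (intro PiE_ext[of e "{..<n}"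
        "\<lambda>_. chords {1..Suc n}"]) (auto simp: chord_seqs_def)
  qed
  show "(\<lambda>e. seq_iso n `` {?I e}) ` chord_seqs {..<n} {1..Suc n} = exceptional_classes n"
  proof (intro equalityI subsetI)
    fix C assume "C \<in> (\<lambda>e. seq_iso n `` {?I e}) ` chord_seqs {..<n} {1..Suc n}"
    then show "C \<in> exceptional_classes n"
      using ce by (auto simp: exceptional_classes_def intro!: quotientI)
  next
    fix C :: "'k qrep list set" assume "C \<in> exceptional_classes n"
    then obtain Es where Es: "complete_exceptional n Es" "C = seq_iso n `` {Es}"
      by (auto simp: exceptional_classes_def quotient_def)
    obtain e where e: "realizes n Es e" "e \<in> chord_seqs {..<n} {1..Suc n}"
      by (rule complete_exceptional_realizes[OF Es(1)])
    have "(?I e, Es) \<in> seq_iso n"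
      using e Es(1) ce[OF e(2)] realizesD(4)[OF e(1)] isomorphic_sym
      by (auto simp: seq_iso_def list_all2_conv_all_nth realizes_def interval_seq_def)
    then have "seq_iso n `` {?I e} = C" unfolding Es(2) by (rule equiv_class_eq[OF equiv_seq_iso])
    then show "C \<in> (\<lambda>e. seq_iso n `` {?I e}) ` chord_seqs {..<n} {1..Suc n}" using e(2) by blast
  qed
qed

theorem theoremC:
  fixes n :: nat
  assumes "n \<ge> 1"
  shows "(\<Sum>C\<in>(exceptional_classes n :: 'k::field qrep list set set).
            var Ind_a ^ num_p n (class_rep C) *
            var Ind_b ^ num_q n (class_rep C) *
            var Ind_c ^ num_r n (class_rep C))
         = var Ind_c *
           (\<Prod>j = 1..n - 1. of_nat j * var Ind_a + of_nat (n - j) * var Ind_b + var Ind_c)"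
proof -
  let ?I = "interval_seq n :: _ \<Rightarrow> 'k qrep list"
  let ?x = "var Ind_a" and ?y = "var Ind_b" and ?z = "var Ind_c"
  let ?w = "\<lambda>C :: 'k qrep list set. ?x ^ num_p n (class_rep C) * ?y ^ num_q n (class_rep C)
      * ?z ^ num_r n (class_rep C)"
  have "?w (seq_iso n `` {?I e}) = (\<Prod>i\<in>{..<n}. chord_weight ?x ?y ?z {..<n} {1..Suc n} e i)"
    if e: "e \<in> chord_seqs {..<n} {1..Suc n}" for e
  proof -
    let ?C = "seq_iso n `` {?I e}"
    note R = realizes_interval_seq[OF e, where ?'a = 'k]
    have exc: "exceptional_on {..<n} e" using e by (simp add: chord_seqs_def)
    have "?I e \<in> ?C"
      by (rule equiv_class_self[OF equiv_seq_iso]) (simp add: realizes_complete_exceptional[OF R] exc)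
    \<comment> \<open>The chosen representative need not consist of interval modules, but it
      realizes the same chords, and the three numbers depend only on these.\<close>
    then have "class_rep ?C \<in> ?C" unfolding class_rep_def by (rule someI)
    then have "realizes n (class_rep ?C) e" using realizes_seq_iso[OF R] by blast
    then show ?thesis by (rule realizes_monomial[OF _ exc])
  qed
  then have "sum ?w (exceptional_classes n) =
      (\<Sum>e\<in>chord_seqs {..<n} {1..Suc n}. \<Prod>i\<in>{..<n}. chord_weight ?x ?y ?z {..<n} {1..Suc n} e i)"
    by (subst sum.reindex_bij_betw[OF bij_betw_exceptional_classes, symmetric]) (rule sum.cong, auto)
  also have "\<dots> = abel_prod ?x ?y n ?z"
    using chord_seqs_generating_function[of "{..<n}" "{1..Suc n}" ?x ?y ?z] by simp
  also have "\<dots> = ?z * (\<Prod>j=1..n-1. of_nat j * ?x + of_nat (n - j) * ?y + ?z)"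
    by (rule abel_prod_eq[OF assms])
  finally show ?thesis .
qed

end
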